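(* Let $\bar x\in\Gamma$ be a stationary point of problem (P), and let MSCQ hold at $\bar x$ with modulus $\sigma>0$. Let $\kappa>0$. Then the following three assertions are equivalent: (i) $\bar x$ is a tilt-stable local minimizer of (P) with modulus $\kappa$. (ii) There exists $\eta>0$ such that $$\big\langle\big(\nabla^2 f(x)+\nabla^2\langle\lambda,g\rangle(x)+\mathcal H(x,\lambda)\big)u,u\big\rangle\ge\frac1\kappa$$ whenever $x\in\Gamma\cap\mathbb B_\eta(\bar x)$, $x^*\in\mathbb R^n$ with $\|x^*\|\le\eta$, $u\in K_\Gamma\big(x,x^*-\nabla f(x)\big)\cap\mathcal S$, and $\lambda\in\Lambda\big(x,x^*-\nabla f(x);u\big)\cap\sigma\|x^*-\nabla f(x)\|\mathbb B$. (iii) There exists $\eta>0$ such that the same inequality holds whenever $x\in\Gamma\cap\mathbb B_\eta(\bar x)$, $\|x^*\|\le\eta$, $u\in K_\Gamma\big(x,x^*-\nabla f(x)\big)\cap\mathcal S$, and $\lambda\in\Lambda\big(x,x^*-\nabla f(x);u\big)\cap\Lambda^0\big(x,x^*-\nabla f(x)\big)$. Moreover, the exact bound of tilt stability is $$\mathrm{tilt}(f+\delta_\Gamma,\bar x)=\inf_{\eta>0}\sup\Big\{\frac{1}{\big\langle\big(\nabla^2 f(x)+\nabla^2\langle\lambda,g\rangle(x)+\mathcal H(x,\lambda)\big)u,u\big\rangle}\;\Big|\;x\in\Gamma\cap\mathbb B_\eta(\bar x),\ \|x^*\|\le\eta,\ u\in K_\Gamma\big(x,x^*-\nabla f(x)\big)\cap\mathcal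 S,\ \lambda\in\Lambda\big(x,x^*-\nabla f(x);u\big)\cap\sigma\|x^*-\nabla f(x)\|\mathbb B\Big\}.$$
   Context: Setting. Let $n,m\ge1$ and let $\mathcal Q:=\{(q_0,q_r)\in\mathbb R\times\mathbb R^m:\|q_r\|\le q_0\}$ be the second-order cone. For $q=(q_0,q_r)\in\mathbb R^{1+m}$ write $\hat q:=(-q_0,q_r)$, and let $\mathcal Q^*:=\{\hat q: q\in\mathcal Q\}=\{(q_0,q_r):\|q_r\|\le-q_0\}$. The normal cone to $\mathcal Q$ at $q\in\mathcal Q$ is $N_{\mathcal Q}(q)=\mathcal Q^*$ if $q=0$, $N_{\mathcal Q}(q)=\{0\}$ if $q\in\operatorname{int}\mathcal Q$, and $N_{\mathcal Q}(q)=\{\alpha\hat q:\alpha\ge0\}$ if $q\in\operatorname{bd}\mathcal Q\setminus\{0\}$. Problem (P) is: minimize $f(x)$ subject to $x\in\Gamma:=\{x\in\mathbb R^n: g(x)\in\mathcal Q\}$, where $f:\mathbb R^n\to\mathbb R$ and $g=(g_0,g_r):\mathbb R^n\to\mathbb R\times\mathbb R^m$ are $C^2$-smooth around a point $\bar x\in\Gamma$ with $g(\bar x)=0$. $\nabla g(x)$ is the Jacobian, $\nabla g(x)^*$ its transpose, $\nabla^2 g(x)(u,v)\in\mathbb R^{1+m}$ is the vector with components $u^T\nabla^2 g_i(x)v$, and $\nabla^2\langle\lambda,g\rangle(x)=\sum_i\lambda_i\nabla^2 g_i(x)$. $\mathcal S$ is the unit sphere, $\mathbb B$ the closed unit ball,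 $\mathbb B_\eta(x)=x+\eta\mathbb B$, and $r\mathbb B$ the closed ball of radius $r$ about $0$. MSCQ. The metric subregularity constraint qualification (MSCQ) holds at $\bar x$ with modulus $\sigma>0$ if there is a neighborhood $U$ of $\bar x$ with $\operatorname{dist}(x;\Gamma)\le\sigma\operatorname{dist}(g(x);\mathcal Q)$ for all $x\in U$. Multipliers and cones. $T_\Gamma(x)$ is the Bouligand tangent cone $\{v:\exists t_k\downarrow0,\ v_k\to v,\ x+t_kv_k\in\Gamma\}$. For $x\in\Gamma$, $x^*\in\mathbb R^n$: $\Lambda(x,x^* ):=\{\lambda\in N_{\mathcal Q}(g(x)):\nabla g(x)^*\lambda=x^*\}$; $\Lambda^0(x,x^* ):=\{0\}$ if $x^*=0$ and $\Lambda^0(x,x^* ):=\Lambda(x,x^* )$ otherwise; the critical cone is $K_\Gamma(x,x^* ):=\{u\in T_\Gamma(x):\langle x^*,u\rangle=0\}$. The curvature mapping is $\mathcal H(x,\lambda):=\frac{-\lambda_0}{g_0(x)}\big(\nabla g_r(x)^*\nabla g_r(x)-\nabla g_0(x)^*\nabla g_0(x)\big)$ if $g(x)\in\operatorname{bd}\mathcal Q\setminus\{0\}$ and $\mathcal H(x,\lambda):=0$ otherwise. The directional multiplier set is $\Lambda(x,x^*;u):=\operatorname{argmax}_{\lambda\in\Lambda(x,x^* )}\langle(\nabla^2\langle\lambda,g\rangle(x)+\mathcal H(x,\lambda))u,u\rangle$. Stationarity and tilt stability. $\bar x$ is a stationary point of (P) if $-\nabla f(\bar x)\in N_\Gamma(\bar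 x)$, where $N_\Gamma$ is the limiting (Mordukhovich) normal cone. Let $\varphi:=f+\delta_\Gamma$ ($\delta_\Gamma$ the indicator function of $\Gamma$). $\bar x$ is a tilt-stable local minimizer of (P) with modulus $\kappa>0$ if there is $\gamma>0$ such that $M_\gamma(v^* ):=\operatorname{argmin}\{\varphi(x)-\langle v^*,x\rangle:\|x-\bar x\|\le\gamma\}$ is single-valued and Lipschitz continuous with constant $\kappa$ on a neighborhood of $0$, with $M_\gamma(0)=\{\bar x\}$. The exact bound of tilt stability is $\mathrm{tilt}(\varphi,\bar x):=\inf_{\gamma>0}\operatorname{lip}M_\gamma(0)$, where $\operatorname{lip}M_\gamma(0)$ is the infimum of the Lipschitz constants of $M_\gamma$ on neighborhoods of $0$.
   Formalization: The exact-bound formula is stated only when x̄ is tilt-stable (it fails e.g. for g≡0, f=−‖x‖²/2); lip M_γ(0) counts only γ with M_γ single-valued near 0 and M_γ(0)={x̄}; the supremum of the empty set is taken as 0. *)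

theory Defs
  imports "HOL-Analysis.Analysis"
begin

text \<open>Setting: R^n is an abstract euclidean space 'a, R^m is 'b, and R^{1+m} = real \<times> 'b.
 g = (g_0, g_r) :: 'a \<Rightarrow> real \<times> 'b.  Derivatives are given as explicit data:
 gradient f' x :: 'a, Hessian f'' x :: 'a \<Rightarrow>L 'a, Jacobian Dg x, second derivative D2g x.\<close>

definition soc :: "(real \<times> 'b::euclidean_space) set" where
  "soc = {q. norm (snd q) \<le> fst q}"

definition hat :: "real \<times> 'b::euclidean_space \<Rightarrow> real \<times> 'b" where
  "hat q = (- fst q, snd q)"

definition soc_dual :: "(real \<times> 'b::euclidean_space) set" where
  "soc_dual = {hat q | q. q \<in> soc}"

definition normal_soc :: "real \<times> 'b::euclidean_space \<Rightarrow> (real \<times> 'b) set" where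
  "normal_soc q = (if q = 0 then soc_dual
                   else if q \<in> interior soc then {0}
                   else if q \<in> frontier soc then {\<alpha> *\<^sub>R hat q | \<alpha>. \<alpha> \<ge> 0}
                   else {})"

definition feas :: "('a \<Rightarrow> real \<times> 'b::euclidean_space) \<Rightarrow> 'a set" where
  "feas g = {x. g x \<in> soc}"

definition C2_around_f :: "('a::euclidean_space \<Rightarrow> real) \<Rightarrow> ('a \<Rightarrow> 'a) \<Rightarrow> ('a \<Rightarrow> 'a \<Rightarrow>\<^sub>L 'a) \<Rightarrow> 'a \<Rightarrow> bool" where
  "C2_around_f f f' f'' xbar = (\<exists>U. open U \<and> xbar \<in> U \<and>
     (\<forall>x\<in>U. (f has_derivative (\<lambda>h. f' x \<bullet> h)) (at x)) \<and>
     (\<forall>x\<in>U. (f' has_derivative blinfun_apply (f'' x)) (at x)) \<and>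
     continuous_on U f'')"

definition C2_around_g :: "('a::euclidean_space \<Rightarrow> real \<times> 'b::euclidean_space) \<Rightarrow>
     ('a \<Rightarrow> 'a \<Rightarrow>\<^sub>L (real \<times> 'b)) \<Rightarrow> ('a \<Rightarrow> 'a \<Rightarrow>\<^sub>L 'a \<Rightarrow>\<^sub>L (real \<times> 'b)) \<Rightarrow> 'a \<Rightarrow> bool" where
  "C2_around_g g Dg D2g xbar = (\<exists>U. open U \<and> xbar \<in> U \<and>
     (\<forall>x\<in>U. (g has_derivative blinfun_apply (Dg x)) (at x)) \<and>
     (\<forall>x\<in>U. (Dg has_derivative blinfun_apply (D2g x)) (at x)) \<and>
     continuous_on U D2g)"

definition mscq :: "('a::euclidean_space \<Rightarrow> real \<times> 'b::euclidean_space) \<Rightarrow> 'a \<Rightarrow> real \<Rightarrow> bool" where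
  "mscq g xbar \<sigma> = (\<exists>U. open U \<and> xbar \<in> U \<and>
     (\<forall>x\<in>U. infdist x (feas g) \<le> \<sigma> * infdist (g x) soc))"

definition tangent_cone :: "'a::euclidean_space set \<Rightarrow> 'a \<Rightarrow> 'a set" where
  "tangent_cone S x = {v. \<exists>t w. (\<forall>k. 0 < t k) \<and> t \<longlonglongrightarrow> 0 \<and> w \<longlonglongrightarrow> v \<and>
                         (\<forall>k. x + t k *\<^sub>R w k \<in> S)}"

definition regular_normal :: "'a::euclidean_space set \<Rightarrow> 'a \<Rightarrow> 'a set" where
  "regular_normal S x = {v. \<forall>\<epsilon>>0. \<exists>\<delta>>0. \<forall>y\<in>S. norm (y - x) < \<delta> \<longrightarrow> v \<bullet> (y - x) \<le> \<epsilon> * norm (y - x)}"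

definition limiting_normal :: "'a::euclidean_space set \<Rightarrow> 'a \<Rightarrow> 'a set" where
  "limiting_normal S x = {v. \<exists>xs vs. (\<forall>k. xs k \<in> S \<and> vs k \<in> regular_normal S (xs k)) \<and>
                            xs \<longlonglongrightarrow> x \<and> vs \<longlonglongrightarrow> v}"

definition stationary :: "('a::euclidean_space \<Rightarrow> 'a) \<Rightarrow> ('a \<Rightarrow> real \<times> 'b::euclidean_space) \<Rightarrow> 'a \<Rightarrow> bool" where
  "stationary f' g xbar = (- f' xbar \<in> limiting_normal (feas g) xbar)"

definition mults :: "('a::euclidean_space \<Rightarrow> real \<times> 'b::euclidean_space) \<Rightarrow> ('a \<Rightarrow> 'a \<Rightarrow>\<^sub>L (real \<times> 'b)) \<Rightarrow>
     'a \<Rightarrow> 'a \<Rightarrow> (real \<times> 'b) set" where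
  "mults g Dg x xs = {lam \<in> normal_soc (g x). \<forall>h. lam \<bullet> blinfun_apply (Dg x) h = xs \<bullet> h}"

definition mults0 :: "('a::euclidean_space \<Rightarrow> real \<times> 'b::euclidean_space) \<Rightarrow> ('a \<Rightarrow> 'a \<Rightarrow>\<^sub>L (real \<times> 'b)) \<Rightarrow>
     'a \<Rightarrow> 'a \<Rightarrow> (real \<times> 'b) set" where
  "mults0 g Dg x xs = (if xs = 0 then {0} else mults g Dg x xs)"

definition crit_cone :: "'a::euclidean_space set \<Rightarrow> 'a \<Rightarrow> 'a \<Rightarrow> 'a set" where
  "crit_cone S x xs = {u \<in> tangent_cone S x. xs \<bullet> u = 0}"

text \<open>Quadratic form of the curvature mapping: <H(x,lam)u,u>\<close>
definition curv :: "('a::euclidean_space \<Rightarrow> real \<times> 'b::euclidean_space) \<Rightarrow> ('a \<Rightarrow> 'a \<Rightarrow>\<^sub>L (real \<times> 'b)) \<Rightarrow>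
     'a \<Rightarrow> real \<times> 'b \<Rightarrow> 'a \<Rightarrow> real" where
  "curv g Dg x lam u = (if g x \<in> frontier soc - {0}
       then (- fst lam / fst (g x)) *
            ((norm (snd (blinfun_apply (Dg x) u)))\<^sup>2 - (fst (blinfun_apply (Dg x) u))\<^sup>2)
       else 0)"

definition lagr_quad :: "('a::euclidean_space \<Rightarrow> real \<times> 'b::euclidean_space) \<Rightarrow> ('a \<Rightarrow> 'a \<Rightarrow>\<^sub>L (real \<times> 'b)) \<Rightarrow>
     ('a \<Rightarrow> 'a \<Rightarrow>\<^sub>L 'a \<Rightarrow>\<^sub>L (real \<times> 'b)) \<Rightarrow> 'a \<Rightarrow> real \<times> 'b \<Rightarrow> 'a \<Rightarrow> real" where
  "lagr_quad g Dg D2g x lam u = lam \<bullet> blinfun_apply (blinfun_apply (D2g x) u) u + curv g Dg x lam u"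

definition dir_mults :: "('a::euclidean_space \<Rightarrow> real \<times> 'b::euclidean_space) \<Rightarrow> ('a \<Rightarrow> 'a \<Rightarrow>\<^sub>L (real \<times> 'b)) \<Rightarrow>
     ('a \<Rightarrow> 'a \<Rightarrow>\<^sub>L 'a \<Rightarrow>\<^sub>L (real \<times> 'b)) \<Rightarrow> 'a \<Rightarrow> 'a \<Rightarrow> 'a \<Rightarrow> (real \<times> 'b) set" where
  "dir_mults g Dg D2g x xs u = {lam \<in> mults g Dg x xs.
      \<forall>mu \<in> mults g Dg x xs. lagr_quad g Dg D2g x mu u \<le> lagr_quad g Dg D2g x lam u}"

definition Mtilt :: "('a::euclidean_space \<Rightarrow> real) \<Rightarrow> ('a \<Rightarrow> real \<times> 'b::euclidean_space) \<Rightarrow> 'a \<Rightarrow> real \<Rightarrow> 'a \<Rightarrow> 'a set" where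
  "Mtilt f g xbar \<gamma> v = {x \<in> feas g. norm (x - xbar) \<le> \<gamma> \<and>
      (\<forall>y \<in> feas g. norm (y - xbar) \<le> \<gamma> \<longrightarrow> f x - v \<bullet> x \<le> f y - v \<bullet> y)}"

definition tilt_stable :: "('a::euclidean_space \<Rightarrow> real) \<Rightarrow> ('a \<Rightarrow> real \<times> 'b::euclidean_space) \<Rightarrow> 'a \<Rightarrow> real \<Rightarrow> bool" where
  "tilt_stable f g xbar \<kappa> = (\<exists>\<gamma>>0. \<exists>V m. open V \<and> 0 \<in> V \<and> Mtilt f g xbar \<gamma> 0 = {xbar} \<and>
      (\<forall>v\<in>V. Mtilt f g xbar \<gamma> v = {m v}) \<and>
      (\<forall>v\<in>V. \<forall>w\<in>V. dist (m v) (m w) \<le> \<kappa> * dist v w))"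

text \<open>lip M_gamma(0): infimum of Lipschitz constants of (single-valued) M_gamma on
  neighbourhoods of 0 (localized at (0, xbar)); +infinity if there are none.\<close>
definition lipM :: "('a::euclidean_space \<Rightarrow> real) \<Rightarrow> ('a \<Rightarrow> real \<times> 'b::euclidean_space) \<Rightarrow> 'a \<Rightarrow> real \<Rightarrow> ereal" where
  "lipM f g xbar \<gamma> = Inf {ereal c | c. c \<ge> 0 \<and> (\<exists>V m. open V \<and> 0 \<in> V \<and> Mtilt f g xbar \<gamma> 0 = {xbar} \<and>
      (\<forall>v\<in>V. Mtilt f g xbar \<gamma> v = {m v}) \<and>
      (\<forall>v\<in>V. \<forall>w\<in>V. dist (m v) (m w) \<le> c * dist v w))}"

definition tilt_bound :: "('a::euclidean_space \<Rightarrow> real) \<Rightarrow> ('a \<Rightarrow> real \<times> 'b::euclidean_space) \<Rightarrow> 'a \<Rightarrow> ereal" where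
  "tilt_bound f g xbar = (INF \<gamma>\<in>{0<..}. lipM f g xbar \<gamma>)"

end

theory Submission
  imports Defs
begin

text \<open>
  Metric subregularity, tested along arcs \<open>x + t u + (t\<^sup>2/2) w\<close>, and a minimax argument show that for a
  critical direction \<open>u\<close> the least value of \<open>-y \<bullet> w\<close> over feasible arcs equals the largest value of
  the Lagrangian form over the multipliers \<open>\<lambda>\<close> of \<open>y\<close> with \<open>\<parallel>\<lambda>\<parallel> \<le> \<sigma> \<parallel>y\<parallel>\<close>. In particular
  directional multipliers exist within this bound, so conditions (ii) and (iii) say the same.

  Necessity: a \<open>\<kappa>\<close>-Lipschitz solution map of the tilted problems is the gradient of a convex function,
  and conjugation gives uniform quadratic growth with constant \<open>1/(2\<kappa>)\<close>; this is evaluated along the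
  arcs above.

  Sufficiency: the bounded multipliers make \<open>\<Gamma>\<close> prox-regular, so for large \<open>r\<close> the proximal mapping
  \<open>P y = argmin f + (r/2) \<parallel>\<cdot> - y\<parallel>\<^sup>2\<close> is single-valued and Lipschitz near \<open>xbar\<close>. The second-order condition
  bounds its directional difference quotients, hence \<open>P\<close> has Lipschitz constant \<open>r\<kappa>/(1 + r\<kappa>) < 1\<close>.
  Solutions of the tilted problem for \<open>v\<close> are the points \<open>x = P (x + v/r)\<close>, which gives the modulus \<open>\<kappa>\<close>,
  and the Moreau envelope has \<open>xbar\<close> as its only local minimizer.
\<close>

section \<open>Geometry of the second-order cone\<close>

text \<open>No regularity of the Jacobian is available, so multiplier sets may be unbounded and may
  change abruptly with the point. What stays uniform is \<sigma>: subregularity is assumed on a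
  whole neighborhood, hence with the same constant at every nearby feasible point. For each
  curvature \<open>w\<close> the distance estimate certifies with a bounded normal that may depend
  on \<open>w\<close>. The minimax step exchanges the quantifiers; it needs a form linear in the
  multiplier, which is why the curvature term is written as a vector.

  In the sufficiency part the second-order condition speaks only of points with normals. It does not
  directly make \<open>xbar\<close> a local minimizer, and tilted minimizers over a ball might lie
  on its sphere. The Moreau envelope helps because it is continuous on a full ball, where a
  minimizer exists and can be moved toward \<open>xbar\<close> along a possibly infeasible segment.

  In the necessity part growth is available at first only at points \<open>m v\<close>. A resolvent
  argument in the space of tilts shows that every nearby pair of a point and a normal has this
  form.\<close>

lemma soc_iff: "q \<in> soc \<longleftrightarrow> norm (snd q) \<le> fst q"
  by (simp add: soc_def)

lemma soc_dual_iff: "lam \<in> soc_dual \<longleftrightarrow> norm (snd lam) \<le> - fst lam"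
proof
  assume "norm (snd lam) \<le> - fst lam"
  then have "lam = hat (- fst lam, snd lam)" "(- fst lam, snd lam) \<in> soc"
    by (auto simp: hat_def soc_iff)
  then show "lam \<in> soc_dual"
    unfolding soc_dual_def by blast
qed (auto simp: soc_dual_def hat_def soc_iff)

lemma closed_soc: "closed soc"
  unfolding soc_def by (intro closed_Collect_le continuous_intros)

lemma closed_soc_dual: "closed soc_dual"
proof -
  have "soc_dual = {lam::real \<times> 'a. norm (snd lam) \<le> - fst lam}"
    by (auto simp: soc_dual_iff)
  moreover have "closed {lam::real \<times> 'a. norm (snd lam) \<le> - fst lam}"
    by (intro closed_Collect_le continuous_intros)
  ultimately show ?thesis
    by simp
qed

lemma zero_in_soc [simp]: "0 \<in> soc"
  by (simp add: soc_iff)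

lemma zero_in_soc_dual [simp]: "0 \<in> soc_dual"
  by (simp add: soc_dual_iff)

lemma scaleR_soc: "q \<in> soc \<Longrightarrow> 0 \<le> c \<Longrightarrow> c *\<^sub>R q \<in> soc"
  by (simp add: soc_iff mult_left_mono)

lemma scaleR_soc_dual: "q \<in> soc_dual \<Longrightarrow> 0 \<le> c \<Longrightarrow> c *\<^sub>R q \<in> soc_dual"
  using mult_left_mono[of "norm (snd q)" "- fst q" c] by (simp add: soc_dual_iff)

lemma add_soc_dual: "p \<in> soc_dual \<Longrightarrow> q \<in> soc_dual \<Longrightarrow> p + q \<in> soc_dual"
  using norm_triangle_ineq[of "snd p" "snd q"] by (simp add: soc_dual_iff)

lemma add_soc: "p \<in> soc \<Longrightarrow> q \<in> soc \<Longrightarrow> p + q \<in> soc"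
  using norm_triangle_ineq[of "snd p" "snd q"] by (simp add: soc_iff)

lemma convex_soc: "convex soc"
  unfolding convex_def by (blast intro: add_soc scaleR_soc)

lemma soc_polar_le:
  assumes "lam \<in> soc_dual" "q \<in> soc"
  shows "lam \<bullet> q \<le> 0"
proof -
  have "snd lam \<bullet> snd q \<le> norm (snd lam) * norm (snd q)"
    by (rule norm_cauchy_schwarz)
  also have "\<dots> \<le> (- fst lam) * fst q"
    using assms order_trans[OF norm_ge_zero, of "snd lam" "- fst lam"]
    by (intro mult_mono) (auto simp: soc_iff soc_dual_iff)
  finally show ?thesis
    by (simp add: inner_prod_def)
qed

lemma soc_polar_imp_dual:
  assumes "\<And>q. q \<in> soc \<Longrightarrow> lam \<bullet> q \<le> 0"
  shows "lam \<in> soc_dual"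
proof (cases "snd lam = 0")
  case True
  have "lam \<bullet> (1, 0) \<le> 0"
    by (rule assms) (simp add: soc_iff)
  then show ?thesis
    using True by (simp add: soc_dual_iff inner_prod_def)
next
  case False
  have "lam \<bullet> (norm (snd lam), snd lam) \<le> 0"
    by (rule assms) (simp add: soc_iff)
  then have "norm (snd lam) * (fst lam + norm (snd lam)) \<le> 0"
    by (simp add: inner_prod_def power2_norm_eq_inner[symmetric] power2_eq_square algebra_simps)
  then have "fst lam + norm (snd lam) \<le> 0"
    using False by (simp add: mult_le_0_iff)
  then show ?thesis
    by (simp add: soc_dual_iff)
qed

lemma hat_inner: "hat q \<bullet> p = - (fst q * fst p) + snd q \<bullet> snd p"
  by (simp add: hat_def inner_prod_def)

lemma hat_in_soc_dual: "q \<in> soc \<Longrightarrow> hat q \<in> soc_dual"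
  unfolding soc_dual_def by blast

lemma soc_interior_or_boundary:
  assumes "q \<in> soc" "q \<noteq> 0"
  obtains "q \<in> interior soc" "q \<notin> frontier soc"
  | "q \<notin> interior soc" "q \<in> frontier soc" "norm (snd q) = fst q" "0 < fst q"
proof (cases "q \<in> interior soc")
  case True
  then show ?thesis
    using that(1) by (simp add: frontier_def)
next
  case False
  have op: "open {q::real \<times> 'a. norm (snd q) < fst q}"
    by (intro open_Collect_less continuous_intros)
  have "{q::real \<times> 'a. norm (snd q) < fst q} \<subseteq> interior soc"
    using op by (intro interior_maximal) (auto simp: soc_iff)
  then have "norm (snd q) = fst q"
    using False assms(1) by (force simp: soc_iff)
  moreover have "q \<in> frontier soc"
    using False assms(1) closure_subset by (auto simp: frontier_def)
  moreover have "0 < fst q"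
  proof (rule ccontr)
    assume "\<not> 0 < fst q"
    with \<open>norm (snd q) = fst q\<close> have "fst q = 0" "snd q = 0"
      using norm_ge_zero[of "snd q"] by (auto simp del: norm_ge_zero)
    then show False
      using assms(2) by (simp add: prod_eq_iff)
  qed
  ultimately show ?thesis
    using that(2) False by blast
qed

text \<open>Polarity plus complementarity replaces the three cases of the definition, so that
  convexity, closedness and passage to limits become immediate. On the nonzero boundary
  \<open>lam \<bullet> q = 0\<close> forces equality in Cauchy-Schwarz, which aligns the spatial
  parts; in the interior a small step along \<open>lam\<close> stays in the cone and gives
  \<open>lam = 0\<close>.\<close>

lemma normal_soc_eq:
  assumes q: "q \<in> soc"
  shows "normal_soc q = {lam \<in> soc_dual. lam \<bullet> q = 0}"
proof (cases "q = 0")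
  case True
  then show ?thesis by (simp add: normal_soc_def)
next
  case False
  from q False show ?thesis
  proof (cases rule: soc_interior_or_boundary)
    case 1
    have "lam = 0" if lam: "lam \<in> soc_dual" "lam \<bullet> q = 0" for lam
    proof (rule ccontr)
      assume nz: "lam \<noteq> 0"
      obtain e where e: "e > 0" "cball q e \<subseteq> soc"
        using 1 mem_interior_cball by blast
      define s where "s = e / norm lam"
      have s: "s > 0"
        using e nz by (simp add: s_def)
      have "q + s *\<^sub>R lam \<in> cball q e"
        using nz e by (simp add: dist_norm s_def)
      then have "lam \<bullet> (q + s *\<^sub>R lam) \<le> 0"
        using e lam by (intro soc_polar_le) auto
      then have "s * (lam \<bullet> lam) \<le> 0"
        using lam by (simp add: inner_add_right)
      moreover have "0 < s * (lam \<bullet> lam)"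
        using s nz by (intro mult_pos_pos) auto
      ultimately show False
        by linarith
    qed
    then show ?thesis
      using 1 False by (auto simp: normal_soc_def)
  next
    case 2
    have nq: "snd q \<bullet> snd q = fst q * fst q"
      using 2 by (simp add: power2_norm_eq_inner[symmetric] power2_eq_square)
    have "\<exists>\<alpha>\<ge>0. lam = \<alpha> *\<^sub>R hat q" if lam: "lam \<in> soc_dual" "lam \<bullet> q = 0" for lam
    proof -
      have a: "snd lam \<bullet> snd q = (- fst lam) * fst q"
        using lam by (simp add: inner_prod_def)
      have "norm (snd lam) * norm (snd q) \<le> (- fst lam) * fst q"
        using lam 2 mult_right_mono[of "norm (snd lam)" "- fst lam" "fst q"] by (simp add: soc_dual_iff)
      then have cs: "snd lam \<bullet> snd q = norm (snd lam) * norm (snd q)"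
        using a norm_cauchy_schwarz[of "snd lam" "snd q"] by linarith
      then have "norm (snd lam) *\<^sub>R snd q = norm (snd q) *\<^sub>R snd lam"
        by (simp only: norm_cauchy_schwarz_eq)
      moreover have "snd lam = (1 / fst q) *\<^sub>R (norm (snd q) *\<^sub>R snd lam)"
        using 2 by simp
      ultimately have "snd lam = (1 / fst q) *\<^sub>R (norm (snd lam) *\<^sub>R snd q)"
        by simp
      then have "snd lam = (norm (snd lam) / fst q) *\<^sub>R snd q"
        by simp
      moreover have "- fst lam = norm (snd lam)"
        using cs a 2 mult_right_cancel[of "fst q" "- fst lam" "norm (snd lam)"] by simp
      ultimately show ?thesis
        using 2 by (intro exI[of _ "norm (snd lam) / fst q"]) (auto simp: hat_def prod_eq_iff)
    qed
    moreover have "hat q \<bullet> q = 0"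
      using nq by (simp add: hat_inner)
    ultimately show ?thesis
      using 2 False q by (auto simp: normal_soc_def intro!: scaleR_soc_dual hat_in_soc_dual)
  qed
qed

lemma zero_in_normal_soc: "q \<in> soc \<Longrightarrow> 0 \<in> normal_soc q"
  by (simp add: normal_soc_eq)

lemma scaleR_normal_soc: "q \<in> soc \<Longrightarrow> lam \<in> normal_soc q \<Longrightarrow> 0 \<le> c \<Longrightarrow> c *\<^sub>R lam \<in> normal_soc q"
  by (simp add: normal_soc_eq scaleR_soc_dual)

lemma convex_normal_soc: "q \<in> soc \<Longrightarrow> convex (normal_soc q)"
  unfolding convex_def normal_soc_eq
  by (simp add: normal_soc_eq inner_add_left add_soc_dual scaleR_soc_dual)

lemma closed_normal_soc: "q \<in> soc \<Longrightarrow> closed (normal_soc q)"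
proof -
  assume q: "q \<in> soc"
  have "normal_soc q = soc_dual \<inter> {lam. lam \<bullet> q = 0}"
    using q by (auto simp: normal_soc_eq)
  then show ?thesis
    by (auto intro!: closed_Int closed_soc_dual closed_Collect_eq continuous_intros)
qed

lemma normal_soc_le:
  assumes "q \<in> soc" "p \<in> soc" "lam \<in> normal_soc q"
  shows "lam \<bullet> (p - q) \<le> 0"
  using assms soc_polar_le[of lam p] by (simp add: normal_soc_eq inner_diff_right)

text \<open>Squaring the cone condition for \<open>q + d\<close> cancels the zero-order terms
  because \<open>q\<close> is on the boundary. What remains beyond the linear term is the quadratic
  form that appears in \<open>curv\<close>.\<close>

lemma hat_inner_le_on_boundary:
  assumes "norm (snd q) = fst q" "q + d \<in> soc"
  shows "hat q \<bullet> d \<le> ((fst d)\<^sup>2 - (norm (snd d))\<^sup>2) / 2"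
proof -
  have "(norm (snd q + snd d))\<^sup>2 \<le> (fst q + fst d)\<^sup>2"
    using assms(2) by (intro power_mono) (auto simp: soc_iff)
  moreover have "(norm (snd q + snd d))\<^sup>2 = (fst q)\<^sup>2 + 2 * (snd q \<bullet> snd d) + (norm (snd d))\<^sup>2"
    unfolding assms(1)[symmetric]
    by (simp add: power2_norm_eq_inner inner_add_left inner_add_right inner_commute)
  ultimately show ?thesis
    by (simp add: hat_inner power2_eq_square algebra_simps)
qed

section \<open>Distance to the cone up to second order\<close>

lemma infdist_soc_attained:
  obtains lam where "lam \<in> soc_dual" "norm lam \<le> 1" "infdist r soc = lam \<bullet> r"
proof (cases "r \<in> soc")
  case True
  then show ?thesis
    using that[of 0] by simp
next
  case False
  define c where "c = closest_point soc r"
  have ne: "soc \<noteq> ({}::(real \<times> 'a) set)"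
    using zero_in_soc by blast
  have c: "c \<in> soc"
    unfolding c_def by (rule closest_point_in_set[OF closed_soc ne])
  have dot: "(r - c) \<bullet> (q - c) \<le> 0" if "q \<in> soc" for q
    unfolding c_def by (rule closest_point_dot[OF convex_soc closed_soc that])
  have pos: "norm (r - c) > 0"
    using False c by auto
  \<comment> \<open>The cone contains 0 and twice \<open>c\<close>, so the variational inequality of
    the projection holds with both signs along \<open>c\<close>. The residual is therefore a polar
    vector, and its normalization attains the distance.\<close>
  have "(r - c) \<bullet> c = 0"
    using dot[of 0] dot[OF scaleR_soc[OF c, of 2]] by (simp add: scaleR_2)
  then have dual: "r - c \<in> soc_dual"
    using dot by (intro soc_polar_imp_dual) (simp add: inner_diff_right)
  define lam where "lam = (1 / norm (r - c)) *\<^sub>R (r - c)"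
  have "lam \<bullet> r = (1 / norm (r - c)) * ((r - c) \<bullet> (r - c))"
    unfolding lam_def inner_scaleR_left using \<open>(r - c) \<bullet> c = 0\<close> by (simp add: inner_diff_right)
  also have "\<dots> = norm (r - c)"
    using pos by (simp add: power2_norm_eq_inner[symmetric] power2_eq_square)
  also have "\<dots> = infdist r soc"
  proof -
    have "infdist r soc = setdist {r} soc"
      by (simp add: infdist_eq_setdist)
    also have "\<dots> = dist r c"
      unfolding c_def by (rule setdist_closest_point[OF closed_soc ne])
    finally show ?thesis
      by (simp add: dist_norm)
  qed
  finally show ?thesis
    using that[of lam] dual pos by (simp add: lam_def scaleR_soc_dual)
qed

lemma infdist_soc_le:
  assumes "0 \<le> norm (snd r) + fst r"
  shows "infdist r soc \<le> max 0 (norm (snd r) - fst r) / sqrt 2"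
proof (cases "r \<in> soc")
  case True
  then show ?thesis by simp
next
  case False
  define s where "s = norm (snd r) - fst r"
  have s: "s > 0"
    using False by (simp add: s_def soc_iff)
  have n: "norm (snd r) > 0"
    using s assms by (auto simp: s_def)
  \<comment> \<open>The projection onto the boundary: both components get size
    \<open>(norm (snd r) + fst r) / 2\<close>. The hypothesis makes the scaling factor
    nonnegative.\<close>
  define p where "p = (fst r + s / 2, (1 - s / (2 * norm (snd r))) *\<^sub>R snd r)"
  have le: "s / (2 * norm (snd r)) \<le> 1"
    using n assms by (simp add: s_def divide_le_eq)
  have "norm (snd p) = (1 - s / (2 * norm (snd r))) * norm (snd r)"
    using le by (simp add: p_def)
  also have "\<dots> = norm (snd r) - s / 2"
    using n by (simp add: field_simps)
  finally have "p \<in> soc"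
    by (simp add: soc_iff p_def s_def field_simps)
  then have "infdist r soc \<le> dist r p"
    by (rule infdist_le)
  also have "r - p = (- (s / 2), (s / (2 * norm (snd r))) *\<^sub>R snd r)"
    by (simp add: p_def prod_eq_iff algebra_simps)
  then have "dist r p = sqrt ((s / 2)\<^sup>2 + (s / 2)\<^sup>2)"
    using n s by (simp add: dist_norm norm_prod_def)
  also have "\<dots> = s / sqrt 2"
  proof -
    have "(s / 2)\<^sup>2 + (s / 2)\<^sup>2 = (s / sqrt 2)\<^sup>2"
      by (simp add: power_divide)
    then show ?thesis
      using s by simp
  qed
  finally show ?thesis
    using s by (simp add: s_def)
qed

text \<open>Pairing this vector with a multiplier yields the curvature form. Keeping the multiplier
  out of it makes the whole Lagrangian form linear in the multiplier, as the separation and scaling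
  arguments require.\<close>

definition curvvec :: "real \<times> 'b::euclidean_space \<Rightarrow> real \<times> 'b \<Rightarrow> real \<times> 'b" where
  "curvvec q z = (if q \<in> frontier soc - {0}
     then (- ((norm (snd z))\<^sup>2 - (fst z)\<^sup>2) / fst q, 0) else 0)"

lemma curv_eq_inner_curvvec: "curv g Dg x lam u = lam \<bullet> curvvec (g x) (blinfun_apply (Dg x) u)"
  by (auto simp: curv_def curvvec_def inner_prod_def right_diff_distrib diff_divide_distrib)

lemma curvvec_scaleR: "curvvec q (s *\<^sub>R z) = s\<^sup>2 *\<^sub>R curvvec q z"
  by (auto simp: curvvec_def power_mult_distrib algebra_simps prod_eq_iff)

text \<open>A sharpened normal cone inequality: on the nonzero boundary a normal is a multiple of
  \<open>hat q\<close>, and the bending of the cone contributes the quadratic term. It is exact for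
  every step \<open>d\<close>, so there is no remainder to control.\<close>

lemma normal_soc_second_order_le:
  assumes q: "q \<in> soc" and d: "q + d \<in> soc" and lam: "lam \<in> normal_soc q"
  shows "lam \<bullet> d \<le> - (lam \<bullet> curvvec q d) / 2"
proof (cases "q \<in> frontier soc - {0}")
  case True
  from q have b: "norm (snd q) = fst q" "0 < fst q" "q \<notin> interior soc"
    using True by (auto elim!: soc_interior_or_boundary)
  obtain \<alpha> where \<alpha>: "\<alpha> \<ge> 0" "lam = \<alpha> *\<^sub>R hat q"
    using lam True b by (auto simp: normal_soc_def)
  have "hat q \<bullet> curvvec q d = (norm (snd d))\<^sup>2 - (fst d)\<^sup>2"
    using b True by (simp add: hat_inner curvvec_def)
  then have "hat q \<bullet> d \<le> - (hat q \<bullet> curvvec q d) / 2"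
    using hat_inner_le_on_boundary[OF b(1) d] by (simp add: field_simps)
  then show ?thesis
    using mult_left_mono[OF _ \<alpha>(1)] by (fastforce simp: \<alpha>(2))
next
  case False
  then have "curvvec q d = 0"
    unfolding curvvec_def by (rule if_not_P)
  then show ?thesis
    using normal_soc_le[OF q d lam] by simp
qed

text \<open>Along a parabolic arc with tangential direction \<open>z\<close>, only normals
  orthogonal to \<open>z\<close> matter for the distance at second order. The vertex has no smooth
  description and is handled by compactness of distance certificates; at the other boundary points
  an explicit formula is available.\<close>

lemma infdist_soc_expansion:
  fixes t :: "nat \<Rightarrow> real"
  assumes q: "q \<in> soc" and z: "\<And>lam. lam \<in> normal_soc q \<Longrightarrow> lam \<bullet> z \<le> 0"
    and t: "\<And>k. 0 < t k" "t \<longlonglongrightarrow> 0" and P: "P \<longlonglongrightarrow> p"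
    and B: "\<And>lam. lam \<in> normal_soc q \<Longrightarrow> norm lam \<le> 1 \<Longrightarrow> lam \<bullet> z = 0 \<Longrightarrow> lam \<bullet> (p + curvvec q z) \<le> B"
    and e: "e > 0"
  shows "\<forall>\<^sub>F k in sequentially. infdist (q + t k *\<^sub>R z + ((t k)\<^sup>2 / 2) *\<^sub>R P k) soc \<le> (t k)\<^sup>2 / 2 * (B + e)"
proof -
  have B0: "B \<ge> 0"
    using B[of 0] zero_in_normal_soc[OF q] by simp
  define r where "r k = q + t k *\<^sub>R z + ((t k)\<^sup>2 / 2) *\<^sub>R P k" for k
  have r_lim: "r \<longlonglongrightarrow> q"
  proof -
    have "(\<lambda>k. q + t k *\<^sub>R z + ((t k)\<^sup>2 / 2) *\<^sub>R P k) \<longlonglongrightarrow> q + 0 *\<^sub>R z + (0\<^sup>2 / 2) *\<^sub>R p"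
      by (intro tendsto_intros t P) simp
    then show ?thesis
      by (simp add: r_def[abs_def])
  qed
  have zero_ok: "infdist (r k) soc \<le> (t k)\<^sup>2 / 2 * (B + e)" if "r k \<in> soc" for k
    using that B0 e by simp
  show ?thesis
    unfolding r_def[symmetric]
  proof (cases "q = 0")
    case True
    show "\<forall>\<^sub>F k in sequentially. infdist (r k) soc \<le> (t k)\<^sup>2 / 2 * (B + e)"
    proof (rule ccontr)
      assume "\<not> ?thesis"
      then obtain s :: "nat \<Rightarrow> nat" where s: "strict_mono s"
        and far: "\<And>n. \<not> infdist (r (s n)) soc \<le> (t (s n))\<^sup>2 / 2 * (B + e)"
        using not_eventually_sequentiallyD by blast
      have "\<exists>lam. lam \<in> soc_dual \<and> norm lam \<le> 1 \<and> infdist (r (s n)) soc = lam \<bullet> r (s n)" for n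
        by (metis infdist_soc_attained)
      then obtain L where L: "\<And>n. L n \<in> soc_dual" "\<And>n. norm (L n) \<le> 1"
        "\<And>n. infdist (r (s n)) soc = L n \<bullet> r (s n)"
        by metis
      have "compact (soc_dual \<inter> cball 0 1 :: (real \<times> 'a) set)"
        by (intro closed_Int_compact closed_soc_dual compact_cball)
      moreover have "\<forall>n. L n \<in> soc_dual \<inter> cball 0 1"
        using L by simp
      ultimately obtain l \<rho> where l: "l \<in> soc_dual \<inter> cball 0 1" "strict_mono \<rho>" "(L \<circ> \<rho>) \<longlonglongrightarrow> l"
        unfolding compact_def by blast
      define a where "a n = s (\<rho> n)" for n
      have "strict_mono a"
        using s l by (auto simp: a_def strict_mono_def)
      then have t_lim: "(\<lambda>n. t (a n)) \<longlonglongrightarrow> 0" and P_lim: "(\<lambda>n. P (a n)) \<longlonglongrightarrow> p"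
        using LIMSEQ_subseq_LIMSEQ[OF t(2)] LIMSEQ_subseq_LIMSEQ[OF P] by (auto simp: o_def)
      have l_lim: "(\<lambda>n. L (\<rho> n)) \<longlonglongrightarrow> l"
        using l by (simp add: o_def)
      have ineq: "(t (a n))\<^sup>2 / 2 * (B + e) < L (\<rho> n) \<bullet> r (a n)" for n
        using far[of "\<rho> n"] L(3)[of "\<rho> n"] by (simp add: a_def)
      have expand: "L (\<rho> n) \<bullet> r (a n) = t (a n) * (L (\<rho> n) \<bullet> z + t (a n) / 2 * (L (\<rho> n) \<bullet> P (a n)))" for n
        by (simp add: r_def True inner_add_right power2_eq_square algebra_simps)
      have nz: "L (\<rho> n) \<bullet> z \<le> 0" for n
        using z L(1) True by (simp add: normal_soc_def)
      \<comment> \<open>The certified distance is positive, hence so is the bracket. In the limit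
        this gives \<open>l \<bullet> z \<ge> 0\<close>, so \<open>l\<close> is orthogonal to
        \<open>z\<close> and the hypothesis on \<open>B\<close> applies to it.\<close>
      have "0 \<le> L (\<rho> n) \<bullet> z + t (a n) / 2 * (L (\<rho> n) \<bullet> P (a n))" for n
      proof -
        have "0 \<le> (t (a n))\<^sup>2 / 2 * (B + e)"
          using B0 e by simp
        then have "0 < t (a n) * (L (\<rho> n) \<bullet> z + t (a n) / 2 * (L (\<rho> n) \<bullet> P (a n)))"
          using ineq[of n] expand[of n] by linarith
        then show ?thesis
          using t(1)[of "a n"] by (simp add: zero_less_mult_iff)
      qed
      moreover have "(\<lambda>n. L (\<rho> n) \<bullet> z + t (a n) / 2 * (L (\<rho> n) \<bullet> P (a n))) \<longlonglongrightarrow> l \<bullet> z + 0 / 2 * (l \<bullet> p)"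
        by (intro tendsto_intros l_lim t_lim P_lim) simp
      ultimately have "0 \<le> l \<bullet> z + 0 / 2 * (l \<bullet> p)"
        by (intro LIMSEQ_le_const) auto
      moreover have "l \<bullet> z \<le> 0"
        using z[of l] l(1) True by (simp add: normal_soc_def)
      ultimately have "l \<bullet> (p + curvvec q z) \<le> B"
        using l(1) True by (intro B) (auto simp: normal_soc_def)
      then have lp: "l \<bullet> p \<le> B"
        using True by (simp add: curvvec_def)
      have "B + e \<le> L (\<rho> n) \<bullet> P (a n)" for n
      proof -
        have "(t (a n))\<^sup>2 / 2 * (B + e) < t (a n) * (t (a n) / 2 * (L (\<rho> n) \<bullet> P (a n)))"
          using ineq[of n] expand[of n] mult_left_mono[of "L (\<rho> n) \<bullet> z" 0 "t (a n)"] nz[of n] t(1)[of "a n"]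
          by (simp add: distrib_left)
        then have "(t (a n))\<^sup>2 / 2 * (B + e) < (t (a n))\<^sup>2 / 2 * (L (\<rho> n) \<bullet> P (a n))"
          by (simp add: power2_eq_square)
        then show ?thesis
          using t(1)[of "a n"] by (simp add: mult_less_cancel_left)
      qed
      moreover have "(\<lambda>n. L (\<rho> n) \<bullet> P (a n)) \<longlonglongrightarrow> l \<bullet> p"
        by (intro tendsto_intros l_lim P_lim)
      ultimately have "B + e \<le> l \<bullet> p"
        by (intro LIMSEQ_le_const) auto
      then show False
        using lp e by linarith
    qed
  next
    case False
    from q False show "\<forall>\<^sub>F k in sequentially. infdist (r k) soc \<le> (t k)\<^sup>2 / 2 * (B + e)"
    proof (cases rule: soc_interior_or_boundary)
      case 1
      then have "\<forall>\<^sub>F k in sequentially. r k \<in> interior soc"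
        using r_lim by (intro topological_tendstoD) auto
      then show ?thesis
        by eventually_elim (use zero_ok interior_subset in blast)
    next
      case 2
      define D where "D k = z + (t k / 2) *\<^sub>R P k" for k
      have r_eq: "r k = q + t k *\<^sub>R D k" for k
        by (simp add: r_def D_def scaleR_add_right power2_eq_square)
      have D_lim: "D \<longlonglongrightarrow> z"
      proof -
        have "(\<lambda>k. z + (t k / 2) *\<^sub>R P k) \<longlonglongrightarrow> z + (0 / 2) *\<^sub>R p"
          by (intro tendsto_intros t P) simp
        then show ?thesis
          by (simp add: D_def[abs_def])
      qed
      \<comment> \<open>\<open>S\<close> is the violation of the cone inequality. Multiplied by
        \<open>M\<close>, which tends to the positive number \<open>2 * fst q\<close>, it becomes a
        difference of squares that can be expanded explicitly.\<close>
      define M where "M k = norm (snd (r k)) + fst (r k)" for k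
      define S where "S k = norm (snd (r k)) - fst (r k)" for k
      define C where "C k = (norm (snd (D k)))\<^sup>2 - (fst (D k))\<^sup>2" for k
      have M_lim: "M \<longlonglongrightarrow> 2 * fst q"
      proof -
        have "M \<longlonglongrightarrow> norm (snd q) + fst q"
          unfolding M_def by (intro tendsto_intros r_lim)
        then show ?thesis
          using 2 by simp
      qed
      have C_lim: "C \<longlonglongrightarrow> (norm (snd z))\<^sup>2 - (fst z)\<^sup>2"
        unfolding C_def by (intro tendsto_intros D_lim)
      have M_pos: "\<forall>\<^sub>F k in sequentially. 0 < M k"
        using order_tendstoD(1)[OF M_lim] 2 by simp
      have SM: "S k * M k = t k * (2 * (hat q \<bullet> D k) + t k * C k)" for k
      proof -
        have nn: "(norm (snd q))\<^sup>2 = (fst q)\<^sup>2"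
          using 2 by simp
        have "S k * M k = (norm (snd (r k)))\<^sup>2 - (fst (r k))\<^sup>2"
          by (simp add: S_def M_def power2_eq_square algebra_simps)
        also have "(norm (snd (r k)))\<^sup>2 = (fst q)\<^sup>2 + 2 * t k * (snd q \<bullet> snd (D k)) + (t k)\<^sup>2 * (norm (snd (D k)))\<^sup>2"
          unfolding nn[symmetric] r_eq power2_norm_eq_inner
          by (simp add: inner_add_left inner_add_right inner_commute power2_eq_square)
        also have "fst (r k) = fst q + t k * fst (D k)"
          by (simp add: r_eq)
        finally show ?thesis
          by (simp add: C_def hat_inner power2_eq_square algebra_simps)
      qed
      have S_neg: "r k \<in> soc" if "S k \<le> 0" for k
        using that by (simp add: S_def soc_iff)
      have hat_normal: "hat q \<in> normal_soc q"
        using 2 q by (simp add: normal_soc_eq hat_in_soc_dual)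
          (simp add: hat_inner power2_norm_eq_inner[symmetric] power2_eq_square[symmetric])
      show ?thesis
      proof (cases "hat q \<bullet> z = 0")
        case False
        then have neg: "hat q \<bullet> z < 0"
          using z[OF hat_normal] by linarith
        have "(\<lambda>k. 2 * (hat q \<bullet> D k) + t k * C k) \<longlonglongrightarrow> 2 * (hat q \<bullet> z) + 0 * ((norm (snd z))\<^sup>2 - (fst z)\<^sup>2)"
          by (intro tendsto_intros D_lim C_lim t)
        then have "\<forall>\<^sub>F k in sequentially. 2 * (hat q \<bullet> D k) + t k * C k < 0"
          by (rule order_tendstoD(2)) (use neg in simp)
        with M_pos show ?thesis
        proof eventually_elim
          case (elim k)
          then have "S k * M k < 0"
            using t(1)[of k] by (simp add: SM mult_pos_neg)
          then have "S k \<le> 0"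
            using elim by (simp add: mult_less_0_iff)
          then show ?case
            using zero_ok S_neg by blast
        qed
      next
        case True
        \<comment> \<open>The unit normal at \<open>q\<close>, since
          \<open>norm (hat q) = sqrt 2 * fst q\<close>. On this part of the boundary
          \<open>B\<close> enters only through this normal.\<close>
        define lam where "lam = (1 / (sqrt 2 * fst q)) *\<^sub>R hat q"
        have "norm (hat q) = sqrt 2 * fst q"
          using 2 by (simp add: hat_def norm_prod_def real_sqrt_mult flip: mult_2)
        then have "norm lam \<le> 1"
          using 2 by (simp add: lam_def)
        then have "lam \<bullet> (p + curvvec q z) \<le> B"
          using True 2 q by (intro B) (auto simp: lam_def intro!: scaleR_normal_soc hat_normal)
        also have "lam \<bullet> (p + curvvec q z) = sqrt 2 * ((hat q \<bullet> p + ((norm (snd z))\<^sup>2 - (fst z)\<^sup>2)) / (2 * fst q))"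
        proof -
          have "hat q \<bullet> curvvec q z = (norm (snd z))\<^sup>2 - (fst z)\<^sup>2"
            using 2 False by (simp add: hat_inner curvvec_def)
          moreover have "1 / (sqrt 2 * fst q) = sqrt 2 / (2 * fst q)"
            using 2 by (simp add: field_simps)
          ultimately show ?thesis
            by (simp add: lam_def inner_add_right add_divide_distrib distrib_left)
        qed
        finally have le: "sqrt 2 * ((hat q \<bullet> p + ((norm (snd z))\<^sup>2 - (fst z)\<^sup>2)) / (2 * fst q)) < B + e"
          using e by linarith
        have "(\<lambda>k. sqrt 2 * ((hat q \<bullet> P k + C k) / M k)) \<longlonglongrightarrow>
            sqrt 2 * ((hat q \<bullet> p + ((norm (snd z))\<^sup>2 - (fst z)\<^sup>2)) / (2 * fst q))"
          using 2 by (intro tendsto_intros P C_lim M_lim) simp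
        then have "\<forall>\<^sub>F k in sequentially. sqrt 2 * ((hat q \<bullet> P k + C k) / M k) < B + e"
          by (rule order_tendstoD(2)[OF _ le])
        with M_pos show ?thesis
        proof eventually_elim
          case (elim k)
          have "S k * M k = (t k)\<^sup>2 * (hat q \<bullet> P k + C k)"
            unfolding SM using True by (simp add: D_def inner_add_right power2_eq_square algebra_simps)
          then have S_eq: "S k = (t k)\<^sup>2 * ((hat q \<bullet> P k + C k) / M k)"
            using elim by (simp add: field_simps)
          have "infdist (r k) soc \<le> max 0 (S k) / sqrt 2"
            unfolding S_def using elim by (intro infdist_soc_le) (simp add: M_def)
          also have "\<dots> = (t k)\<^sup>2 / 2 * max 0 (sqrt 2 * ((hat q \<bullet> P k + C k) / M k))"
          proof -
            have "S k / sqrt 2 = S k * (1 / sqrt 2)" and "1 / sqrt 2 = sqrt 2 / 2"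
              by (simp_all add: field_simps)
            then have "S k / sqrt 2 = (t k)\<^sup>2 / 2 * (sqrt 2 * ((hat q \<bullet> P k + C k) / M k))"
              unfolding S_eq by (simp only: mult_ac times_divide_eq_left times_divide_eq_right mult_1_left)
            moreover have "max 0 (c * X) = c * max 0 X" if "c > 0" for c X :: real
              using that by (auto simp: max_def zero_le_mult_iff mult_le_0_iff)
            from this[of "1 / sqrt 2" "S k"] this[of "(t k)\<^sup>2 / 2" "sqrt 2 * ((hat q \<bullet> P k + C k) / M k)"]
            have "max 0 (S k) / sqrt 2 = max 0 (S k / sqrt 2)"
              "(t k)\<^sup>2 / 2 * max 0 (sqrt 2 * ((hat q \<bullet> P k + C k) / M k)) =
                max 0 ((t k)\<^sup>2 / 2 * (sqrt 2 * ((hat q \<bullet> P k + C k) / M k)))"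
              using t(1)[of k] by simp_all
            ultimately show ?thesis
              by simp
          qed
          also have "\<dots> \<le> (t k)\<^sup>2 / 2 * (B + e)"
            using elim B0 e by (intro mult_left_mono) auto
          finally show ?case .
        qed
      qed
    qed
  qed
qed

section \<open>A minimax argument producing multipliers\<close>

text \<open>The certificate in the hypothesis may depend on \<open>w\<close>, whereas the conclusion
  provides a single one. If there were none, the compact convex set of pairs (adjoint residual,
  value) over \<open>L\<close> would be strictly separated from the ray of pairs with residual 0 and
  value at least \<beta>; the separating vector then produces a \<open>w\<close> that violates the
  hypothesis.\<close>

lemma multiplier_of_minimax:
  fixes A :: "'a::euclidean_space \<Rightarrow> 'c::euclidean_space"
  assumes A: "bounded_linear A" and L: "compact L" "convex L" "L \<noteq> {}"
    and minimax: "\<And>w. \<exists>lam\<in>L. lam \<bullet> (A w + b) - y \<bullet> w \<ge> \<beta>"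
  shows "\<exists>lam\<in>L. (\<forall>h. lam \<bullet> A h = y \<bullet> h) \<and> lam \<bullet> b \<ge> \<beta>"
proof (rule ccontr)
  assume none: "\<not> ?thesis"
  interpret A: bounded_linear A by (rule A)
  define F where "F lam = (adjoint A lam - y, lam \<bullet> b)" for lam
  have adj: "adjoint A lam \<bullet> h = lam \<bullet> A h" for lam h
    using adjoint_works[OF A.linear_axioms, of h lam] by (simp add: inner_commute)
  have lin: "linear (adjoint A)"
    by (rule adjoint_linear[OF A.linear_axioms])
  have cont: "continuous_on L F"
    unfolding F_def using lin
    by (intro continuous_intros linear_continuous_on linear_conv_bounded_linear[THEN iffD1])
  have "compact (F ` L)"
    by (rule compact_continuous_image[OF cont L(1)])
  moreover have "convex (F ` L)"
  proof (rule convexI)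
    fix p q and u v :: real
    assume "p \<in> F ` L" "q \<in> F ` L" and uv: "0 \<le> u" "0 \<le> v" "u + v = 1"
    then obtain l m where lm: "l \<in> L" "m \<in> L" "p = F l" "q = F m" by blast
    have "u *\<^sub>R p + v *\<^sub>R q = F (u *\<^sub>R l + v *\<^sub>R m)"
    proof -
      have "- (u *\<^sub>R y) - v *\<^sub>R y = - ((u + v) *\<^sub>R y)"
        by (simp add: scaleR_add_left)
      then show ?thesis
        unfolding lm F_def using uv
        by (simp add: linear_add[OF lin] linear_scale[OF lin] inner_add_left scaleR_diff_right)
    qed
    then show "u *\<^sub>R p + v *\<^sub>R q \<in> F ` L"
      using convexD[OF L(2) lm(1,2) uv] by blast
  qed
  moreover have "closed ({0::'a} \<times> {\<beta>..})" "convex ({0::'a} \<times> {\<beta>..})"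
    by (auto intro: closed_Times convex_Times)
  moreover have "F ` L \<inter> ({0} \<times> {\<beta>..}) = {}"
  proof (rule ccontr)
    assume "\<not> ?thesis"
    then have "\<exists>p. p \<in> F ` L \<and> p \<in> {0} \<times> {\<beta>..}"
      by (simp only: ex_in_conv[symmetric] Int_iff)
    then obtain p where p: "p \<in> F ` L" "p \<in> {0} \<times> {\<beta>..}"
      by (elim exE conjE)
    obtain lam where "lam \<in> L" "p = F lam"
      using p(1) by (rule imageE)
    then have lam: "lam \<in> L" "F lam \<in> {0} \<times> {\<beta>..}"
      using p(2) by simp_all
    then have "adjoint A lam = y" "lam \<bullet> b \<ge> \<beta>"
      by (simp_all add: F_def)
    then show False
      using none adj lam(1) by metis
  qed
  moreover have "F ` L \<noteq> {}"
    using L by simp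
  ultimately obtain a c where sep1: "\<And>p. p \<in> F ` L \<Longrightarrow> a \<bullet> p < c"
    and sep2: "\<And>p. p \<in> {0} \<times> {\<beta>..} \<Longrightarrow> c < a \<bullet> p"
    using separating_hyperplane_compact_closed[of "F ` L" "{0} \<times> {\<beta>..}"] by metis
  obtain w s where a: "a = (w, s)"
    by fastforce
  have left: "lam \<bullet> A w - y \<bullet> w + s * (lam \<bullet> b) < c" if "lam \<in> L" for lam
    using sep1[of "F lam"] that by (simp add: a F_def inner_diff_right inner_commute[of w] adj)
  have right: "c < s * \<tau>" if "\<tau> \<ge> \<beta>" for \<tau>
    using sep2[of "(0, \<tau>)"] that by (simp add: a)
  \<comment> \<open>The ray is unbounded upward, so the separator cannot have a negative last
    coordinate.\<close>
  have s0: "s \<ge> 0"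
  proof (rule ccontr)
    assume "\<not> s \<ge> 0"
    then have "c < s * max \<beta> (c / s)" "s * max \<beta> (c / s) \<le> s * (c / s)"
      using right[of "max \<beta> (c / s)"] by (simp, intro mult_left_mono_neg) auto
    then show False
      using \<open>\<not> s \<ge> 0\<close> by simp
  qed
  show False
  proof (cases "s = 0")
    case True
    then have c: "c < 0"
      using right[of \<beta>] by simp
    obtain K where K: "K > 0" "\<And>lam. lam \<in> L \<Longrightarrow> norm lam \<le> K"
      using compact_imp_bounded[OF L(1)] by (auto simp: bounded_pos)
    \<comment> \<open>A last coordinate 0 leaves a slope uniformly below \<open>c < 0\<close> along
      \<open>w\<close>. The multiple is so large that this slope outweighs \<beta> and the bounded
      terms \<open>lam \<bullet> b\<close>; the later \<open>+ 1\<close> makes the inequality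
      strict.\<close>
    define \<tau> where "\<tau> = (\<bar>\<beta>\<bar> + K * norm b) / (- c)"
    have \<tau>: "\<tau> \<ge> 0" "\<tau> * (- c) = \<bar>\<beta>\<bar> + K * norm b"
      using c K by (auto simp: \<tau>_def intro!: divide_nonneg_neg divide_nonneg_pos)
    define \<tau>' where "\<tau>' = \<tau> + 1"
    obtain lam where lam: "lam \<in> L" "lam \<bullet> (A (\<tau>' *\<^sub>R w) + b) - y \<bullet> (\<tau>' *\<^sub>R w) \<ge> \<beta>"
      using minimax by blast
    have "\<tau>' * (lam \<bullet> A w - y \<bullet> w) \<le> \<tau>' * c"
      using left[OF lam(1)] True \<tau> by (intro mult_left_mono) (auto simp: \<tau>'_def)
    moreover have "lam \<bullet> b \<le> K * norm b"
      using norm_cauchy_schwarz[of lam b] K(2)[OF lam(1)] mult_right_mono[of "norm lam" K "norm b"] by simp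
    moreover have "\<tau>' * (lam \<bullet> A w - y \<bullet> w) + lam \<bullet> b \<ge> \<beta>"
      using lam(2) by (simp add: A.scaleR inner_add_right right_diff_distrib)
    ultimately have "\<beta> \<le> \<tau>' * c + K * norm b"
      by linarith
    moreover have "\<tau>' * c = - (\<bar>\<beta>\<bar> + K * norm b) + c"
      using \<tau>(2) by (simp add: \<tau>'_def algebra_simps)
    ultimately show False
      using c by linarith
  next
    case False
    then have s: "s > 0"
      using s0 by simp
    \<comment> \<open>Dividing by \<open>s\<close> gives the value the coefficient 1, which is the
      form of the hypothesis.\<close>
    obtain lam where lam: "lam \<in> L" "lam \<bullet> (A ((1 / s) *\<^sub>R w) + b) - y \<bullet> ((1 / s) *\<^sub>R w) \<ge> \<beta>"
      using minimax by blast
    have "s * \<beta> \<le> s * (lam \<bullet> (A ((1 / s) *\<^sub>R w) + b) - y \<bullet> ((1 / s) *\<^sub>R w))"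
      using lam(2) s by simp
    also have "\<dots> = lam \<bullet> A w - y \<bullet> w + s * (lam \<bullet> b)"
      using s by (simp add: A.scaleR inner_add_right right_diff_distrib distrib_left)
    also have "\<dots> < s * \<beta>"
      using left[OF lam(1)] right[of \<beta>] by simp
    finally show False by simp
  qed
qed

section \<open>Taylor expansions\<close>

text \<open>The mean value inequality is applied to the remainder along a segment; the derivative of
  that remainder is exactly what the first-order expansion \<open>B\<close> of \<open>F'\<close> at
  \<open>x\<close> controls.\<close>

lemma second_order_taylor:
  fixes F :: "'a::real_normed_vector \<Rightarrow> 'c::real_normed_vector"
  assumes U: "open U" "x \<in> U" and F: "\<And>y. y \<in> U \<Longrightarrow> (F has_derivative F' y) (at y)"
    and B: "\<And>e. e > 0 \<Longrightarrow> \<exists>d>0. \<forall>h k. norm h < d \<longrightarrow> norm (F' (x + h) k - F' x k - B h k) \<le> e * norm h * norm k"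
    and B_scale: "\<And>s h k. B (s *\<^sub>R h) k = s *\<^sub>R B h k"
    and e: "e > 0"
  shows "\<exists>d>0. \<forall>h. norm h < d \<longrightarrow> norm (F (x + h) - F x - F' x h - (1 / 2) *\<^sub>R B h h) \<le> e * (norm h)\<^sup>2"
proof -
  obtain d1 where d1: "d1 > 0" "\<And>h k. norm h < d1 \<Longrightarrow> norm (F' (x + h) k - F' x k - B h k) \<le> e * norm h * norm k"
    using B[OF e] by blast
  obtain d2 where d2: "d2 > 0" "ball x d2 \<subseteq> U"
    using U openE by blast
  have "norm (F (x + h) - F x - F' x h - (1 / 2) *\<^sub>R B h h) \<le> e * (norm h)\<^sup>2" if h: "norm h < min d1 d2" for h
  proof -
    define \<phi> where "\<phi> s = F (x + s *\<^sub>R h) - s *\<^sub>R F' x h - (s\<^sup>2 / 2) *\<^sub>R B h h" for s :: real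
    define \<phi>' where "\<phi>' s r = r *\<^sub>R (F' (x + s *\<^sub>R h) h - F' x h - s *\<^sub>R B h h)" for s r :: real
    have sh: "norm (s *\<^sub>R h) \<le> norm h" if "s \<in> {0..1}" for s
      using that by (simp add: mult_left_le_one_le)
    have "norm (\<phi> 1 - \<phi> 0) \<le> (e * (norm h)\<^sup>2) * norm (1 - 0 :: real)"
    proof (rule differentiable_bound[where S = "{0..1}" and f' = \<phi>'])
      fix s :: real
      assume s: "s \<in> {0..1}"
      have "x + s *\<^sub>R h \<in> U"
        using d2 sh[OF s] h by (intro subsetD[OF d2(2)]) (simp add: dist_norm)
      note D = F[OF this]
      have lin: "F' (x + s *\<^sub>R h) (r *\<^sub>R h) = r *\<^sub>R F' (x + s *\<^sub>R h) h" for r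
        using has_derivative_bounded_linear[OF D] by (simp add: bounded_linear.linear linear_scale)
      have "((\<lambda>s. F (x + s *\<^sub>R h)) has_derivative (\<lambda>r. F' (x + s *\<^sub>R h) (r *\<^sub>R h))) (at s within {0..1})"
        by (rule has_derivative_compose[where f = "\<lambda>s. x + s *\<^sub>R h", OF _ D]) (auto intro!: derivative_eq_intros)
      then have "(\<phi> has_derivative (\<lambda>r. F' (x + s *\<^sub>R h) (r *\<^sub>R h) - r *\<^sub>R F' x h - (r * s) *\<^sub>R B h h)) (at s within {0..1})"
        unfolding \<phi>_def by (auto intro!: derivative_eq_intros simp: algebra_simps)
      then show "(\<phi> has_derivative \<phi>' s) (at s within {0..1})"
        unfolding \<phi>'_def lin by (simp add: scaleR_diff_right)
      have "norm (F' (x + s *\<^sub>R h) h - F' x h - s *\<^sub>R B h h) \<le> e * norm (s *\<^sub>R h) * norm h"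
        using d1(2)[of "s *\<^sub>R h" h] sh[OF s] h by (simp add: B_scale)
      also have "\<dots> \<le> e * norm h * norm h"
        using sh[OF s] e by (intro mult_right_mono mult_left_mono) auto
      finally show "onorm (\<phi>' s) \<le> e * (norm h)\<^sup>2"
        unfolding \<phi>'_def
        using e by (intro onorm_bound) (auto simp: power2_eq_square mult.assoc mult.commute[of _ "\<bar>_\<bar>"] mult_left_mono)
    qed auto
    then show ?thesis
      by (simp add: \<phi>_def algebra_simps)
  qed
  then show ?thesis
    using d1 d2 by (intro exI[of _ "min d1 d2"]) auto
qed

text \<open>The linear term is taken at \<open>d k\<close> and not at the limit \<open>u\<close>: a
  deviation of \<open>d k\<close> from \<open>u\<close> of order \<open>t k\<close> contributes at
  order \<open>t\<^sup>2\<close> through the first derivative and must be kept apart from the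
  second-order term.\<close>

lemma second_order_taylor_seq:
  fixes F :: "'a::real_normed_vector \<Rightarrow> 'c::real_normed_vector" and t :: "nat \<Rightarrow> real"
  assumes taylor: "\<And>e. e > 0 \<Longrightarrow> \<exists>r>0. \<forall>h. norm h < r \<longrightarrow> norm (F (x + h) - F x - F' h - (1 / 2) *\<^sub>R B h h) \<le> e * (norm h)\<^sup>2"
    and F': "bounded_linear F'" and B: "bounded_bilinear B"
    and t: "\<And>k. 0 < t k" "t \<longlonglongrightarrow> 0" and d: "d \<longlonglongrightarrow> u"
  shows "(\<lambda>k. (2 / (t k)\<^sup>2) *\<^sub>R (F (x + t k *\<^sub>R d k) - F x - t k *\<^sub>R F' (d k))) \<longlonglongrightarrow> B u u"
proof -
  interpret F': bounded_linear F' by (rule F')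
  interpret B: bounded_bilinear B by (rule B)
  have td: "(\<lambda>k. t k *\<^sub>R d k) \<longlonglongrightarrow> 0"
    using tendsto_scaleR[OF t(2) d] by simp
  obtain K where K: "K > 0" "\<And>k. norm (d k) \<le> K"
    using convergent_imp_Bseq[of d] d by (auto simp: convergent_def Bseq_def)
  have "(\<lambda>k. (2 / (t k)\<^sup>2) *\<^sub>R (F (x + t k *\<^sub>R d k) - F x - t k *\<^sub>R F' (d k)) - B (d k) (d k)) \<longlonglongrightarrow> 0"
  proof (rule LIMSEQ_I)
    fix r :: real
    assume "r > 0"
    define e where "e = r / (4 * K\<^sup>2)"
    have e: "e > 0"
      using \<open>r > 0\<close> K by (simp add: e_def)
    obtain \<rho> where \<rho>: "\<rho> > 0"
      "\<And>h. norm h < \<rho> \<Longrightarrow> norm (F (x + h) - F x - F' h - (1 / 2) *\<^sub>R B h h) \<le> e * (norm h)\<^sup>2"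
      using taylor[OF e] by blast
    obtain N where N: "\<And>k. k \<ge> N \<Longrightarrow> norm (t k *\<^sub>R d k) < \<rho>"
      using LIMSEQ_D[OF td \<open>\<rho> > 0\<close>] by auto
    have "norm ((2 / (t k)\<^sup>2) *\<^sub>R (F (x + t k *\<^sub>R d k) - F x - t k *\<^sub>R F' (d k)) - B (d k) (d k) - 0) < r"
      if "k \<ge> N" for k
    proof -
      define h where "h = t k *\<^sub>R d k"
      have "B h h = (t k)\<^sup>2 *\<^sub>R B (d k) (d k)"
        by (simp add: h_def B.scaleR_left B.scaleR_right power2_eq_square)
      then have "(2 / (t k)\<^sup>2) *\<^sub>R (F (x + t k *\<^sub>R d k) - F x - t k *\<^sub>R F' (d k)) - B (d k) (d k)
          = (2 / (t k)\<^sup>2) *\<^sub>R (F (x + h) - F x - F' h - (1 / 2) *\<^sub>R B h h)"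
        using t(1)[of k] by (simp add: h_def F'.scaleR scaleR_diff_right)
      also have "norm \<dots> \<le> (2 / (t k)\<^sup>2) * (e * (norm h)\<^sup>2)"
        using \<rho>(2)[of h] N[OF that] by (simp add: h_def divide_right_mono)
      also have "\<dots> = 2 * e * (norm (d k))\<^sup>2"
        using t(1)[of k] by (simp add: h_def power_mult_distrib)
      also have "\<dots> \<le> 2 * e * K\<^sup>2"
        using e K by (intro mult_left_mono power_mono) auto
      also have "\<dots> = r / 2"
        using K by (simp add: e_def)
      finally show ?thesis
        using \<open>r > 0\<close> by simp
    qed
    then show "\<exists>no. \<forall>n\<ge>no. norm ((2 / (t n)\<^sup>2) *\<^sub>R (F (x + t n *\<^sub>R d n) - F x - t n *\<^sub>R F' (d n)) - B (d n) (d n) - 0) < r"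
      by blast
  qed
  moreover have "(\<lambda>k. B (d k) (d k)) \<longlonglongrightarrow> B u u"
    by (rule B.tendsto[OF d d])
  ultimately show ?thesis
    using tendsto_add by fastforce
qed

lemma linearization_quadratic_bound:
  fixes F :: "'a::real_normed_vector \<Rightarrow> 'c::real_normed_vector"
  assumes S: "convex S" "x \<in> S" "y \<in> S" and F: "\<And>z. z \<in> S \<Longrightarrow> (F has_derivative F' z) (at z)"
    and lip: "\<And>z k. z \<in> S \<Longrightarrow> norm (F' z k - F' x k) \<le> M * norm (z - x) * norm k" and M: "M \<ge> 0"
  shows "norm (F y - F x - F' x (y - x)) \<le> M * (norm (y - x))\<^sup>2"
proof -
  have seg: "closed_segment x y \<subseteq> S"
    using S closed_segment_subset by blast
  have "norm (F y - F x - F' x (y - x)) \<le> norm (y - x) * (M * norm (y - x))"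
  proof (rule differentiable_bound_linearization[where S = "closed_segment x y"])
    show "x + t *\<^sub>R (y - x) \<in> closed_segment x y" if "t \<in> {0..1}" for t
      using that unfolding closed_segment_def
      by (intro CollectI exI[of _ t]) (auto simp: algebra_simps)
    show "(F has_derivative F' z) (at z within closed_segment x y)" if "z \<in> closed_segment x y" for z
      using F seg that has_derivative_at_withinI by blast
    show "onorm (F' z - F' x) \<le> M * norm (y - x)" if z: "z \<in> closed_segment x y" for z
      unfolding fun_diff_def
    proof (rule onorm_bound)
      show "0 \<le> M * norm (y - x)"
        using M by simp
      fix k
      have "norm (F' z k - F' x k) \<le> M * norm (z - x) * norm k"
        using lip seg z by blast
      also have "norm (z - x) \<le> norm (y - x)"
        using segment_bound1[OF z] by (simp add: norm_minus_commute)
      then have "M * norm (z - x) * norm k \<le> M * norm (y - x) * norm k"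
        using M by (intro mult_right_mono mult_left_mono) auto
      finally show "norm (F' z k - F' x k) \<le> M * norm (y - x) * norm k" .
    qed
  qed auto
  then show ?thesis
    by (simp add: power2_eq_square mult.left_commute)
qed

lemma has_derivative_diff_quotient:
  fixes F :: "'a::real_normed_vector \<Rightarrow> 'c::real_normed_vector" and t :: "nat \<Rightarrow> real"
  assumes F: "(F has_derivative F') (at x)" and t: "\<And>k. 0 < t k" "t \<longlonglongrightarrow> 0" and d: "d \<longlonglongrightarrow> u"
  shows "(\<lambda>k. (1 / t k) *\<^sub>R (F (x + t k *\<^sub>R d k) - F x)) \<longlonglongrightarrow> F' u"
proof -
  interpret F': bounded_linear F'
    using F by (rule has_derivative_bounded_linear)
  have td: "(\<lambda>k. t k *\<^sub>R d k) \<longlonglongrightarrow> 0"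
    using tendsto_scaleR[OF t(2) d] by simp
  obtain K where K: "K > 0" "\<And>k. norm (d k) \<le> K"
    using convergent_imp_Bseq[of d] d by (auto simp: convergent_def Bseq_def)
  have "(\<lambda>k. (1 / t k) *\<^sub>R (F (x + t k *\<^sub>R d k) - F x) - F' (d k)) \<longlonglongrightarrow> 0"
  proof (rule LIMSEQ_I)
    fix r :: real
    assume r: "r > 0"
    define e where "e = r / (2 * K)"
    have e: "e > 0"
      using r K by (simp add: e_def)
    obtain \<rho> where \<rho>: "\<rho> > 0" "\<And>y. norm (y - x) < \<rho> \<Longrightarrow> norm (F y - F x - F' (y - x)) \<le> e * norm (y - x)"
      using F e unfolding has_derivative_at_alt by blast
    obtain n0 where n0: "\<And>k. k \<ge> n0 \<Longrightarrow> norm (t k *\<^sub>R d k) < \<rho>"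
      using LIMSEQ_D[OF td \<rho>(1)] by auto
    have "norm ((1 / t k) *\<^sub>R (F (x + t k *\<^sub>R d k) - F x) - F' (d k) - 0) < r" if "k \<ge> n0" for k
    proof -
      have "(1 / t k) *\<^sub>R (F (x + t k *\<^sub>R d k) - F x) - F' (d k)
          = (1 / t k) *\<^sub>R (F (x + t k *\<^sub>R d k) - F x - F' (t k *\<^sub>R d k))"
        using t(1)[of k] by (simp add: F'.scaleR scaleR_diff_right)
      also have "norm \<dots> \<le> (1 / t k) * (e * norm (t k *\<^sub>R d k))"
        using \<rho>(2)[of "x + t k *\<^sub>R d k"] n0[OF that] t(1)[of k] by (simp add: pos_divide_le_eq mult_ac)
      also have "\<dots> = e * norm (d k)"
        using t(1)[of k] by simp
      also have "\<dots> \<le> e * K"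
        using e K by (intro mult_left_mono) auto
      also have "\<dots> = r / 2"
        using K by (simp add: e_def)
      finally show ?thesis
        using r by simp
    qed
    then show "\<exists>no. \<forall>n\<ge>no. norm ((1 / t n) *\<^sub>R (F (x + t n *\<^sub>R d n) - F x) - F' (d n) - 0) < r"
      by blast
  qed
  from tendsto_add[OF this F'.tendsto[OF d]] show ?thesis
    by simp
qed

text \<open>An arc \<open>x + t u + (t\<^sup>2/2) W\<close> equals \<open>x + t d\<close> for this
  direction \<open>d\<close>, so facts about converging directions apply to arcs with bounded
  curvature.\<close>

lemma arc_direction_tendsto:
  fixes t :: "nat \<Rightarrow> real" and u :: "'a::real_normed_vector"
  assumes t: "t \<longlonglongrightarrow> 0" and K: "\<And>k. norm (W k) \<le> K"
  shows "(\<lambda>k. u + (t k / 2) *\<^sub>R W k) \<longlonglongrightarrow> u"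
proof -
  have "(\<lambda>k. (t k / 2) *\<^sub>R W k) \<longlonglongrightarrow> 0"
  proof (rule Lim_null_comparison)
    show "\<forall>\<^sub>F k in sequentially. norm ((t k / 2) *\<^sub>R W k) \<le> \<bar>t k\<bar> / 2 * K"
      using K by (auto intro!: always_eventually divide_right_mono mult_left_mono)
    have "(\<lambda>k. \<bar>t k\<bar> / 2 * K) \<longlonglongrightarrow> \<bar>0\<bar> / 2 * K"
      by (intro tendsto_intros t) simp
    then show "(\<lambda>k. \<bar>t k\<bar> / 2 * K) \<longlonglongrightarrow> 0"
      by simp
  qed
  then show ?thesis
    using tendsto_add[OF tendsto_const] by fastforce
qed

section \<open>Multipliers under metric subregularity\<close>

text \<open>Smoothness and subregularity are collected on one open set \<open>U\<close>. Since
  \<open>subregular\<close> holds at every point of \<open>U\<close>, the results below apply at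
  each feasible point near \<open>xbar\<close> with the same \<sigma>.\<close>

locale socp =
  fixes f :: "'a::euclidean_space \<Rightarrow> real" and f' :: "'a \<Rightarrow> 'a" and f'' :: "'a \<Rightarrow> 'a \<Rightarrow>\<^sub>L 'a"
    and g :: "'a \<Rightarrow> real \<times> 'b::euclidean_space" and Dg :: "'a \<Rightarrow> 'a \<Rightarrow>\<^sub>L (real \<times> 'b)"
    and D2g :: "'a \<Rightarrow> 'a \<Rightarrow>\<^sub>L 'a \<Rightarrow>\<^sub>L (real \<times> 'b)"
    and xbar :: 'a and \<sigma> :: real and U :: "'a set"
  assumes open_U: "open U" and xbar_U: "xbar \<in> U"
    and f_deriv: "\<And>x. x \<in> U \<Longrightarrow> (f has_derivative (\<lambda>h. f' x \<bullet> h)) (at x)"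
    and f'_deriv: "\<And>x. x \<in> U \<Longrightarrow> (f' has_derivative blinfun_apply (f'' x)) (at x)"
    and f''_cont: "continuous_on U f''"
    and g_deriv: "\<And>x. x \<in> U \<Longrightarrow> (g has_derivative blinfun_apply (Dg x)) (at x)"
    and Dg_deriv: "\<And>x. x \<in> U \<Longrightarrow> (Dg has_derivative blinfun_apply (D2g x)) (at x)"
    and D2g_cont: "continuous_on U D2g"
    and xbar_feas: "xbar \<in> feas g"
    and sigma_pos: "\<sigma> > 0"
    and subregular: "\<And>x. x \<in> U \<Longrightarrow> infdist x (feas g) \<le> \<sigma> * infdist (g x) soc"
begin

abbreviation \<Gamma> where "\<Gamma> \<equiv> feas g"
abbreviation N where "N \<equiv> regular_normal (feas g)"
abbreviation mlt where "mlt \<equiv> mults g Dg"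
abbreviation lq where "lq \<equiv> lagr_quad g Dg D2g"
abbreviation hess where "hess x u \<equiv> blinfun_apply (f'' x) u \<bullet> u"

lemma feasD: "x \<in> \<Gamma> \<Longrightarrow> g x \<in> soc"
  by (simp add: feas_def)

lemma lagr_quad_eq: "lq x lam u = lam \<bullet> (D2g x u u + curvvec (g x) (Dg x u))"
  by (simp add: lagr_quad_def curv_eq_inner_curvvec inner_add_right)

lemma lagr_quad_scaleR: "lq x lam (s *\<^sub>R u) = s\<^sup>2 * lq x lam u"
  by (simp add: lagr_quad_eq blinfun.scaleR_right blinfun.scaleR_left curvvec_scaleR inner_add_right
      power2_eq_square distrib_left mult.assoc)

lemma g_taylor_seq:
  assumes x: "x \<in> U" and t: "\<And>k. 0 < t k" "t \<longlonglongrightarrow> 0" and d: "d \<longlonglongrightarrow> u"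
  shows "(\<lambda>k. (2 / (t k)\<^sup>2) *\<^sub>R (g (x + t k *\<^sub>R d k) - g x - t k *\<^sub>R Dg x (d k))) \<longlonglongrightarrow> D2g x u u"
proof (rule second_order_taylor_seq[OF _ _ _ t d, where B = "\<lambda>h k. D2g x h k"])
  show "bounded_linear (blinfun_apply (Dg x))"
    by (rule blinfun.bounded_linear_right)
  show "bounded_bilinear (\<lambda>h k. D2g x h k)"
    by (rule bounded_bilinear.comp1[OF bounded_bilinear_blinfun_apply blinfun.bounded_linear_right])
  fix e :: real
  assume "e > 0"
  then show "\<exists>r>0. \<forall>h. norm h < r \<longrightarrow> norm (g (x + h) - g x - Dg x h - (1 / 2) *\<^sub>R D2g x h h) \<le> e * (norm h)\<^sup>2"
  proof (rule second_order_taylor[OF open_U x g_deriv, where B = "\<lambda>h k. D2g x h k", rotated -1])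
    fix e :: real
    assume "e > 0"
    then obtain d where d: "d > 0" "\<And>y. norm (y - x) < d \<Longrightarrow> norm (Dg y - Dg x - D2g x (y - x)) \<le> e * norm (y - x)"
      using Dg_deriv[OF x] unfolding has_derivative_at_alt by blast
    have "norm (Dg (x + h) k - Dg x k - D2g x h k) \<le> e * norm h * norm k" if "norm h < d" for h k
    proof -
      have "norm ((Dg (x + h) - Dg x - D2g x h) k) \<le> norm (Dg (x + h) - Dg x - D2g x h) * norm k"
        by (rule norm_blinfun)
      also have "\<dots> \<le> e * norm h * norm k"
        using d(2)[of "x + h"] that by (intro mult_right_mono) auto
      finally show ?thesis
        by (simp add: blinfun.diff_left)
    qed
    then show "\<exists>d>0. \<forall>h k. norm h < d \<longrightarrow> norm (Dg (x + h) k - Dg x k - D2g x h k) \<le> e * norm h * norm k"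
      using d(1) by blast
  qed (simp_all add: blinfun.scaleR_right blinfun.scaleR_left)
qed

lemma f_taylor_seq:
  assumes x: "x \<in> U" and t: "\<And>k. 0 < t k" "t \<longlonglongrightarrow> 0" and d: "d \<longlonglongrightarrow> u"
  shows "(\<lambda>k. (2 / (t k)\<^sup>2) * (f (x + t k *\<^sub>R d k) - f x - t k * (f' x \<bullet> d k))) \<longlonglongrightarrow> hess x u"
proof -
  have "(\<lambda>k. (2 / (t k)\<^sup>2) *\<^sub>R (f (x + t k *\<^sub>R d k) - f x - t k *\<^sub>R (f' x \<bullet> d k))) \<longlonglongrightarrow> f'' x u \<bullet> u"
  proof (rule second_order_taylor_seq[OF _ _ _ t d, where B = "\<lambda>h k. f'' x h \<bullet> k"])
    show "bounded_linear ((\<bullet>) (f' x))"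
      by (rule bounded_linear_inner_right)
    show "bounded_bilinear (\<lambda>h k. f'' x h \<bullet> k)"
      by (rule bounded_bilinear.comp1[OF bounded_bilinear_inner blinfun.bounded_linear_right])
    fix e :: real
    assume "e > 0"
    then show "\<exists>r>0. \<forall>h. norm h < r \<longrightarrow> norm (f (x + h) - f x - f' x \<bullet> h - (1 / 2) *\<^sub>R (f'' x h \<bullet> h)) \<le> e * (norm h)\<^sup>2"
    proof (rule second_order_taylor[OF open_U x f_deriv, where B = "\<lambda>h k. f'' x h \<bullet> k", rotated -1])
      fix e :: real
      assume "e > 0"
      then obtain d where d: "d > 0" "\<And>y. norm (y - x) < d \<Longrightarrow> norm (f' y - f' x - f'' x (y - x)) \<le> e * norm (y - x)"
        using f'_deriv[OF x] unfolding has_derivative_at_alt by blast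
      have "norm (f' (x + h) \<bullet> k - f' x \<bullet> k - f'' x h \<bullet> k) \<le> e * norm h * norm k" if "norm h < d" for h k
      proof -
        have "norm ((f' (x + h) - f' x - f'' x h) \<bullet> k) \<le> norm (f' (x + h) - f' x - f'' x h) * norm k"
          unfolding real_norm_def by (rule Cauchy_Schwarz_ineq2)
        also have "\<dots> \<le> e * norm h * norm k"
          using d(2)[of "x + h"] that by (intro mult_right_mono) auto
        finally show ?thesis
          by (simp add: inner_diff_left)
      qed
      then show "\<exists>d>0. \<forall>h k. norm h < d \<longrightarrow> norm (f' (x + h) \<bullet> k - f' x \<bullet> k - f'' x h \<bullet> k) \<le> e * norm h * norm k"
        using d(1) by blast
    qed (simp_all add: blinfun.scaleR_right)
  qed
  then show ?thesis
    by simp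
qed

lemma g_diff_quotient:
  assumes x: "x \<in> U" and t: "\<And>k. 0 < t k" "t \<longlonglongrightarrow> 0" and d: "d \<longlonglongrightarrow> u"
  shows "(\<lambda>k. (1 / t k) *\<^sub>R (g (x + t k *\<^sub>R d k) - g x)) \<longlonglongrightarrow> Dg x u"
  by (rule has_derivative_diff_quotient[OF g_deriv[OF x] t d])

lemma tangent_cone_polar:
  assumes x: "x \<in> \<Gamma>" "x \<in> U" and u: "u \<in> tangent_cone \<Gamma> x" and lam: "lam \<in> normal_soc (g x)"
  shows "lam \<bullet> Dg x u \<le> 0"
proof -
  obtain t w where t: "\<And>k. 0 < t k" "t \<longlonglongrightarrow> 0" and w: "w \<longlonglongrightarrow> u" and feas: "\<And>k. x + t k *\<^sub>R w k \<in> \<Gamma>"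
    using u by (auto simp: tangent_cone_def)
  have "(\<lambda>k. lam \<bullet> ((1 / t k) *\<^sub>R (g (x + t k *\<^sub>R w k) - g x))) \<longlonglongrightarrow> lam \<bullet> Dg x u"
    by (intro tendsto_intros g_diff_quotient x t w)
  moreover have "lam \<bullet> ((1 / t k) *\<^sub>R (g (x + t k *\<^sub>R w k) - g x)) \<le> 0" for k
    using normal_soc_le[OF feasD[OF x(1)] feasD[OF feas] lam, of k] t(1)[of k]
    by (simp add: divide_le_0_iff)
  ultimately show ?thesis
    by (intro LIMSEQ_le_const2) auto
qed

text \<open>The second-order counterpart of the subregularity estimate: minimising over the curvature of
  feasible arcs is, by duality, the same as maximising over bounded multipliers.\<close>

lemma feasible_arc:
  assumes x: "x \<in> \<Gamma>" "x \<in> U" and u: "u \<in> tangent_cone \<Gamma> x" and yu: "y \<bullet> u = 0"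
    and none: "\<And>lam. lam \<in> mlt x y \<Longrightarrow> norm lam \<le> \<sigma> * norm y \<Longrightarrow> lq x lam u < \<beta>"
    and t: "\<And>k. 0 < t k" "t \<longlonglongrightarrow> 0"
  obtains W K where "\<And>k. norm (W k) \<le> K"
    "\<forall>\<^sub>F k in sequentially. x + t k *\<^sub>R u + ((t k)\<^sup>2 / 2) *\<^sub>R W k \<in> \<Gamma>"
    "\<And>k. - (y \<bullet> W k) \<le> \<beta>"
proof -
  define q where "q = g x"
  define z where "z = Dg x u"
  define b where "b = D2g x u u + curvvec q z"
  have q: "q \<in> soc"
    using feasD x by (simp add: q_def)
  have polar: "lam \<bullet> z \<le> 0" if "lam \<in> normal_soc q" for lam
    using tangent_cone_polar[OF x u] that by (simp add: q_def z_def)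
  \<comment> \<open>Critical normals of bounded size. Radius \<sigma> \<open>norm y\<close> serves
    the duality argument, radius 1 the distance expansion; scaling connects the two.\<close>
  define L where "L c = normal_soc q \<inter> cball 0 c \<inter> {lam. lam \<bullet> z = 0}" for c
  have L_compact: "compact (L c)" for c
  proof -
    have "compact (normal_soc q \<inter> cball 0 c)"
      by (intro closed_Int_compact closed_normal_soc q compact_cball)
    then show ?thesis
      unfolding L_def
      by (rule compact_Int_closed) (intro closed_Collect_eq continuous_intros)
  qed
  have "convex {lam. lam \<bullet> z = 0}"
    using convex_hyperplane[of z 0] by (simp add: inner_commute)
  then have L_convex: "convex (L c)" for c
    unfolding L_def by (intro convex_Int convex_normal_soc q convex_cball)
  have L_0: "0 \<in> L c" if "c \<ge> 0" for c
    using that zero_in_normal_soc[OF q] by (simp add: L_def)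
  define \<rho> where "\<rho> = \<sigma> * norm y"
  have \<rho>: "\<rho> \<ge> 0"
    using sigma_pos by (simp add: \<rho>_def)
  obtain w where w: "\<And>lam. lam \<in> L \<rho> \<Longrightarrow> lam \<bullet> (Dg x w + b) - y \<bullet> w < \<beta>"
  proof -
    have "\<not> (\<exists>lam\<in>L \<rho>. (\<forall>h. lam \<bullet> Dg x h = y \<bullet> h) \<and> lam \<bullet> b \<ge> \<beta>)"
      using none by (force simp: L_def mults_def lagr_quad_eq b_def q_def z_def \<rho>_def)
    \<comment> \<open>The minimax lemma read backwards: without a multiplier of value \<beta>, a
      single \<open>w\<close> stays below \<beta> for all critical normals at once.\<close>
    then have "\<exists>w. \<forall>lam\<in>L \<rho>. \<not> lam \<bullet> (Dg x w + b) - y \<bullet> w \<ge> \<beta>"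
      using multiplier_of_minimax[OF blinfun.bounded_linear_right L_compact L_convex, where b = b and y = y and \<beta> = \<beta>]
        L_0[OF \<rho>] by blast
    then show ?thesis
      using that by (auto simp: not_le)
  qed
  define p where "p = Dg x w + D2g x u u"
  have "continuous_on (L 1) (\<lambda>lam. lam \<bullet> (p + curvvec q z))"
    by (intro continuous_intros)
  moreover have "L 1 \<noteq> {}"
    using L_0[of 1] by auto
  ultimately obtain l1 where l1: "l1 \<in> L 1" "\<And>lam. lam \<in> L 1 \<Longrightarrow> lam \<bullet> (p + curvvec q z) \<le> l1 \<bullet> (p + curvvec q z)"
    using continuous_attains_sup[OF L_compact[of 1], of "\<lambda>lam. lam \<bullet> (p + curvvec q z)"] by blast
  define B where "B = l1 \<bullet> (p + curvvec q z)"
  have B0: "B \<ge> 0"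
    using l1(2)[OF L_0] by (simp add: B_def)
  \<comment> \<open>\<open>B\<close> is the distance coefficient of the arc with curvature
    \<open>w\<close>. Making that arc feasible costs about \<sigma> \<open>B\<close> in curvature,
    hence \<rho> \<open>B\<close> in the value; scaling the maximizer \<open>l1\<close> into
    \<open>L \<rho>\<close> shows that the total stays below \<beta>.\<close>
  have "norm (\<rho> *\<^sub>R l1) \<le> \<rho>"
    using l1(1) \<rho> by (simp add: L_def mult_left_le)
  then have "\<rho> *\<^sub>R l1 \<in> L \<rho>"
    using l1(1) \<rho> q by (simp add: L_def scaleR_normal_soc)
  from w[OF this] have slack: "\<rho> * B - y \<bullet> w < \<beta>"
    by (simp add: B_def p_def b_def add.assoc)
  \<comment> \<open>\<open>e\<close> spreads the slack over the error of the expansion and that of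
    the choice of a feasible point; the \<open>+ 1\<close> keeps the denominator positive when
    \<open>y = 0\<close>.\<close>
  define e where "e = (\<beta> - (\<rho> * B - y \<bullet> w)) / (norm y * (\<sigma> + 1) + 1)"
  have den: "norm y * (\<sigma> + 1) + 1 > 0"
    using sigma_pos by (intro add_nonneg_pos mult_nonneg_nonneg) auto
  have e: "e > 0"
    using slack den by (simp add: e_def)
  have e_le: "norm y * (\<sigma> + 1) * e \<le> \<beta> - (\<rho> * B - y \<bullet> w)"
  proof -
    have "norm y * (\<sigma> + 1) * e \<le> (norm y * (\<sigma> + 1) + 1) * e"
      using e by (simp add: distrib_right)
    also have "\<dots> = \<beta> - (\<rho> * B - y \<bullet> w)"
      using den by (simp add: e_def)
    finally show ?thesis .
  qed
  define d where "d k = u + (t k / 2) *\<^sub>R w" for k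
  have d_lim: "d \<longlonglongrightarrow> u"
  proof -
    have "(\<lambda>k. u + (t k / 2) *\<^sub>R w) \<longlonglongrightarrow> u + (0 / 2) *\<^sub>R w"
      by (intro tendsto_intros t) simp
    then show ?thesis
      by (simp add: d_def[abs_def])
  qed
  define R where "R k = (2 / (t k)\<^sup>2) *\<^sub>R (g (x + t k *\<^sub>R d k) - g x - t k *\<^sub>R Dg x (d k))" for k
  have R_lim: "R \<longlonglongrightarrow> D2g x u u"
    unfolding R_def by (rule g_taylor_seq[OF x(2) t d_lim])
  have X_eq: "x + t k *\<^sub>R d k = x + t k *\<^sub>R u + ((t k)\<^sup>2 / 2) *\<^sub>R w" for k
    by (simp add: d_def scaleR_add_right power2_eq_square)
  have gX: "g (x + t k *\<^sub>R d k) = q + t k *\<^sub>R z + ((t k)\<^sup>2 / 2) *\<^sub>R (Dg x w + R k)" for k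
  proof -
    have "g (x + t k *\<^sub>R d k) = g x + t k *\<^sub>R Dg x (d k) + ((t k)\<^sup>2 / 2) *\<^sub>R R k"
      using t(1)[of k] by (simp add: R_def)
    also have "t k *\<^sub>R Dg x (d k) = t k *\<^sub>R z + ((t k)\<^sup>2 / 2) *\<^sub>R Dg x w"
      by (simp add: d_def z_def blinfun.add_right blinfun.scaleR_right scaleR_add_right power2_eq_square)
    finally show ?thesis
      by (simp add: q_def scaleR_add_right)
  qed
  have "(\<lambda>k. Dg x w + R k) \<longlonglongrightarrow> p"
    unfolding p_def by (intro tendsto_intros R_lim)
  then have ev1: "\<forall>\<^sub>F k in sequentially. infdist (g (x + t k *\<^sub>R d k)) soc \<le> (t k)\<^sup>2 / 2 * (B + e)"
    unfolding gX using l1(2) by (intro infdist_soc_expansion[OF q polar t _ _ e]) (auto simp: L_def B_def)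
  have "(\<lambda>k. x + t k *\<^sub>R d k) \<longlonglongrightarrow> x + 0 *\<^sub>R u"
    by (intro tendsto_intros t d_lim)
  then have ev2: "\<forall>\<^sub>F k in sequentially. x + t k *\<^sub>R d k \<in> U"
    using open_U x by (intro topological_tendstoD) auto
  \<comment> \<open>The last \<open>e\<close> makes the distance estimate strict, so a feasible
    point within it exists even if the infimum is not attained.\<close>
  define r where "r = \<sigma> * (B + e) + e"
  define good where "good k W \<longleftrightarrow> x + t k *\<^sub>R u + ((t k)\<^sup>2 / 2) *\<^sub>R W \<in> \<Gamma>" for k W
  have ev: "\<forall>\<^sub>F k in sequentially. \<exists>W. norm (W - w) \<le> r \<and> good k W"
    using ev1 ev2
  proof eventually_elim
    case (elim k)
    have tk: "(t k)\<^sup>2 / 2 > 0"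
      using t(1)[of k] by simp
    have "infdist (x + t k *\<^sub>R d k) \<Gamma> \<le> \<sigma> * infdist (g (x + t k *\<^sub>R d k)) soc"
      using elim subregular by blast
    also have "\<dots> \<le> \<sigma> * ((t k)\<^sup>2 / 2 * (B + e))"
      using elim sigma_pos by (intro mult_left_mono) auto
    also have "\<dots> = (t k)\<^sup>2 / 2 * (\<sigma> * (B + e))"
      by simp
    also have "\<dots> < (t k)\<^sup>2 / 2 * r"
      using tk e by (intro mult_strict_left_mono) (auto simp: r_def)
    finally have "(INF a\<in>\<Gamma>. dist (x + t k *\<^sub>R d k) a) < (t k)\<^sup>2 / 2 * r"
      using xbar_feas by (subst (asm) infdist_notempty) auto
    then obtain a where a: "a \<in> \<Gamma>" "dist (x + t k *\<^sub>R d k) a < (t k)\<^sup>2 / 2 * r"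
      using xbar_feas by (subst (asm) cINF_less_iff) (auto intro!: bdd_belowI[of _ 0])
    define W where "W = w + (2 / (t k)\<^sup>2) *\<^sub>R (a - (x + t k *\<^sub>R d k))"
    have "norm (W - w) = (2 / (t k)\<^sup>2) * dist (x + t k *\<^sub>R d k) a"
      by (simp add: W_def dist_norm norm_minus_commute)
    also have "\<dots> \<le> (2 / (t k)\<^sup>2) * ((t k)\<^sup>2 / 2 * r)"
      using a by (intro mult_left_mono) auto
    also have "\<dots> = r"
      using t(1)[of k] by simp
    finally have "norm (W - w) \<le> r" .
    moreover have "x + t k *\<^sub>R u + ((t k)\<^sup>2 / 2) *\<^sub>R W = a"
      using t(1)[of k] unfolding W_def scaleR_add_right add.assoc[symmetric] X_eq[symmetric] by simp
    then have "good k W"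
      using a by (simp add: good_def)
    ultimately show ?case
      by blast
  qed
  have r0: "r \<ge> 0"
    using B0 e sigma_pos by (simp add: r_def)
  \<comment> \<open>The default \<open>w\<close> keeps the two bounds valid for every
    \<open>k\<close>; feasibility is claimed only eventually.\<close>
  define V where "V k = (if \<exists>W. norm (W - w) \<le> r \<and> good k W then SOME W. norm (W - w) \<le> r \<and> good k W else w)" for k
  have V1: "norm (V k - w) \<le> r \<and> ((\<exists>W. norm (W - w) \<le> r \<and> good k W) \<longrightarrow> good k (V k))" for k
  proof (cases "\<exists>W. norm (W - w) \<le> r \<and> good k W")
    case True
    then show ?thesis
      using someI_ex[OF True] by (simp add: V_def)
  next
    case False
    then have "V k = w"
      unfolding V_def by (rule if_not_P)
    then show ?thesis
      using False r0 by simp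
  qed
  show ?thesis
  proof (rule that[of V "norm w + r"])
    show "norm (V k) \<le> norm w + r" for k
      using V1[of k] norm_triangle_sub[of "V k" w] by linarith
    show "\<forall>\<^sub>F k in sequentially. x + t k *\<^sub>R u + ((t k)\<^sup>2 / 2) *\<^sub>R V k \<in> \<Gamma>"
      using ev by eventually_elim (use V1 good_def in blast)
    show "- (y \<bullet> V k) \<le> \<beta>" for k
    proof -
      have "- (y \<bullet> (V k - w)) \<le> norm y * norm (V k - w)"
        using norm_cauchy_schwarz[of y "- (V k - w)"] by (simp only: inner_minus_right norm_minus_cancel)
      also have "\<dots> \<le> norm y * r"
        using V1 by (intro mult_left_mono) auto
      also have "\<dots> = \<rho> * B + norm y * (\<sigma> + 1) * e"
        by (simp add: r_def \<rho>_def algebra_simps)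
      finally show ?thesis
        using e_le by (simp add: inner_diff_right)
    qed
  qed
qed

text \<open>Weak duality, opposite to \<open>feasible_arc\<close>: every multiplier, whatever its
  norm, bounds the cost of a feasible sequence from below. Normality enters in its second-order
  form, since the first-order inequality would lose the curvature term.\<close>

lemma feasible_arc_lower_bound:
  assumes x: "x \<in> \<Gamma>" "x \<in> U" and lam: "lam \<in> mlt x y"
    and t: "\<And>k. 0 < t k" "t \<longlonglongrightarrow> 0" and d: "d \<longlonglongrightarrow> u"
    and feas: "\<forall>\<^sub>F k in sequentially. x + t k *\<^sub>R d k \<in> \<Gamma>" and e: "e > 0"
  shows "\<forall>\<^sub>F k in sequentially. lq x lam u - e \<le> - 2 * (y \<bullet> d k) / t k"
proof -
  have lam: "lam \<in> normal_soc (g x)" "\<And>h. lam \<bullet> Dg x h = y \<bullet> h"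
    using lam by (auto simp: mults_def)
  define R where "R k = (2 / (t k)\<^sup>2) *\<^sub>R (g (x + t k *\<^sub>R d k) - g x - t k *\<^sub>R Dg x (d k))" for k
  define Z where "Z k = (1 / t k) *\<^sub>R (g (x + t k *\<^sub>R d k) - g x)" for k
  have R_lim: "R \<longlonglongrightarrow> D2g x u u"
    unfolding R_def by (rule g_taylor_seq[OF x(2) t d])
  have Z_lim: "Z \<longlonglongrightarrow> Dg x u"
    unfolding Z_def by (rule g_diff_quotient[OF x(2) t d])
  have "(\<lambda>k. curvvec (g x) (Z k)) \<longlonglongrightarrow> curvvec (g x) (Dg x u)"
  proof (cases "g x \<in> frontier soc - {0}")
    case True
    then have "fst (g x) \<noteq> 0"
      using feasD[OF x(1)] by (auto elim!: soc_interior_or_boundary)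
    then show ?thesis
      using True unfolding curvvec_def by (simp, intro tendsto_intros Z_lim) auto
  next
    case False
    then have "curvvec (g x) v = 0" for v
      unfolding curvvec_def by (rule if_not_P)
    then show ?thesis
      by simp
  qed
  then have "(\<lambda>k. lam \<bullet> (R k + curvvec (g x) (Z k))) \<longlonglongrightarrow> lq x lam u"
    unfolding lagr_quad_eq by (intro tendsto_intros R_lim)
  then have "\<forall>\<^sub>F k in sequentially. lq x lam u - e < lam \<bullet> (R k + curvvec (g x) (Z k))"
    by (rule order_tendstoD) (use e in simp)
  with feas show ?thesis
  proof eventually_elim
    case (elim k)
    define D where "D = g (x + t k *\<^sub>R d k) - g x"
    have tk: "t k > 0"
      by (rule t(1))
    have "lam \<bullet> D \<le> - (lam \<bullet> curvvec (g x) D) / 2"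
      using feasD[OF x(1)] feasD[OF elim(1)] lam by (intro normal_soc_second_order_le) (auto simp: D_def)
    moreover have DZ: "D = t k *\<^sub>R Z k"
      using tk by (simp add: D_def Z_def)
    moreover have "D = t k *\<^sub>R Dg x (d k) + ((t k)\<^sup>2 / 2) *\<^sub>R R k"
      using tk by (simp add: D_def R_def)
    then have "lam \<bullet> D = t k * (y \<bullet> d k) + (t k)\<^sup>2 / 2 * (lam \<bullet> R k)"
      by (simp add: inner_add_right lam(2))
    ultimately have "t k * (y \<bullet> d k) + (t k)\<^sup>2 / 2 * (lam \<bullet> R k) \<le> - ((t k)\<^sup>2 * (lam \<bullet> curvvec (g x) (Z k))) / 2"
      unfolding DZ curvvec_scaleR by simp
    then have "t k * (t k * (lam \<bullet> (R k + curvvec (g x) (Z k)))) \<le> t k * (- 2 * (y \<bullet> d k))"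
      by (simp add: inner_add_right power2_eq_square algebra_simps)
    then have "t k * (lam \<bullet> (R k + curvvec (g x) (Z k))) \<le> - 2 * (y \<bullet> d k)"
      using tk by (simp only: mult_le_cancel_left_pos)
    then have "lam \<bullet> (R k + curvvec (g x) (Z k)) \<le> - 2 * (y \<bullet> d k) / t k"
      using tk by (subst pos_le_divide_eq) (auto simp: mult.commute)
    then show ?case
      using elim by linarith
  qed
qed

lemma zero_in_tangent_cone: "x \<in> S \<Longrightarrow> 0 \<in> tangent_cone S x"
  unfolding tangent_cone_def using LIMSEQ_inverse_real_of_nat
  by (intro CollectI exI[of _ "\<lambda>k. inverse (real (Suc k))"] exI[of _ "\<lambda>_. 0"]) auto

text \<open>The arc lemma is used with \<open>u = 0\<close>, where \<open>(t\<^sup>2/2) W\<close> is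
  the whole displacement. If no bounded multiplier existed, its condition on multipliers would hold
  vacuously for every \<beta>; the choice -1 gives feasible displacements with
  \<open>y \<bullet> W \<ge> 1\<close>, against regular normality.\<close>

lemma regular_normal_multiplier:
  assumes x: "x \<in> \<Gamma>" "x \<in> U" and y: "y \<in> N x"
  obtains lam where "lam \<in> mlt x y" "norm lam \<le> \<sigma> * norm y"
proof -
  have "\<exists>lam. lam \<in> mlt x y \<and> norm lam \<le> \<sigma> * norm y"
  proof (rule ccontr)
    assume "\<not> ?thesis"
    then have none: "lq x lam 0 < - 1" if "lam \<in> mlt x y" "norm lam \<le> \<sigma> * norm y" for lam
      using that by blast
    define t where "t k = inverse (real (Suc k))" for k
    have t: "0 < t k" "t \<longlonglongrightarrow> 0" for k
      unfolding t_def using LIMSEQ_inverse_real_of_nat by auto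
    obtain W K where K: "\<And>k. norm (W k) \<le> K"
      and ev: "\<forall>\<^sub>F k in sequentially. x + t k *\<^sub>R 0 + ((t k)\<^sup>2 / 2) *\<^sub>R W k \<in> \<Gamma>" and W: "\<And>k. - (y \<bullet> W k) \<le> - 1"
      using feasible_arc[OF x zero_in_tangent_cone[OF x(1)] _ none t] by auto
    have K0: "K \<ge> 0"
      using K[of 0] norm_ge_zero order_trans by blast
    define e where "e = 1 / (2 * (K + 1))"
    have e: "e > 0" "e * K < 1"
      using K0 by (auto simp: e_def field_simps)
    obtain d where d: "d > 0" "\<And>x'. x' \<in> \<Gamma> \<Longrightarrow> norm (x' - x) < d \<Longrightarrow> y \<bullet> (x' - x) \<le> e * norm (x' - x)"
      using y e by (auto simp: regular_normal_def)
    have "(\<lambda>k. (t k)\<^sup>2 / 2 * K) \<longlonglongrightarrow> 0\<^sup>2 / 2 * K"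
      by (intro tendsto_intros t) simp
    then have "\<forall>\<^sub>F k in sequentially. (t k)\<^sup>2 / 2 * K < d"
      by (rule order_tendstoD) (use d in simp)
    with ev have "\<forall>\<^sub>F k in sequentially. False"
    proof eventually_elim
      case (elim k)
      define x' where "x' = x + ((t k)\<^sup>2 / 2) *\<^sub>R W k"
      have tk: "(t k)\<^sup>2 / 2 > 0"
        using t(1)[of k] by simp
      have n: "norm (x' - x) \<le> (t k)\<^sup>2 / 2 * K"
        using K[of k] by (simp add: x'_def mult_left_mono divide_right_mono)
      then have "y \<bullet> (x' - x) \<le> e * norm (x' - x)"
        using elim by (intro d) (auto simp: x'_def)
      also have "\<dots> \<le> e * ((t k)\<^sup>2 / 2 * K)"
        using n e by (intro mult_left_mono) auto
      also have "\<dots> = (t k)\<^sup>2 / 2 * (e * K)"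
        by simp
      also have "\<dots> < (t k)\<^sup>2 / 2 * 1"
        using e tk by (intro mult_strict_left_mono)
      also have "\<dots> \<le> (t k)\<^sup>2 / 2 * (y \<bullet> W k)"
        using W[of k] tk by (intro mult_left_mono) auto
      also have "\<dots> = y \<bullet> (x' - x)"
        by (simp add: x'_def)
      finally show False by simp
    qed
    then show False
      by simp
  qed
  then show ?thesis
    using that by blast
qed

section \<open>Prox-regularity of the feasible set near \<open>xbar\<close>\<close>

lemma local_quadratic_bounds:
  obtains \<delta> M where "\<delta> > 0" "M \<ge> 0" "cball xbar \<delta> \<subseteq> U"
    "\<And>x x'. x \<in> cball xbar \<delta> \<Longrightarrow> x' \<in> cball xbar \<delta> \<Longrightarrow> norm (f x' - f x - f' x \<bullet> (x' - x)) \<le> M * (norm (x' - x))\<^sup>2"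
    "\<And>x x'. x \<in> cball xbar \<delta> \<Longrightarrow> x' \<in> cball xbar \<delta> \<Longrightarrow> norm (g x' - g x - Dg x (x' - x)) \<le> M * (norm (x' - x))\<^sup>2"
proof -
  obtain \<delta> where \<delta>: "\<delta> > 0" "cball xbar \<delta> \<subseteq> U"
    using open_U xbar_U open_contains_cball by blast
  have "compact (f'' ` cball xbar \<delta>)" "compact (D2g ` cball xbar \<delta>)"
    using continuous_on_subset[OF f''_cont \<delta>(2)] continuous_on_subset[OF D2g_cont \<delta>(2)]
    by (auto intro: compact_continuous_image)
  then have "bounded (f'' ` cball xbar \<delta>)" "bounded (D2g ` cball xbar \<delta>)"
    by (auto intro: compact_imp_bounded)
  then obtain M1 M2 where M1: "\<And>x. x \<in> cball xbar \<delta> \<Longrightarrow> norm (f'' x) \<le> M1" "M1 > 0"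
    and M2: "\<And>x. x \<in> cball xbar \<delta> \<Longrightarrow> norm (D2g x) \<le> M2" "M2 > 0"
    unfolding bounded_pos by blast
  define M where "M = max M1 M2"
  have lip_f: "norm (f' z - f' x) \<le> M * norm (z - x)" if "x \<in> cball xbar \<delta>" "z \<in> cball xbar \<delta>" for x z
  proof (rule differentiable_bound[OF convex_cball _ _ that(2,1)])
    fix v
    assume v: "v \<in> cball xbar \<delta>"
    show "(f' has_derivative blinfun_apply (f'' v)) (at v within cball xbar \<delta>)"
      using f'_deriv v \<delta>(2) has_derivative_at_withinI by blast
    show "onorm (blinfun_apply (f'' v)) \<le> M"
      using M1(1)[OF v] by (simp add: M_def norm_blinfun.rep_eq)
  qed
  have lip_g: "norm (Dg z - Dg x) \<le> M * norm (z - x)" if "x \<in> cball xbar \<delta>" "z \<in> cball xbar \<delta>" for x z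
  proof (rule differentiable_bound[OF convex_cball _ _ that(2,1)])
    fix v
    assume v: "v \<in> cball xbar \<delta>"
    show "(Dg has_derivative blinfun_apply (D2g v)) (at v within cball xbar \<delta>)"
      using Dg_deriv v \<delta>(2) has_derivative_at_withinI by blast
    show "onorm (blinfun_apply (D2g v)) \<le> M"
      using M2(1)[OF v] by (simp add: M_def norm_blinfun.rep_eq)
  qed
  have M: "M \<ge> 0"
    using M1(2) by (simp add: M_def)
  show ?thesis
  proof (rule that[OF \<delta>(1) M \<delta>(2)])
    fix x x'
    assume x: "x \<in> cball xbar \<delta>" "x' \<in> cball xbar \<delta>"
    show "norm (f x' - f x - f' x \<bullet> (x' - x)) \<le> M * (norm (x' - x))\<^sup>2"
    proof (rule linearization_quadratic_bound[OF convex_cball x, where F' = "\<lambda>x h. f' x \<bullet> h"])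
      show "(f has_derivative (\<lambda>h. f' z \<bullet> h)) (at z)" if "z \<in> cball xbar \<delta>" for z
        using f_deriv that \<delta> by blast
      show "norm (f' z \<bullet> k - f' x \<bullet> k) \<le> M * norm (z - x) * norm k" if "z \<in> cball xbar \<delta>" for z k
        using Cauchy_Schwarz_ineq2[of "f' z - f' x" k] mult_right_mono[OF lip_f[OF x(1) that] norm_ge_zero[of k]]
        by (simp add: inner_diff_left)
    qed (rule M)
    show "norm (g x' - g x - Dg x (x' - x)) \<le> M * (norm (x' - x))\<^sup>2"
    proof (rule linearization_quadratic_bound[OF convex_cball x, where F' = "\<lambda>x h. Dg x h"])
      show "(g has_derivative blinfun_apply (Dg z)) (at z)" if "z \<in> cball xbar \<delta>" for z
        using g_deriv that \<delta> by blast
      show "norm (Dg z k - Dg x k) \<le> M * norm (z - x) * norm k" if "z \<in> cball xbar \<delta>" for z k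
        using norm_blinfun[of "Dg z - Dg x" k] mult_right_mono[OF lip_g[OF x(1) that] norm_ge_zero[of k]]
        by (simp add: blinfun.diff_left)
    qed (rule M)
  qed
qed

text \<open>Normality of \<open>lam\<close> at \<open>g x\<close> discards the increment of
  \<open>g\<close> and leaves only its Taylor remainder. The constant depends on \<open>y\<close>
  only through \<open>norm lam\<close>, which is where bounded multipliers pay off.\<close>

lemma multiplier_prox_bound:
  obtains \<delta> M where "\<delta> > 0" "M \<ge> 0" "cball xbar \<delta> \<subseteq> U"
    "\<And>x x'. x \<in> cball xbar \<delta> \<Longrightarrow> x' \<in> cball xbar \<delta> \<Longrightarrow> norm (f x' - f x - f' x \<bullet> (x' - x)) \<le> M * (norm (x' - x))\<^sup>2"
    "\<And>x x' lam y. x \<in> \<Gamma> \<Longrightarrow> x' \<in> \<Gamma> \<Longrightarrow> x \<in> cball xbar \<delta> \<Longrightarrow> x' \<in> cball xbar \<delta> \<Longrightarrow> lam \<in> mlt x y \<Longrightarrow>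
      y \<bullet> (x' - x) \<le> norm lam * M * (norm (x' - x))\<^sup>2"
proof -
  obtain \<delta> M where \<delta>: "\<delta> > 0" "M \<ge> 0" "cball xbar \<delta> \<subseteq> U"
    and f: "\<And>x x'. x \<in> cball xbar \<delta> \<Longrightarrow> x' \<in> cball xbar \<delta> \<Longrightarrow> norm (f x' - f x - f' x \<bullet> (x' - x)) \<le> M * (norm (x' - x))\<^sup>2"
    and g: "\<And>x x'. x \<in> cball xbar \<delta> \<Longrightarrow> x' \<in> cball xbar \<delta> \<Longrightarrow> norm (g x' - g x - Dg x (x' - x)) \<le> M * (norm (x' - x))\<^sup>2"
    by (rule local_quadratic_bounds) blast
  show ?thesis
  proof (rule that[OF \<delta> f])
    fix x x' lam y
    assume x: "x \<in> \<Gamma>" "x' \<in> \<Gamma>" "x \<in> cball xbar \<delta>" "x' \<in> cball xbar \<delta>" and lam: "lam \<in> mlt x y"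
    have "y \<bullet> (x' - x) = lam \<bullet> (g x' - g x) - lam \<bullet> (g x' - g x - Dg x (x' - x))"
      using lam by (simp add: mults_def inner_diff_right)
    moreover have "lam \<bullet> (g x' - g x) \<le> 0"
      using lam x by (intro normal_soc_le feasD) (auto simp: mults_def)
    moreover have "- (lam \<bullet> (g x' - g x - Dg x (x' - x))) \<le> norm lam * norm (g x' - g x - Dg x (x' - x))"
      using Cauchy_Schwarz_ineq2[of lam "g x' - g x - Dg x (x' - x)"] by linarith
    moreover have "norm lam * norm (g x' - g x - Dg x (x' - x)) \<le> norm lam * (M * (norm (x' - x))\<^sup>2)"
      using g[OF x(3,4)] by (intro mult_left_mono) auto
    ultimately show "y \<bullet> (x' - x) \<le> norm lam * M * (norm (x' - x))\<^sup>2"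
      unfolding mult.assoc by linarith
  qed
qed

lemma regular_normalI_quadratic:
  assumes "d > 0" "C \<ge> 0" "\<And>x'. x' \<in> S \<Longrightarrow> norm (x' - x) < d \<Longrightarrow> y \<bullet> (x' - x) \<le> C * (norm (x' - x))\<^sup>2"
  shows "y \<in> regular_normal S x"
  unfolding regular_normal_def
proof (intro CollectI allI impI)
  fix e :: real
  assume e: "e > 0"
  show "\<exists>\<delta>>0. \<forall>z\<in>S. norm (z - x) < \<delta> \<longrightarrow> y \<bullet> (z - x) \<le> e * norm (z - x)"
  proof (intro exI[of _ "min d (e / (C + 1))"] conjI ballI impI)
    show "0 < min d (e / (C + 1))"
      using assms e by simp
    fix z
    assume z: "z \<in> S" "norm (z - x) < min d (e / (C + 1))"
    have "C * norm (z - x) \<le> (C + 1) * norm (z - x)"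
      by (simp add: distrib_right)
    also have "\<dots> \<le> e"
      using z assms(2) by (simp add: field_simps)
    finally have "C * norm (z - x) * norm (z - x) \<le> e * norm (z - x)"
      by (intro mult_right_mono) auto
    moreover have "y \<bullet> (z - x) \<le> C * (norm (z - x))\<^sup>2"
      using assms(3) z by auto
    ultimately show "y \<bullet> (z - x) \<le> e * norm (z - x)"
      by (simp add: power2_eq_square mult.assoc)
  qed
qed

text \<open>Together with \<open>regular_normal_multiplier\<close> this identifies the regular
  normals near \<open>xbar\<close> with the vectors that admit a multiplier.\<close>

lemma multiplier_regular_normal:
  obtains \<delta> where "\<delta> > 0" "\<And>x lam y. x \<in> \<Gamma> \<Longrightarrow> x \<in> ball xbar \<delta> \<Longrightarrow> lam \<in> mlt x y \<Longrightarrow> y \<in> N x"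
proof -
  obtain \<delta> M where \<delta>: "\<delta> > 0" "M \<ge> 0"
    and prox: "\<And>x x' lam y. x \<in> \<Gamma> \<Longrightarrow> x' \<in> \<Gamma> \<Longrightarrow> x \<in> cball xbar \<delta> \<Longrightarrow> x' \<in> cball xbar \<delta> \<Longrightarrow> lam \<in> mlt x y \<Longrightarrow>
      y \<bullet> (x' - x) \<le> norm lam * M * (norm (x' - x))\<^sup>2"
    by (rule multiplier_prox_bound) blast
  have "y \<in> N x" if x: "x \<in> \<Gamma>" "x \<in> ball xbar \<delta>" "lam \<in> mlt x y" for x lam y
  proof (rule regular_normalI_quadratic[of "\<delta> - dist xbar x" "norm lam * M"])
    show "y \<bullet> (x' - x) \<le> norm lam * M * (norm (x' - x))\<^sup>2" if "x' \<in> \<Gamma>" "norm (x' - x) < \<delta> - dist xbar x" for x'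
      using that x dist_triangle[of xbar x' x] by (intro prox) (auto simp: dist_norm norm_minus_commute)
  qed (use x \<delta> in auto)
  then show ?thesis
    using that \<delta> by blast
qed

text \<open>The constant is uniform because a multiplier of norm at most
  \<open>\<sigma> * (\<delta> + G)\<close> can be chosen, with \<open>G\<close> a bound on the
  gradient of \<open>f\<close>. The last inequality is a subgradient inequality, with quadratic
  defect, for \<open>f\<close> plus the indicator of the feasible set.\<close>

lemma hypomonotone:
  obtains \<delta> c where "\<delta> > 0" "c > 0" "cball xbar \<delta> \<subseteq> U"
    "\<And>x x' xs. x \<in> \<Gamma> \<Longrightarrow> x' \<in> \<Gamma> \<Longrightarrow> x \<in> cball xbar \<delta> \<Longrightarrow> x' \<in> cball xbar \<delta> \<Longrightarrow> norm xs \<le> \<delta> \<Longrightarrow>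
      xs - f' x \<in> N x \<Longrightarrow> (xs - f' x) \<bullet> (x' - x) \<le> c * (norm (x' - x))\<^sup>2 \<and>
      f x' \<ge> f x + xs \<bullet> (x' - x) - c / 2 * (norm (x' - x))\<^sup>2"
proof -
  obtain \<delta> M where \<delta>: "\<delta> > 0" "M \<ge> 0" "cball xbar \<delta> \<subseteq> U"
    and f: "\<And>x x'. x \<in> cball xbar \<delta> \<Longrightarrow> x' \<in> cball xbar \<delta> \<Longrightarrow> norm (f x' - f x - f' x \<bullet> (x' - x)) \<le> M * (norm (x' - x))\<^sup>2"
    and prox: "\<And>x x' lam y. x \<in> \<Gamma> \<Longrightarrow> x' \<in> \<Gamma> \<Longrightarrow> x \<in> cball xbar \<delta> \<Longrightarrow> x' \<in> cball xbar \<delta> \<Longrightarrow> lam \<in> mlt x y \<Longrightarrow>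
      y \<bullet> (x' - x) \<le> norm lam * M * (norm (x' - x))\<^sup>2"
    by (rule multiplier_prox_bound) blast
  have "continuous_on U f'"
    using f'_deriv has_derivative_continuous by (subst continuous_on_eq_continuous_at[OF open_U]) blast
  then have "bounded (f' ` cball xbar \<delta>)"
    using \<delta>(3) by (intro compact_imp_bounded compact_continuous_image) (auto intro: continuous_on_subset)
  then obtain G where G: "G > 0" "\<And>x. x \<in> cball xbar \<delta> \<Longrightarrow> norm (f' x) \<le> G"
    unfolding bounded_pos by blast
  define A where "A = \<sigma> * (\<delta> + G) * M"
  \<comment> \<open>Half of \<open>c\<close> must cover both the Taylor remainder of
    \<open>f\<close> and the constraint term \<open>A\<close>; the \<open>+ 1\<close> makes
    \<open>c\<close> positive.\<close>
  define c where "c = 2 * (M + A) + 1"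
  have c0: "A \<ge> 0"
    using sigma_pos \<delta> G by (simp add: A_def)
  show ?thesis
  proof (rule that[OF \<delta>(1) _ \<delta>(3), of c])
    show "c > 0"
      using \<delta> c0 by (simp add: c_def)
    fix x x' xs
    assume x: "x \<in> \<Gamma>" "x' \<in> \<Gamma>" "x \<in> cball xbar \<delta>" "x' \<in> cball xbar \<delta>" and xs: "norm xs \<le> \<delta>" "xs - f' x \<in> N x"
    obtain lam where lam: "lam \<in> mlt x (xs - f' x)" "norm lam \<le> \<sigma> * norm (xs - f' x)"
      using regular_normal_multiplier[OF x(1) _ xs(2)] x \<delta>(3) by blast
    have "norm (xs - f' x) \<le> \<delta> + G"
      using norm_triangle_ineq4[of xs "f' x"] xs G(2)[OF x(3)] by linarith
    then have "norm lam \<le> \<sigma> * (\<delta> + G)"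
      using lam(2) sigma_pos mult_left_mono[of "norm (xs - f' x)" "\<delta> + G" \<sigma>] by linarith
    then have "norm lam * M * (norm (x' - x))\<^sup>2 \<le> A * (norm (x' - x))\<^sup>2"
      unfolding A_def using \<delta> by (intro mult_right_mono) auto
    then have 1: "(xs - f' x) \<bullet> (x' - x) \<le> A * (norm (x' - x))\<^sup>2"
      using prox[OF x lam(1)] by linarith
    also have "\<dots> \<le> c * (norm (x' - x))\<^sup>2"
    proof (rule mult_right_mono)
      show "A \<le> c"
      using c0 \<delta>(2) by (simp add: c_def)
    qed simp
    finally have 2: "(xs - f' x) \<bullet> (x' - x) \<le> c * (norm (x' - x))\<^sup>2" .
    have "f x + f' x \<bullet> (x' - x) - M * (norm (x' - x))\<^sup>2 \<le> f x'"
      using f[OF x(3,4)] by (auto simp: abs_le_iff)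
    moreover have "c / 2 * (norm (x' - x))\<^sup>2 = M * (norm (x' - x))\<^sup>2 + A * (norm (x' - x))\<^sup>2 + (norm (x' - x))\<^sup>2 / 2"
      by (simp add: c_def algebra_simps)
    ultimately have "f x' \<ge> f x + xs \<bullet> (x' - x) - c / 2 * (norm (x' - x))\<^sup>2"
      using 1 zero_le_power2[of "norm (x' - x)"] unfolding inner_diff_left by linarith
    with 2 show "(xs - f' x) \<bullet> (x' - x) \<le> c * (norm (x' - x))\<^sup>2 \<and>
      f x' \<ge> f x + xs \<bullet> (x' - x) - c / 2 * (norm (x' - x))\<^sup>2"
      by blast
  qed
qed

text \<open>Strong against weak duality. A maximizer among the bounded multipliers exists by
  compactness. If a larger multiplier exceeded it, \<open>feasible_arc\<close> would give arcs of
  cost at most some \<beta> strictly in between, while \<open>feasible_arc_lower_bound\<close>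
  forces the cost above \<beta>.\<close>

lemma dir_mults_exist:
  assumes x: "x \<in> \<Gamma>" "x \<in> U" and y: "y \<in> N x" and u: "u \<in> crit_cone \<Gamma> x y"
  obtains lam where "lam \<in> dir_mults g Dg D2g x y u" "norm lam \<le> \<sigma> * norm y"
proof -
  define L where "L = mlt x y \<inter> cball 0 (\<sigma> * norm y)"
  have "mlt x y = normal_soc (g x) \<inter> (\<Inter>h. {lam. lam \<bullet> Dg x h = y \<bullet> h})"
    by (auto simp: mults_def)
  moreover have "closed (\<Inter>h. {lam. lam \<bullet> Dg x h = y \<bullet> h})"
    by (intro closed_INT ballI closed_Collect_eq continuous_intros)
  ultimately have "closed (mlt x y)"
    using closed_normal_soc[OF feasD[OF x(1)]] by auto
  then have "compact L"
    unfolding L_def by (rule closed_Int_compact) (rule compact_cball)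
  moreover obtain l where "l \<in> mlt x y" "norm l \<le> \<sigma> * norm y"
    by (rule regular_normal_multiplier[OF x y])
  then have "l \<in> L"
    by (simp add: L_def)
  then have "L \<noteq> {}"
    by blast
  moreover have "continuous_on L (\<lambda>lam. lq x lam u)"
    unfolding lagr_quad_eq by (intro continuous_intros)
  ultimately obtain lam where lam: "lam \<in> L" "\<And>mu. mu \<in> L \<Longrightarrow> lq x mu u \<le> lq x lam u"
    using continuous_attains_sup[of L "\<lambda>lam. lq x lam u"] by blast
  have "lq x mu u \<le> lq x lam u" if mu: "mu \<in> mlt x y" for mu
  proof (rule ccontr)
    assume "\<not> ?thesis"
    then have lt: "lq x lam u < lq x mu u"
      by simp
    define \<beta> where "\<beta> = (lq x lam u + lq x mu u) / 2"
    have \<beta>: "lq x lam u < \<beta>" "\<beta> < lq x mu u"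
      using lt by (auto simp: \<beta>_def)
    have none: "lq x l u < \<beta>" if "l \<in> mlt x y" "norm l \<le> \<sigma> * norm y" for l
      using lam(2)[of l] that \<beta> by (simp add: L_def)
    have uT: "u \<in> tangent_cone \<Gamma> x" and yu: "y \<bullet> u = 0"
      using u by (auto simp: crit_cone_def)
    define t where "t k = inverse (real (Suc k))" for k
    have t: "0 < t k" "t \<longlonglongrightarrow> 0" for k
      unfolding t_def using LIMSEQ_inverse_real_of_nat by auto
    obtain W K where K: "\<And>k. norm (W k) \<le> K"
      and ev: "\<forall>\<^sub>F k in sequentially. x + t k *\<^sub>R u + ((t k)\<^sup>2 / 2) *\<^sub>R W k \<in> \<Gamma>" and W: "\<And>k. - (y \<bullet> W k) \<le> \<beta>"
      by (rule feasible_arc[OF x uT yu none t]) (assumption | rule that)+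
    define d where "d k = u + (t k / 2) *\<^sub>R W k" for k
    have d_eq: "x + t k *\<^sub>R d k = x + t k *\<^sub>R u + ((t k)\<^sup>2 / 2) *\<^sub>R W k" for k
      by (simp add: d_def scaleR_add_right power2_eq_square)
    have d_lim: "d \<longlonglongrightarrow> u"
      unfolding d_def by (rule arc_direction_tendsto[OF t(2) K])
    have "\<forall>\<^sub>F k in sequentially. lq x mu u - (lq x mu u - \<beta>) / 2 \<le> - 2 * (y \<bullet> d k) / t k"
      using \<beta> ev by (intro feasible_arc_lower_bound[OF x mu t d_lim]) (auto simp: d_eq)
    then obtain k where k: "lq x mu u - (lq x mu u - \<beta>) / 2 \<le> - 2 * (y \<bullet> d k) / t k"
      using eventually_happens' sequentially_bot by blast
    \<comment> \<open>The direction \<open>u\<close> is critical, so the first-order part vanishes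
      and only the curvature is left.\<close>
    have "- 2 * (y \<bullet> d k) / t k = - (y \<bullet> W k)"
      using t(1)[of k] yu by (simp add: d_def inner_add_right)
    then have "lq x mu u - (lq x mu u - \<beta>) / 2 \<le> \<beta>"
      using k W[of k] by linarith
    then show False
      using \<beta> by (simp add: field_simps)
  qed
  then show ?thesis
    using lam(1) that[of lam] by (simp add: dir_mults_def L_def)
qed

end

section \<open>Sufficiency\<close>

text \<open>Continuous induction: the largest \<open>s\<close> for which the estimate holds must be
  1, since otherwise one more step extends it. A single good step to the right of each point is
  enough.\<close>

lemma norm_diff_le_of_right_quotients:
  fixes \<theta> :: "real \<Rightarrow> 'a::real_normed_vector"
  assumes cont: "continuous_on {0..1} \<theta>"
    and dini: "\<And>s e. 0 \<le> s \<Longrightarrow> s < 1 \<Longrightarrow> e > 0 \<Longrightarrow> \<exists>t>0. s + t \<le> 1 \<and> norm (\<theta> (s + t) - \<theta> s) \<le> (C + e) * t"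
  shows "norm (\<theta> 1 - \<theta> 0) \<le> C"
proof (rule field_le_epsilon)
  fix e :: real
  assume e: "e > 0"
  define S where "S = {0..1} \<inter> {s \<in> {0..1}. norm (\<theta> s - \<theta> 0) \<le> (C + e) * s}"
  have "closed {s \<in> {0..1}. norm (\<theta> s - \<theta> 0) \<le> (C + e) * s}"
    by (intro continuous_on_closed_Collect_le continuous_intros cont)
  then have "compact S"
    unfolding S_def by (intro compact_Int_closed) auto
  moreover have "0 \<in> S"
    by (simp add: S_def)
  ultimately obtain s where s: "s \<in> S" "\<And>s'. s' \<in> S \<Longrightarrow> s' \<le> s"
    using compact_attains_sup[of S] by auto
  have "s = 1"
  proof (rule ccontr)
    assume "s \<noteq> 1"
    then have "0 \<le> s" "s < 1"
      using s(1) by (auto simp: S_def)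
    then obtain t where t: "t > 0" "s + t \<le> 1" "norm (\<theta> (s + t) - \<theta> s) \<le> (C + e) * t"
      using dini e by blast
    have "norm (\<theta> (s + t) - \<theta> 0) \<le> norm (\<theta> (s + t) - \<theta> s) + norm (\<theta> s - \<theta> 0)"
      using norm_triangle_ineq[of "\<theta> (s + t) - \<theta> s" "\<theta> s - \<theta> 0"] by simp
    also have "\<dots> \<le> (C + e) * (s + t)"
      using t s(1) by (simp add: S_def distrib_left)
    finally have "s + t \<in> S"
      using t \<open>0 \<le> s\<close> by (simp add: S_def)
    then show False
      using s(2) t(1) by force
  qed
  then show "norm (\<theta> 1 - \<theta> 0) \<le> C + e"
    using s(1) by (simp add: S_def)
qed

text \<open>A Lipschitz curve may fail to be differentiable, but its right difference quotients are
  bounded, and it suffices to bound their cluster points. For the proximal mapping these are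
  tangents to the graph of the normal cone and can be analyzed.\<close>

lemma norm_diff_le_of_derivative_limits:
  fixes \<theta> :: "real \<Rightarrow> 'a::euclidean_space"
  assumes lip: "\<And>s s'. s \<in> {0..1} \<Longrightarrow> s' \<in> {0..1} \<Longrightarrow> norm (\<theta> s - \<theta> s') \<le> K * \<bar>s - s'\<bar>"
    and lim: "\<And>s t p. 0 \<le> s \<Longrightarrow> s < 1 \<Longrightarrow> (\<And>k. 0 < t k) \<Longrightarrow> (\<And>k. s + t k \<le> 1) \<Longrightarrow> t \<longlonglongrightarrow> 0 \<Longrightarrow>
      (\<lambda>k::nat. (1 / t k) *\<^sub>R (\<theta> (s + t k) - \<theta> s)) \<longlonglongrightarrow> p \<Longrightarrow> norm p \<le> C"
  shows "norm (\<theta> 1 - \<theta> 0) \<le> C"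
proof (rule norm_diff_le_of_right_quotients)
  show "continuous_on {0..1} \<theta>"
  proof (rule lipschitz_on_continuous_on[of "max K 0"], rule lipschitz_onI)
    fix s s' :: real
    assume "s \<in> {0..1}" "s' \<in> {0..1}"
    then have "norm (\<theta> s - \<theta> s') \<le> K * \<bar>s - s'\<bar>"
      by (rule lip)
    also have "\<dots> \<le> max K 0 * \<bar>s - s'\<bar>"
      by (intro mult_right_mono) auto
    finally show "dist (\<theta> s) (\<theta> s') \<le> max K 0 * dist s s'"
      by (simp add: dist_norm)
  qed simp
  fix s e :: real
  assume s: "0 \<le> s" "s < 1" and e: "e > 0"
  show "\<exists>t>0. s + t \<le> 1 \<and> norm (\<theta> (s + t) - \<theta> s) \<le> (C + e) * t"
  proof (rule ccontr)
    assume "\<not> ?thesis"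
    then have far: "norm (\<theta> (s + t) - \<theta> s) > (C + e) * t" if "t > 0" "s + t \<le> 1" for t
      using that by force
    define t where "t k = (1 - s) * inverse (real (Suc k))" for k
    have t: "0 < t k" "s + t k \<le> 1" for k
    proof -
      have "inverse (real (Suc k)) \<le> 1"
        by (simp add: inverse_le_1_iff)
      then have "t k \<le> (1 - s) * 1"
        unfolding t_def using s by (intro mult_left_mono) auto
      then show "s + t k \<le> 1"
        by simp
      show "0 < t k"
        using s by (simp add: t_def)
    qed
    have t_lim: "t \<longlonglongrightarrow> 0"
      unfolding t_def using tendsto_mult_right_zero[OF LIMSEQ_inverse_real_of_nat] by blast
    define D where "D k = (1 / t k) *\<^sub>R (\<theta> (s + t k) - \<theta> s)" for k
    have "norm (D k) \<le> K" for k
    proof -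
      have "norm (\<theta> (s + t k) - \<theta> s) \<le> K * t k"
        using lip[of "s + t k" s] t[of k] s by simp
      then show ?thesis
        using t(1)[of k] by (simp add: D_def divide_le_eq)
    qed
    then have "bounded (range D)"
      by (auto simp: bounded_iff)
    then obtain p \<rho> where \<rho>: "strict_mono \<rho>" "(D \<circ> \<rho>) \<longlonglongrightarrow> p"
      using bounded_imp_convergent_subsequence by blast
    have "norm p \<le> C"
    proof (rule lim[of s "\<lambda>k. t (\<rho> k)"])
      show "(\<lambda>k. t (\<rho> k)) \<longlonglongrightarrow> 0"
        using LIMSEQ_subseq_LIMSEQ[OF t_lim \<rho>(1)] by (simp add: o_def)
      show "(\<lambda>k. (1 / t (\<rho> k)) *\<^sub>R (\<theta> (s + t (\<rho> k)) - \<theta> s)) \<longlonglongrightarrow> p"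
        using \<rho>(2) by (simp add: o_def D_def)
    qed (use s t in auto)
    moreover have "C + e \<le> norm p"
    proof (rule LIMSEQ_le_const)
      show "(\<lambda>k. norm (D (\<rho> k))) \<longlonglongrightarrow> norm p"
        using tendsto_norm[OF \<rho>(2)] by (simp add: o_def)
      have "C + e \<le> norm (D k)" for k
        using far[OF t[of k]] t(1)[of k] by (simp add: D_def le_divide_eq)
      then show "\<exists>N. \<forall>n\<ge>N. C + e \<le> norm (D (\<rho> n))"
        by blast
    qed
    ultimately show False
      using e by linarith
  qed
qed

lemma nonpos_if_le_small_multiples:
  fixes X K :: real
  assumes "\<And>\<tau>. 0 < \<tau> \<Longrightarrow> \<tau> < 1 \<Longrightarrow> X \<le> \<tau> * K"
  shows "X \<le> 0"
proof (rule LIMSEQ_le_const)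
  show "(\<lambda>n. inverse (real (Suc (Suc n))) * K) \<longlonglongrightarrow> 0"
    using tendsto_mult_left_zero[OF LIMSEQ_Suc[OF LIMSEQ_inverse_real_of_nat]] by blast
  have "X \<le> inverse (real (Suc (Suc n))) * K" for n
    by (rule assms) (auto simp: inverse_less_1_iff)
  then show "\<exists>N. \<forall>n\<ge>N. X \<le> inverse (real (Suc (Suc n))) * K"
    by blast
qed

lemma scaleR_tangent_cone:
  assumes "u \<in> tangent_cone S x" "s > 0"
  shows "s *\<^sub>R u \<in> tangent_cone S x"
proof -
  obtain t w where tw: "\<forall>k. 0 < t k" "t \<longlonglongrightarrow> 0" "w \<longlonglongrightarrow> u" "\<forall>k. x + t k *\<^sub>R w k \<in> S"
    using assms(1) by (auto simp: tangent_cone_def)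
  have "(\<lambda>k. t k / s) \<longlonglongrightarrow> 0 / s" "(\<lambda>k. s *\<^sub>R w k) \<longlonglongrightarrow> s *\<^sub>R u"
    by (intro tendsto_intros tw; use assms in simp)+
  then show ?thesis
    unfolding tangent_cone_def using tw assms(2)
    by (intro CollectI exI[of _ "\<lambda>k. t k / s"] exI[of _ "\<lambda>k. s *\<^sub>R w k"]) auto
qed

context socp
begin

text \<open>Comparing the points \<open>x + t k d k\<close> with feasible arcs in the direction \<open>s p\<close> and letting \<open>s\<close>
  increase to 1 is a discrete form of Euler's identity for the second subderivative.\<close>

lemma normal_graph_tangent_bound:
  assumes x: "x \<in> \<Gamma>" "x \<in> U"
    and t: "\<And>k. 0 < t k" "t \<longlonglongrightarrow> 0" and d: "d \<longlonglongrightarrow> p" and feas: "\<And>k. x + t k *\<^sub>R d k \<in> \<Gamma>"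
    and Y: "(\<lambda>k. (1 / t k) *\<^sub>R (Y k - y)) \<longlonglongrightarrow> q"
    and \<rho>: "\<rho> > 0"
    and prox: "\<And>k x'. x' \<in> \<Gamma> \<Longrightarrow> norm (x' - x) < \<rho> \<Longrightarrow>
      Y k \<bullet> (x' - (x + t k *\<^sub>R d k)) \<le> c * (norm (x' - (x + t k *\<^sub>R d k)))\<^sup>2"
    and yp: "y \<bullet> p = 0" and lam: "lam \<in> dir_mults g Dg D2g x y p"
  shows "lq x lam p \<le> q \<bullet> p"
proof -
  define h where "h = lq x lam p"
  have lam_m: "lam \<in> mlt x y" and lam_max: "\<And>mu. mu \<in> mlt x y \<Longrightarrow> lq x mu p \<le> h"
    using lam by (auto simp: dir_mults_def h_def)
  have pT: "p \<in> tangent_cone \<Gamma> x"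
    unfolding tangent_cone_def using t d feas by blast
  define Q where "Q k = (1 / t k) *\<^sub>R (Y k - y)" for k
  have Q_lim: "Q \<longlonglongrightarrow> q"
    using Y by (simp add: Q_def[abs_def])
  have Y_eq: "Y k = y + t k *\<^sub>R Q k" for k
    using t(1)[of k] by (simp add: Q_def)
  \<comment> \<open>Hypomonotonicity at \<open>x + t k *\<^sub>R d k\<close> is tested with an arc
    in direction \<open>s p\<close>. By quadratic homogeneity the arc costs at most about
    \<open>s\<^sup>2 * h\<close>, while the given points cost at least about
    \<open>h\<close>.\<close>
  have main: "h - s\<^sup>2 * h \<le> 2 * ((1 - s) * (q \<bullet> p)) + 2 * c * ((1 - s)\<^sup>2 * (norm p)\<^sup>2)" if s: "0 < s" "s < 1" for s
  proof (rule field_le_epsilon)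
    fix e2 :: real
    assume "e2 > 0"
    define e where "e = e2 / 2"
    have e: "e > 0"
      using \<open>e2 > 0\<close> by (simp add: e_def)
    define \<beta> where "\<beta> = s\<^sup>2 * h + e"
    have none: "lq x mu (s *\<^sub>R p) < \<beta>" if "mu \<in> mlt x y" "norm mu \<le> \<sigma> * norm y" for mu
      using mult_left_mono[OF lam_max[OF that(1)], of "s\<^sup>2"] e by (simp add: lagr_quad_scaleR \<beta>_def)
    have "y \<bullet> (s *\<^sub>R p) = 0"
      using yp by simp
    then obtain W K where K: "\<And>k. norm (W k) \<le> K"
      and ev: "\<forall>\<^sub>F k in sequentially. x + t k *\<^sub>R (s *\<^sub>R p) + ((t k)\<^sup>2 / 2) *\<^sub>R W k \<in> \<Gamma>"
      and W: "\<And>k. - (y \<bullet> W k) \<le> \<beta>"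
      by (rule feasible_arc[OF x scaleR_tangent_cone[OF pT s(1)] _ none t]) (assumption | rule that)+
    define w where "w k = s *\<^sub>R p + (t k / 2) *\<^sub>R W k" for k
    have w_lim: "w \<longlonglongrightarrow> s *\<^sub>R p"
      unfolding w_def by (rule arc_direction_tendsto[OF t(2) K])
    have w_eq: "x + t k *\<^sub>R (s *\<^sub>R p) + ((t k)\<^sup>2 / 2) *\<^sub>R W k = x + t k *\<^sub>R w k" for k
      by (simp add: w_def scaleR_add_right power2_eq_square)
    have "(\<lambda>k. t k *\<^sub>R w k) \<longlonglongrightarrow> 0 *\<^sub>R (s *\<^sub>R p)"
      by (intro tendsto_intros t w_lim)
    then have "\<forall>\<^sub>F k in sequentially. norm (t k *\<^sub>R w k) < \<rho>"
      using \<rho> by (intro order_tendstoD(2)[of _ "norm (0 *\<^sub>R (s *\<^sub>R p))"] tendsto_norm) auto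
    moreover have "\<forall>\<^sub>F k in sequentially. lq x lam p - e \<le> - 2 * (y \<bullet> d k) / t k"
      using feas by (intro feasible_arc_lower_bound[OF x lam_m t d _ e]) auto
    ultimately have "\<forall>\<^sub>F k in sequentially. - \<beta> + h - e + 2 * (Q k \<bullet> (w k - d k)) \<le> 2 * c * (norm (w k - d k))\<^sup>2"
      using ev
    proof eventually_elim
      case (elim k)
      have tk: "t k > 0"
        by (rule t(1))
      have "Y k \<bullet> ((x + t k *\<^sub>R w k) - (x + t k *\<^sub>R d k)) \<le> c * (norm ((x + t k *\<^sub>R w k) - (x + t k *\<^sub>R d k)))\<^sup>2"
        using elim unfolding w_eq by (intro prox) auto
      also have "(x + t k *\<^sub>R w k) - (x + t k *\<^sub>R d k) = t k *\<^sub>R (w k - d k)"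
        by (simp add: scaleR_diff_right)
      finally have "t k * (Y k \<bullet> (w k - d k)) \<le> t k * (t k * (c * (norm (w k - d k))\<^sup>2))"
        by (simp add: power_mult_distrib power2_eq_square mult_ac)
      then have "Y k \<bullet> (w k - d k) \<le> t k * (c * (norm (w k - d k))\<^sup>2)"
        using tk by (simp only: mult_le_cancel_left_pos)
      \<comment> \<open>Since \<open>y \<bullet> p = 0\<close>, the part \<open>s p\<close> of
        \<open>w k\<close> drops out; only curvature and the change of the normals remain.\<close>
      moreover have "Y k \<bullet> (w k - d k) = t k / 2 * (y \<bullet> W k) - y \<bullet> d k + t k * (Q k \<bullet> (w k - d k))"
        using yp by (simp add: Y_eq w_def inner_add_left inner_add_right inner_diff_right field_simps)
      moreover have "t k / 2 * (- \<beta>) \<le> t k / 2 * (y \<bullet> W k)"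
        using W[of k] tk by (intro mult_left_mono) auto
      moreover have "t k * (h - e) \<le> - 2 * (y \<bullet> d k)"
        using elim(2) unfolding pos_le_divide_eq[OF tk] by (simp add: h_def mult.commute)
      ultimately have "t k / 2 * (- \<beta> + h - e + 2 * (Q k \<bullet> (w k - d k))) \<le> t k / 2 * (2 * c * (norm (w k - d k))\<^sup>2)"
        by (simp add: algebra_simps)
      then show ?case
        using tk by (simp only: mult_le_cancel_left_pos half_gt_zero)
    qed
    moreover have "(\<lambda>k. - \<beta> + h - e + 2 * (Q k \<bullet> (w k - d k))) \<longlonglongrightarrow> - \<beta> + h - e + 2 * (q \<bullet> (s *\<^sub>R p - p))"
      by (intro tendsto_intros Q_lim w_lim d)
    moreover have "(\<lambda>k. 2 * c * (norm (w k - d k))\<^sup>2) \<longlonglongrightarrow> 2 * c * (norm (s *\<^sub>R p - p))\<^sup>2"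
      by (intro tendsto_intros w_lim d)
    ultimately have le: "- \<beta> + h - e + 2 * (q \<bullet> (s *\<^sub>R p - p)) \<le> 2 * c * (norm (s *\<^sub>R p - p))\<^sup>2"
      using tendsto_le[OF trivial_limit_sequentially] by blast
    have sp: "s *\<^sub>R p - p = - ((1 - s) *\<^sub>R p)"
      by (simp add: algebra_simps)
    have "(norm (s *\<^sub>R p - p))\<^sup>2 = (1 - s)\<^sup>2 * (norm p)\<^sup>2"
      unfolding sp by (simp add: power_mult_distrib)
    moreover have "q \<bullet> (s *\<^sub>R p - p) = - ((1 - s) * (q \<bullet> p))"
      unfolding sp by simp
    ultimately show "h - s\<^sup>2 * h \<le> 2 * ((1 - s) * (q \<bullet> p)) + 2 * c * ((1 - s)\<^sup>2 * (norm p)\<^sup>2) + e2"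
      using le by (simp add: \<beta>_def e_def mult.assoc)
  qed
  \<comment> \<open>With \<open>s = 1 - \<tau>\<close> both sides carry a factor \<tau>. After
    division, \<tau> tending to 0 leaves \<open>2 * h \<le> 2 * (q \<bullet> p)\<close>.\<close>
  have "2 * h - 2 * (q \<bullet> p) \<le> \<tau> * (h + 2 * c * (norm p)\<^sup>2)" if "0 < \<tau>" "\<tau> < 1" for \<tau>
  proof -
    have "\<tau> * (2 * h - \<tau> * h) \<le> \<tau> * (2 * (q \<bullet> p) + \<tau> * (2 * c * (norm p)\<^sup>2))"
      using main[of "1 - \<tau>"] that by (simp add: power2_eq_square algebra_simps)
    then have "2 * h - \<tau> * h \<le> 2 * (q \<bullet> p) + \<tau> * (2 * c * (norm p)\<^sup>2)"
      using that by (simp only: mult_le_cancel_left_pos)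
    then show ?thesis
      by (simp add: distrib_left)
  qed
  from nonpos_if_le_small_multiples[OF this] show ?thesis
    by (simp add: h_def)
qed

section \<open>The localized proximal mapping and its a priori bounds\<close>

definition hypo :: "real \<Rightarrow> real \<Rightarrow> bool" where
  "hypo \<delta> c \<longleftrightarrow> \<delta> > 0 \<and> c > 0 \<and> cball xbar \<delta> \<subseteq> U \<and>
    (\<forall>x x' xs. x \<in> \<Gamma> \<longrightarrow> x' \<in> \<Gamma> \<longrightarrow> x \<in> cball xbar \<delta> \<longrightarrow> x' \<in> cball xbar \<delta> \<longrightarrow> norm xs \<le> \<delta> \<longrightarrow>
      xs - f' x \<in> N x \<longrightarrow> (xs - f' x) \<bullet> (x' - x) \<le> c * (norm (x' - x))\<^sup>2 \<and>
      f x' \<ge> f x + xs \<bullet> (x' - x) - c / 2 * (norm (x' - x))\<^sup>2)"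

lemma hypo_exists: "\<exists>\<delta> c. hypo \<delta> c"
  unfolding hypo_def by (rule hypomonotone) blast

lemma hypoD:
  assumes "hypo \<delta> c"
  shows "\<delta> > 0" "c > 0" "cball xbar \<delta> \<subseteq> U"
    "\<And>x x' xs. x \<in> \<Gamma> \<Longrightarrow> x' \<in> \<Gamma> \<Longrightarrow> x \<in> cball xbar \<delta> \<Longrightarrow> x' \<in> cball xbar \<delta> \<Longrightarrow> norm xs \<le> \<delta> \<Longrightarrow>
      xs - f' x \<in> N x \<Longrightarrow> (xs - f' x) \<bullet> (x' - x) \<le> c * (norm (x' - x))\<^sup>2"
    "\<And>x x' xs. x \<in> \<Gamma> \<Longrightarrow> x' \<in> \<Gamma> \<Longrightarrow> x \<in> cball xbar \<delta> \<Longrightarrow> x' \<in> cball xbar \<delta> \<Longrightarrow> norm xs \<le> \<delta> \<Longrightarrow>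
      xs - f' x \<in> N x \<Longrightarrow> f x' \<ge> f x + xs \<bullet> (x' - x) - c / 2 * (norm (x' - x))\<^sup>2"
  using assms unfolding hypo_def by blast+

lemma hypo_mono:
  assumes H: "hypo \<delta> c"
    and 1: "x1 \<in> \<Gamma>" "x1 \<in> cball xbar \<delta>" "norm v1 \<le> \<delta>" "v1 - f' x1 \<in> N x1"
    and 2: "x2 \<in> \<Gamma>" "x2 \<in> cball xbar \<delta>" "norm v2 \<le> \<delta>" "v2 - f' x2 \<in> N x2"
  shows "(v1 - v2) \<bullet> (x1 - x2) \<ge> - c * (norm (x1 - x2))\<^sup>2"
proof -
  have "f x2 \<ge> f x1 + v1 \<bullet> (x2 - x1) - c / 2 * (norm (x1 - x2))\<^sup>2"
    using hypoD(5)[OF H 1(1) 2(1) 1(2) 2(2) 1(3,4)] by (simp add: norm_minus_commute)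
  moreover have "f x1 \<ge> f x2 + v2 \<bullet> (x1 - x2) - c / 2 * (norm (x1 - x2))\<^sup>2"
    using hypoD(5)[OF H 2(1) 1(1) 2(2) 1(2) 2(3,4)] .
  moreover have "v1 \<bullet> (x2 - x1) = - (v1 \<bullet> (x1 - x2))"
    by (simp add: inner_diff_right)
  ultimately show ?thesis
    by (simp add: inner_diff_left)
qed

lemma continuous_on_f: "continuous_on U f" and continuous_on_g: "continuous_on U g"
  using f_deriv g_deriv has_derivative_continuous
  by (subst continuous_on_eq_continuous_at[OF open_U], blast)+

lemma compact_feas_cball:
  assumes "cball xbar \<delta> \<subseteq> U"
  shows "compact (\<Gamma> \<inter> cball xbar \<delta>)"
proof -
  have "closed (cball xbar \<delta> \<inter> g -` soc)"
    using continuous_on_subset[OF continuous_on_g assms]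
    by (intro continuous_closed_preimage closed_soc) auto
  then have "compact (cball xbar \<delta> \<inter> (cball xbar \<delta> \<inter> g -` soc))"
    by (intro compact_Int_closed) auto
  moreover have "cball xbar \<delta> \<inter> (cball xbar \<delta> \<inter> g -` soc) = \<Gamma> \<inter> cball xbar \<delta>"
    by (auto simp: feas_def)
  ultimately show ?thesis
    by simp
qed

text \<open>Fermat's rule with room for a quadratic defect: \<open>C = 0\<close> serves tilted
  minimizers, \<open>C = c\<close> proximal points, where expanding the squared distance leaves this
  defect.\<close>

lemma first_order_condition:
  assumes x: "x \<in> U" and e: "e > 0" and C: "C \<ge> 0"
    and min: "\<And>x'. x' \<in> \<Gamma> \<Longrightarrow> norm (x' - x) < e \<Longrightarrow> f x + v \<bullet> (x' - x) - C * (norm (x' - x))\<^sup>2 \<le> f x'"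
  shows "v - f' x \<in> N x"
  unfolding regular_normal_def
proof (intro CollectI allI impI)
  fix \<epsilon> :: real
  assume \<epsilon>: "\<epsilon> > 0"
  then obtain d where d: "d > 0"
    "\<And>x'. norm (x' - x) < d \<Longrightarrow> norm (f x' - f x - f' x \<bullet> (x' - x)) \<le> \<epsilon> / 2 * norm (x' - x)"
    using f_deriv[OF x] half_gt_zero[OF \<epsilon>] unfolding has_derivative_at_alt by blast
  show "\<exists>\<delta>>0. \<forall>x'\<in>\<Gamma>. norm (x' - x) < \<delta> \<longrightarrow> (v - f' x) \<bullet> (x' - x) \<le> \<epsilon> * norm (x' - x)"
  proof (intro exI[of _ "min (min d e) (\<epsilon> / (2 * (C + 1)))"] conjI ballI impI)
    show "0 < min (min d e) (\<epsilon> / (2 * (C + 1)))"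
      using d e \<epsilon> C by simp
    fix x'
    assume x': "x' \<in> \<Gamma>" "norm (x' - x) < min (min d e) (\<epsilon> / (2 * (C + 1)))"
    have "(C + 1) * norm (x' - x) \<le> \<epsilon> / 2"
      using x'(2) C by (simp add: field_simps)
    moreover have "C * norm (x' - x) \<le> (C + 1) * norm (x' - x)"
      by (simp add: distrib_right)
    ultimately have "C * norm (x' - x) * norm (x' - x) \<le> \<epsilon> / 2 * norm (x' - x)"
      by (intro mult_right_mono) auto
    then have "C * (norm (x' - x))\<^sup>2 \<le> \<epsilon> / 2 * norm (x' - x)"
      by (simp add: power2_eq_square mult.assoc)
    moreover have "norm (f x' - f x - f' x \<bullet> (x' - x)) \<le> \<epsilon> / 2 * norm (x' - x)"
      using d(2) x'(2) by simp
    then have "f x' - f x - f' x \<bullet> (x' - x) \<le> \<epsilon> / 2 * norm (x' - x)"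
      unfolding real_norm_def by linarith
    moreover have "f x + v \<bullet> (x' - x) - C * (norm (x' - x))\<^sup>2 \<le> f x'"
      using min x' by simp
    ultimately show "(v - f' x) \<bullet> (x' - x) \<le> \<epsilon> * norm (x' - x)"
      unfolding inner_diff_left by (simp add: field_simps)
  qed
qed

text \<open>A selection of the proximal mapping of \<open>f\<close> plus the indicator of the
  feasible set, restricted to a closed ball so that minimizers exist. Uniqueness near
  \<open>xbar\<close> comes only from \<open>prox_lipschitz\<close>.\<close>

definition prox :: "real \<Rightarrow> real \<Rightarrow> 'a \<Rightarrow> 'a" where
  "prox \<delta> r y = (SOME x. x \<in> \<Gamma> \<inter> cball xbar \<delta> \<and>
    (\<forall>x'\<in>\<Gamma> \<inter> cball xbar \<delta>. f x + r / 2 * (norm (x - y))\<^sup>2 \<le> f x' + r / 2 * (norm (x' - y))\<^sup>2))"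

lemma norm_sq_diff_expand:
  fixes a b c :: "'v::real_inner"
  shows "(norm (a - b))\<^sup>2 = (norm (a - c))\<^sup>2 + 2 * ((a - c) \<bullet> (c - b)) + (norm (c - b))\<^sup>2"
  unfolding power2_norm_eq_inner by (simp add: inner_diff_left inner_diff_right inner_commute)

lemma prox_min:
  assumes H: "hypo \<delta> c"
  shows "prox \<delta> r y \<in> \<Gamma>" "prox \<delta> r y \<in> cball xbar \<delta>"
    "\<And>x'. x' \<in> \<Gamma> \<Longrightarrow> x' \<in> cball xbar \<delta> \<Longrightarrow>
      f (prox \<delta> r y) + r / 2 * (norm (prox \<delta> r y - y))\<^sup>2 \<le> f x' + r / 2 * (norm (x' - y))\<^sup>2"
proof -
  have "continuous_on (\<Gamma> \<inter> cball xbar \<delta>) (\<lambda>x. f x + r / 2 * (norm (x - y))\<^sup>2)"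
    using hypoD(3)[OF H] by (intro continuous_intros continuous_on_subset[OF continuous_on_f]) auto
  moreover have "xbar \<in> \<Gamma> \<inter> cball xbar \<delta>"
    using xbar_feas hypoD(1)[OF H] by simp
  then have "\<Gamma> \<inter> cball xbar \<delta> \<noteq> {}"
    by blast
  ultimately have ex: "\<exists>x. x \<in> \<Gamma> \<inter> cball xbar \<delta> \<and>
    (\<forall>x'\<in>\<Gamma> \<inter> cball xbar \<delta>. f x + r / 2 * (norm (x - y))\<^sup>2 \<le> f x' + r / 2 * (norm (x' - y))\<^sup>2)"
    using continuous_attains_inf[OF compact_feas_cball[OF hypoD(3)[OF H]]] by blast
  from someI_ex[OF ex]
  show "prox \<delta> r y \<in> \<Gamma>" "prox \<delta> r y \<in> cball xbar \<delta>"
    "\<And>x'. x' \<in> \<Gamma> \<Longrightarrow> x' \<in> cball xbar \<delta> \<Longrightarrow>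
      f (prox \<delta> r y) + r / 2 * (norm (prox \<delta> r y - y))\<^sup>2 \<le> f x' + r / 2 * (norm (x' - y))\<^sup>2"
    unfolding prox_def[symmetric] by blast+
qed

text \<open>The penalty coefficient \<open>c\<close> exceeds the defect \<open>c / 2\<close> of the
  subgradient inequality at \<open>xbar\<close> with tilt 0. The squared distance thus survives with
  coefficient \<open>c / 2\<close>, whence the factor 4. For \<open>y = xbar\<close> the proximal
  point is \<open>xbar\<close> itself.\<close>

lemma prox_near:
  assumes H: "hypo \<delta> c" and stat: "- f' xbar \<in> N xbar"
  shows "norm (prox \<delta> (2 * c) y - xbar) \<le> 4 * norm (y - xbar)"
proof -
  define x where "x = prox \<delta> (2 * c) y"
  have c: "c > 0"
    by (rule hypoD(2)[OF H])
  have xb: "xbar \<in> cball xbar \<delta>"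
    using hypoD(1)[OF H] by simp
  have x: "x \<in> \<Gamma>" "x \<in> cball xbar \<delta>"
    unfolding x_def by (rule prox_min[OF H])+
  have "f x + c * (norm (x - y))\<^sup>2 \<le> f xbar + c * (norm (xbar - y))\<^sup>2"
    using prox_min(3)[OF H xbar_feas xb, of "2 * c" y] by (simp add: x_def)
  moreover have "f x \<ge> f xbar + 0 \<bullet> (x - xbar) - c / 2 * (norm (x - xbar))\<^sup>2"
    using hypoD(1)[OF H] stat by (intro hypoD(5)[OF H xbar_feas x(1) xb x(2)]) auto
  moreover have "(norm (x - y))\<^sup>2 = (norm (x - xbar))\<^sup>2 + 2 * ((x - xbar) \<bullet> (xbar - y)) + (norm (xbar - y))\<^sup>2"
    by (rule norm_sq_diff_expand)
  ultimately have "c * (norm (x - xbar))\<^sup>2 + c * (2 * ((x - xbar) \<bullet> (xbar - y))) \<le> c * ((norm (x - xbar))\<^sup>2 / 2)"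
    by (simp add: algebra_simps)
  then have "c * ((norm (x - xbar))\<^sup>2 + 2 * ((x - xbar) \<bullet> (xbar - y))) \<le> c * ((norm (x - xbar))\<^sup>2 / 2)"
    by (simp only: distrib_left)
  then have "(norm (x - xbar))\<^sup>2 / 2 \<le> - 2 * ((x - xbar) \<bullet> (xbar - y))"
    using c by (simp only: mult_le_cancel_left_pos)
  also have "- ((x - xbar) \<bullet> (xbar - y)) \<le> norm (x - xbar) * norm (y - xbar)"
    using norm_cauchy_schwarz[of "x - xbar" "y - xbar"] by (simp add: inner_diff_right)
  then have "- 2 * ((x - xbar) \<bullet> (xbar - y)) \<le> 2 * (norm (x - xbar) * norm (y - xbar))"
    by simp
  finally have "norm (x - xbar) * norm (x - xbar) \<le> norm (x - xbar) * (4 * norm (y - xbar))"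
    by (simp add: power2_eq_square)
  then show ?thesis
    unfolding x_def[symmetric] by (cases "x = xbar") (auto simp: mult_le_cancel_left)
qed

text \<open>The condition \<open>4 * \<epsilon> < \<delta>\<close> keeps the proximal point inside
  the ball, so Fermat's rule gives a normal of the feasible set alone. The factor
  \<open>10 * c\<close> is \<open>2 * c\<close> times 5, with 5 = 4 + 1 from
  \<open>prox_near\<close>; it keeps the resulting tilt within the range of
  \<open>hypo\<close>.\<close>

lemma prox_normal:
  assumes H: "hypo \<delta> c" and stat: "- f' xbar \<in> N xbar"
    and \<epsilon>: "4 * \<epsilon> < \<delta>" "10 * c * \<epsilon> \<le> \<delta>" and y: "norm (y - xbar) < \<epsilon>"
  shows "(2 * c) *\<^sub>R (y - prox \<delta> (2 * c) y) - f' (prox \<delta> (2 * c) y) \<in> N (prox \<delta> (2 * c) y)"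
    "norm ((2 * c) *\<^sub>R (y - prox \<delta> (2 * c) y)) \<le> 10 * c * norm (y - xbar)"
    "norm ((2 * c) *\<^sub>R (y - prox \<delta> (2 * c) y)) \<le> \<delta>"
proof -
  define x where "x = prox \<delta> (2 * c) y"
  have c: "c > 0"
    by (rule hypoD(2)[OF H])
  have near: "norm (x - xbar) \<le> 4 * norm (y - xbar)"
    unfolding x_def by (rule prox_near[OF H stat])
  have x: "x \<in> \<Gamma>" "x \<in> cball xbar \<delta>"
    unfolding x_def by (rule prox_min[OF H])+
  have "(2 * c) *\<^sub>R (y - x) - f' x \<in> N x"
  proof (rule first_order_condition)
    show "x \<in> U"
      using x hypoD(3)[OF H] by blast
    show "0 < \<delta> - 4 * \<epsilon>" "0 \<le> c"
      using \<epsilon> c by auto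
    fix x'
    assume x': "x' \<in> \<Gamma>" "norm (x' - x) < \<delta> - 4 * \<epsilon>"
    have "x' \<in> cball xbar \<delta>"
      using x'(2) near y norm_triangle_ineq[of "x' - x" "x - xbar"]
      by (simp add: dist_norm norm_minus_commute)
    from prox_min(3)[OF H x'(1) this, of "2 * c" y]
    have "f x + c * (norm (x - y))\<^sup>2 \<le> f x' + c * (norm (x' - y))\<^sup>2"
      by (simp add: x_def)
    then show "f x + ((2 * c) *\<^sub>R (y - x)) \<bullet> (x' - x) - c * (norm (x' - x))\<^sup>2 \<le> f x'"
      unfolding norm_sq_diff_expand[of x' y x] by (simp add: inner_diff_left inner_diff_right inner_commute algebra_simps)
  qed
  then show "(2 * c) *\<^sub>R (y - prox \<delta> (2 * c) y) - f' (prox \<delta> (2 * c) y) \<in> N (prox \<delta> (2 * c) y)"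
    by (simp add: x_def)
  have "norm (y - x) \<le> 5 * norm (y - xbar)"
    using near norm_triangle_ineq4[of "y - xbar" "x - xbar"] by simp
  then have "2 * c * norm (y - x) \<le> 2 * c * (5 * norm (y - xbar))"
    using c by (intro mult_left_mono) auto
  then show le: "norm ((2 * c) *\<^sub>R (y - prox \<delta> (2 * c) y)) \<le> 10 * c * norm (y - xbar)"
    using c by (simp add: x_def)
  also have "\<dots> \<le> 10 * c * \<epsilon>"
    using y c by (intro mult_left_mono) auto
  finally show "norm ((2 * c) *\<^sub>R (y - prox \<delta> (2 * c) y)) \<le> \<delta>"
    using \<epsilon> by simp
qed

text \<open>The vector \<open>x + xs / (2 c)\<close> is the one whose proximal point should be
  \<open>x\<close>. Hypomonotonicity consumes \<open>c\<close> of the strength \<open>2 * c\<close>,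
  so the constant is 2. Stated for any pair of a point and a normal, it yields continuity of the
  mapping and, when the right side is 0, identifies \<open>x\<close> as a proximal point.\<close>

lemma prox_lipschitz:
  assumes H: "hypo \<delta> c" and stat: "- f' xbar \<in> N xbar"
    and \<epsilon>: "4 * \<epsilon> < \<delta>" "10 * c * \<epsilon> \<le> \<delta>" and y: "norm (y - xbar) < \<epsilon>"
    and x: "x \<in> \<Gamma>" "x \<in> cball xbar \<delta>" "norm xs \<le> \<delta>" "xs - f' x \<in> N x"
  shows "norm (x - prox \<delta> (2 * c) y) \<le> 2 * norm (x + (1 / (2 * c)) *\<^sub>R xs - y)"
proof -
  define p where "p = prox \<delta> (2 * c) y"
  define w where "w = x + (1 / (2 * c)) *\<^sub>R xs"
  have c: "c > 0"
    by (rule hypoD(2)[OF H])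
  have xs: "xs = (2 * c) *\<^sub>R (w - x)"
    using c by (simp add: w_def)
  have "(xs - (2 * c) *\<^sub>R (y - p)) \<bullet> (x - p) \<ge> - c * (norm (x - p))\<^sup>2"
    unfolding p_def by (rule hypo_mono[OF H x prox_min(1,2)[OF H] prox_normal(3,1)[OF H stat \<epsilon> y]])
  moreover have "(xs - (2 * c) *\<^sub>R (y - p)) \<bullet> (x - p) = c * (2 * ((w - y) \<bullet> (x - p)) - 2 * (norm (x - p))\<^sup>2)"
    unfolding xs power2_norm_eq_inner by (simp add: inner_diff_left inner_diff_right algebra_simps)
  ultimately have "c * (norm (x - p))\<^sup>2 \<le> c * (2 * ((w - y) \<bullet> (x - p)))"
    by (simp add: algebra_simps)
  then have "(norm (x - p))\<^sup>2 \<le> 2 * ((w - y) \<bullet> (x - p))"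
    using c by (simp only: mult_le_cancel_left_pos)
  also have "\<dots> \<le> 2 * (norm (w - y) * norm (x - p))"
    using norm_cauchy_schwarz by simp
  finally have "norm (x - p) * norm (x - p) \<le> norm (x - p) * (2 * norm (w - y))"
    by (simp add: power2_eq_square mult_ac)
  then show ?thesis
    unfolding p_def[symmetric] w_def[symmetric] by (cases "x = p") (auto simp: mult_le_cancel_left)
qed

text \<open>One directional multiplier per critical direction is enough for the contraction
  estimate; being maximizers, all of them give the same value. Both pointwise conditions of the
  theorem lead to this version.\<close>

definition second_order :: "real \<Rightarrow> real \<Rightarrow> bool" where
  "second_order \<kappa> \<eta> \<longleftrightarrow> (\<forall>x xs u. x \<in> \<Gamma> \<longrightarrow> norm (x - xbar) \<le> \<eta> \<longrightarrow> norm xs \<le> \<eta> \<longrightarrow> xs - f' x \<in> N x \<longrightarrow>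
    u \<in> crit_cone \<Gamma> x (xs - f' x) \<longrightarrow> norm u = 1 \<longrightarrow>
    (\<exists>lam\<in>dir_mults g Dg D2g x (xs - f' x) u. hess x u + lq x lam u \<ge> 1 / \<kappa>))"

text \<open>The modulus \<open>r\<kappa> / (1 + r\<kappa>)\<close> is the Lipschitz constant of the resolvent of a
  \<open>1/\<kappa>\<close>-strongly monotone mapping with parameter \<open>r = 2 c\<close>.\<close>

lemma prox_contraction:
  assumes H: "hypo \<delta> c" and stat: "- f' xbar \<in> N xbar" and \<kappa>: "\<kappa> > 0"
    and so: "second_order \<kappa> \<eta>"
    and \<epsilon>: "4 * \<epsilon> < \<delta>" "10 * c * \<epsilon> \<le> \<delta>" "4 * \<epsilon> \<le> \<eta>" "10 * c * \<epsilon> \<le> \<eta>"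
    and y: "norm (y1 - xbar) < \<epsilon>" "norm (y2 - xbar) < \<epsilon>"
  shows "norm (prox \<delta> (2 * c) y2 - prox \<delta> (2 * c) y1) \<le> 2 * c * \<kappa> / (1 + 2 * c * \<kappa>) * norm (y2 - y1)"
proof -
  define r where "r = 2 * c"
  define P where "P = prox \<delta> r"
  define D where "D = y2 - y1"
  define Yt where "Yt s = y1 + s *\<^sub>R D" for s
  have c: "c > 0" and r: "r > 0"
    using hypoD(2)[OF H] by (auto simp: r_def)
  have in_ball: "norm (Yt s - xbar) < \<epsilon>" if "s \<in> {0..1}" for s
  proof -
    have "(1 - s) *\<^sub>R y1 + s *\<^sub>R y2 \<in> ball xbar \<epsilon>"
      using y that by (intro convexD_alt[OF convex_ball]) (auto simp: dist_norm norm_minus_commute)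
    moreover have "(1 - s) *\<^sub>R y1 + s *\<^sub>R y2 = Yt s"
      by (simp add: Yt_def D_def algebra_simps)
    ultimately show ?thesis
      by (simp add: dist_norm norm_minus_commute)
  qed
  have P_feas: "P z \<in> \<Gamma>" "P z \<in> cball xbar \<delta>" for z
    unfolding P_def by (rule prox_min[OF H])+
  have P_normal: "r *\<^sub>R (z - P z) - f' (P z) \<in> N (P z)" "norm (r *\<^sub>R (z - P z)) \<le> \<delta>"
    "norm (r *\<^sub>R (z - P z)) \<le> \<eta>" "norm (P z - xbar) \<le> \<eta>" "norm (P z - xbar) < \<delta>" if "norm (z - xbar) < \<epsilon>" for z
  proof -
    show "r *\<^sub>R (z - P z) - f' (P z) \<in> N (P z)" "norm (r *\<^sub>R (z - P z)) \<le> \<delta>"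
      unfolding P_def r_def by (rule prox_normal[OF H stat \<epsilon>(1,2) that])+
    have "norm (r *\<^sub>R (z - P z)) \<le> 10 * c * norm (z - xbar)"
      unfolding P_def r_def by (rule prox_normal[OF H stat \<epsilon>(1,2) that])
    also have "\<dots> \<le> 10 * c * \<epsilon>"
      using that c by (intro mult_left_mono) auto
    finally show "norm (r *\<^sub>R (z - P z)) \<le> \<eta>"
      using \<epsilon> by simp
    have "norm (P z - xbar) \<le> 4 * norm (z - xbar)"
      unfolding P_def r_def by (rule prox_near[OF H stat])
    then show "norm (P z - xbar) \<le> \<eta>" "norm (P z - xbar) < \<delta>"
      using that \<epsilon> by auto
  qed
  \<comment> \<open>The crude constant 2 only makes the difference quotients precompact; the sharp
    constant is read off their limits.\<close>
  have P_lip: "norm (P z - P z') \<le> 2 * norm (z - z')" if z: "norm (z - xbar) < \<epsilon>" "norm (z' - xbar) < \<epsilon>" for z z'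
  proof -
    have "norm (P z - prox \<delta> (2 * c) z') \<le> 2 * norm (P z + (1 / (2 * c)) *\<^sub>R (r *\<^sub>R (z - P z)) - z')"
      by (rule prox_lipschitz[OF H stat \<epsilon>(1,2) z(2) P_feas P_normal(2,1)[OF z(1)]])
    also have "P z + (1 / (2 * c)) *\<^sub>R (r *\<^sub>R (z - P z)) = z"
      using c by (simp add: r_def)
    finally show ?thesis
      by (simp add: P_def r_def)
  qed
  have "norm (P (Yt 1) - P (Yt 0)) \<le> r * \<kappa> / (1 + r * \<kappa>) * norm D"
  proof (rule norm_diff_le_of_derivative_limits[where K = "2 * norm D"])
    fix s s' :: real
    assume "s \<in> {0..1}" "s' \<in> {0..1}"
    then have "norm (P (Yt s) - P (Yt s')) \<le> 2 * norm (Yt s - Yt s')"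
      by (intro P_lip in_ball)
    also have "Yt s - Yt s' = (s - s') *\<^sub>R D"
      by (simp add: Yt_def scaleR_diff_left)
    finally show "norm (P (Yt s) - P (Yt s')) \<le> 2 * norm D * \<bar>s - s'\<bar>"
      by (simp add: mult_ac)
  next
    fix s :: real and t :: "nat \<Rightarrow> real" and p
    assume s: "0 \<le> s" "s < 1" and t: "\<And>k. 0 < t k" and st: "\<And>k. s + t k \<le> 1" and t_lim: "t \<longlonglongrightarrow> 0"
      and p: "(\<lambda>k. (1 / t k) *\<^sub>R (P (Yt (s + t k)) - P (Yt s))) \<longlonglongrightarrow> p"
    define x where "x = P (Yt s)"
    define xs where "xs = r *\<^sub>R (Yt s - x)"
    define d where "d k = (1 / t k) *\<^sub>R (P (Yt (s + t k)) - P (Yt s))" for k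
    have d_lim: "d \<longlonglongrightarrow> p"
      using p by (simp add: d_def[abs_def])
    have X: "x + t k *\<^sub>R d k = P (Yt (s + t k))" for k
      using t[of k] by (simp add: d_def x_def)
    define V where "V k = r *\<^sub>R (Yt (s + t k) - P (Yt (s + t k)))" for k
    have st': "s + t k \<in> {0..1}" for k
      using s t[of k] st[of k] by simp
    have s': "s \<in> {0..1}"
      using s by simp
    have x: "x \<in> \<Gamma>" "x \<in> cball xbar \<delta>" "x \<in> U"
      unfolding x_def using P_feas hypoD(3)[OF H] by blast+
    have xs: "xs - f' x \<in> N x" "norm xs \<le> \<delta>" "norm xs \<le> \<eta>" "norm (x - xbar) \<le> \<eta>" "norm (x - xbar) < \<delta>"
      unfolding xs_def x_def by (rule P_normal[OF in_ball[OF s']])+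
    have V: "V k - f' (x + t k *\<^sub>R d k) \<in> N (x + t k *\<^sub>R d k)" "norm (V k) \<le> \<delta>" for k
      unfolding V_def X by (rule P_normal[OF in_ball[OF st']])+
    have Xk: "x + t k *\<^sub>R d k \<in> \<Gamma>" "x + t k *\<^sub>R d k \<in> cball xbar \<delta>" for k
      unfolding X by (rule P_feas)+
    define y where "y = xs - f' x"
    define Y where "Y k = V k - f' (x + t k *\<^sub>R d k)" for k
    \<comment> \<open>The normals attached to the moving proximal points are differentiable along
      the chosen sequence; the limit plays the role of \<open>q\<close> in
      \<open>normal_graph_tangent_bound\<close>.\<close>
    have Q: "(\<lambda>k. (1 / t k) *\<^sub>R (Y k - y)) \<longlonglongrightarrow> r *\<^sub>R (D - p) - f'' x p"
    proof -
      have "(\<lambda>k. r *\<^sub>R (D - d k) - (1 / t k) *\<^sub>R (f' (x + t k *\<^sub>R d k) - f' x)) \<longlonglongrightarrow> r *\<^sub>R (D - p) - f'' x p"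
        by (intro tendsto_intros d_lim has_derivative_diff_quotient[OF f'_deriv] x t t_lim)
      moreover have "(1 / t k) *\<^sub>R (Y k - y) = r *\<^sub>R (D - d k) - (1 / t k) *\<^sub>R (f' (x + t k *\<^sub>R d k) - f' x)" for k
      proof -
        have "Yt (s + t k) = Yt s + t k *\<^sub>R D"
          by (simp add: Yt_def scaleR_add_left)
        then have "V k - xs = t k *\<^sub>R (r *\<^sub>R (D - d k))"
          unfolding V_def xs_def X[symmetric] by (simp add: scaleR_diff_right scaleR_add_right mult.commute)
        then have "Y k - y = t k *\<^sub>R (r *\<^sub>R (D - d k)) - (f' (x + t k *\<^sub>R d k) - f' x)"
          unfolding Y_def y_def by (simp add: algebra_simps)
        then have "(1 / t k) *\<^sub>R (Y k - y) = (1 / t k) *\<^sub>R (t k *\<^sub>R (r *\<^sub>R (D - d k))) - (1 / t k) *\<^sub>R (f' (x + t k *\<^sub>R d k) - f' x)"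
          by (simp only: scaleR_diff_right)
        then show ?thesis
          using t[of k] by simp
      qed
      ultimately show ?thesis
        by simp
    qed
    have Y_lim: "Y \<longlonglongrightarrow> y"
    proof -
      have "(\<lambda>k. y + t k *\<^sub>R ((1 / t k) *\<^sub>R (Y k - y))) \<longlonglongrightarrow> y + 0 *\<^sub>R (r *\<^sub>R (D - p) - f'' x p)"
        by (intro tendsto_intros t_lim Q)
      moreover have "y + t k *\<^sub>R ((1 / t k) *\<^sub>R (Y k - y)) = Y k" for k
        using t[of k] by simp
      ultimately show ?thesis
        by simp
    qed
    have upper: "(\<lambda>k. t k * (c * (norm (d k))\<^sup>2)) \<longlonglongrightarrow> 0"
    proof -
      have "(\<lambda>k. t k * (c * (norm (d k))\<^sup>2)) \<longlonglongrightarrow> 0 * (c * (norm p)\<^sup>2)"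
        by (intro tendsto_intros t_lim d_lim)
      then show ?thesis
        by simp
    qed
    have prox_scaled: "v \<bullet> d k \<le> t k * (c * (norm (d k))\<^sup>2)" if "v \<bullet> (t k *\<^sub>R d k) \<le> c * (norm (t k *\<^sub>R d k))\<^sup>2" for v k
    proof -
      have "t k * (v \<bullet> d k) \<le> t k * (t k * (c * (norm (d k))\<^sup>2))"
        using that by (simp add: power_mult_distrib power2_eq_square mult_ac)
      then show ?thesis
        using t[of k] by (simp only: mult_le_cancel_left_pos)
    qed
    \<comment> \<open>Hypomonotonicity at \<open>x\<close> and at
      \<open>x + t k *\<^sub>R d k\<close>, each divided by the step, gives the two signs. Every
      limit \<open>p\<close> is therefore critical.\<close>
    have yp: "y \<bullet> p = 0"
    proof (rule antisym)
      have "y \<bullet> d k \<le> t k * (c * (norm (d k))\<^sup>2)" for k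
        using hypoD(4)[OF H x(1) Xk(1) x(2) Xk(2) xs(2,1)] by (intro prox_scaled) (simp add: y_def)
      then show "y \<bullet> p \<le> 0"
        by (intro LIMSEQ_le[OF tendsto_inner[OF tendsto_const d_lim] upper]) auto
      have "Y k \<bullet> (x - (x + t k *\<^sub>R d k)) \<le> c * (norm (x - (x + t k *\<^sub>R d k)))\<^sup>2" for k
        unfolding Y_def by (rule hypoD(4)[OF H Xk(1) x(1) Xk(2) x(2) V(2,1)])
      then have "(- Y k) \<bullet> d k \<le> t k * (c * (norm (d k))\<^sup>2)" for k
        by (intro prox_scaled) simp
      then have "(- y) \<bullet> p \<le> 0"
        by (intro LIMSEQ_le[OF tendsto_inner[OF tendsto_minus[OF Y_lim] d_lim] upper]) auto
      then show "0 \<le> y \<bullet> p"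
        by simp
    qed
    show "norm p \<le> r * \<kappa> / (1 + r * \<kappa>) * norm D"
    proof (cases "p = 0")
      case True
      then show ?thesis
        using r \<kappa> by simp
    next
      case False
      define u where "u = (1 / norm p) *\<^sub>R p"
      have pT: "p \<in> tangent_cone \<Gamma> x"
        unfolding tangent_cone_def using t t_lim d_lim Xk(1) by blast
      then have "u \<in> tangent_cone \<Gamma> x"
        unfolding u_def using False by (intro scaleR_tangent_cone) auto
      then have "u \<in> crit_cone \<Gamma> x (xs - f' x)" "norm u = 1"
        using yp False by (auto simp: crit_cone_def y_def u_def)
      then obtain lam where lam: "lam \<in> dir_mults g Dg D2g x y u" "hess x u + lq x lam u \<ge> 1 / \<kappa>"
        using so x(1) xs unfolding second_order_def y_def by blast
      have pu: "p = norm p *\<^sub>R u"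
        using False by (simp add: u_def)
      have lq_p: "lq x mu p = (norm p)\<^sup>2 * lq x mu u" for mu
        by (subst pu) (rule lagr_quad_scaleR)
      have hess_p: "hess x p = (norm p)\<^sup>2 * hess x u"
        by (subst (1 2) pu) (simp add: blinfun.scaleR_right power2_eq_square)
      have lam_p: "lam \<in> dir_mults g Dg D2g x y p"
        using lam(1) by (auto simp: dir_mults_def lq_p intro!: mult_left_mono)
      have "lq x lam p \<le> (r *\<^sub>R (D - p) - f'' x p) \<bullet> p"
      proof (rule normal_graph_tangent_bound[OF x(1,3) t t_lim d_lim Xk(1) Q _ _ yp lam_p])
        show "0 < \<delta> - norm (x - xbar)"
          using xs by simp
        fix k x'
        assume x': "x' \<in> \<Gamma>" "norm (x' - x) < \<delta> - norm (x - xbar)"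
        have "x' \<in> cball xbar \<delta>"
          using x'(2) norm_triangle_ineq[of "x' - x" "x - xbar"] by (simp add: dist_norm norm_minus_commute)
        then show "Y k \<bullet> (x' - (x + t k *\<^sub>R d k)) \<le> c * (norm (x' - (x + t k *\<^sub>R d k)))\<^sup>2"
          unfolding Y_def by (intro hypoD(4)[OF H Xk(1) x'(1) Xk(2) _ V(2,1)])
      qed
      then have "hess x p + lq x lam p \<le> r * (D \<bullet> p) - r * (norm p)\<^sup>2"
        by (simp add: inner_diff_left power2_norm_eq_inner right_diff_distrib)
      moreover have "(norm p)\<^sup>2 * (1 / \<kappa>) \<le> (norm p)\<^sup>2 * (hess x u + lq x lam u)"
        using lam(2) by (intro mult_left_mono) auto
      \<comment> \<open>The second-order condition contributes \<open>1 / \<kappa>\<close> and the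
        penalty \<open>r\<close>: together they give
        \<open>norm p * (1 / \<kappa> + r) \<le> r * norm D\<close>, which is the claimed
        constant.\<close>
      ultimately have "(norm p)\<^sup>2 * (1 / \<kappa>) \<le> r * (D \<bullet> p) - r * (norm p)\<^sup>2"
        by (simp add: lq_p hess_p distrib_left)
      also have "D \<bullet> p \<le> norm D * norm p"
        by (rule norm_cauchy_schwarz)
      then have "r * (D \<bullet> p) - r * (norm p)\<^sup>2 \<le> r * (norm D * norm p) - r * (norm p)\<^sup>2"
        using r by simp
      finally have "norm p * (norm p * (1 / \<kappa> + r)) \<le> norm p * (r * norm D)"
        by (simp add: power2_eq_square algebra_simps)
      then have "norm p * (1 / \<kappa> + r) \<le> r * norm D"
        using False by simp
      then have "\<kappa> * (norm p * (1 / \<kappa> + r)) \<le> \<kappa> * (r * norm D)"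
        using \<kappa> by (intro mult_left_mono) auto
      then have "norm p * (1 + r * \<kappa>) \<le> r * \<kappa> * norm D"
        using \<kappa> by (simp add: algebra_simps)
      then show ?thesis
        using r \<kappa> by (simp add: pos_le_divide_eq add_pos_pos)
    qed
  qed
  then show ?thesis
    by (simp add: Yt_def D_def P_def r_def)
qed

text \<open>Tilted minimizers over a ball satisfy the proximal fixed point equation only once they
  are known to avoid the sphere. Strict minimality of \<open>xbar\<close>, obtained from the
  envelope, ensures this through a positive gap on the sphere.\<close>

lemma sufficiency:
  assumes stat: "- f' xbar \<in> N xbar" and \<kappa>: "\<kappa> > 0" and \<eta>: "\<eta> > 0" and so: "second_order \<kappa> \<eta>"
  shows "tilt_stable f g xbar \<kappa>"
proof -
  obtain \<delta> c where H: "hypo \<delta> c"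
    using hypo_exists by blast
  have c: "c > 0" and \<delta>: "\<delta> > 0" and sub: "cball xbar \<delta> \<subseteq> U"
    using hypoD[OF H] by auto
  \<comment> \<open>The radius \<open>m\<close> respects both \<open>hypo\<close> and the
    second-order condition; \<open>m / 5\<close> makes \<open>4 * \<epsilon> < m\<close> strict and
    \<open>m / (10 * c)\<close> matches the tilt bound of \<open>prox_normal\<close>.\<close>
  define m where "m = min \<delta> \<eta>"
  define \<epsilon> where "\<epsilon> = min (m / 5) (m / (10 * c))"
  have m: "m > 0"
    using \<delta> \<eta> by (simp add: m_def)
  have \<epsilon>0: "\<epsilon> > 0"
    using m c by (simp add: \<epsilon>_def)
  have "\<epsilon> \<le> m / 5" "\<epsilon> \<le> m / (10 * c)"
    by (auto simp: \<epsilon>_def)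
  then have "4 * \<epsilon> < m" "10 * c * \<epsilon> \<le> m"
    using m c by (auto simp: field_simps)
  then have \<epsilon>: "4 * \<epsilon> < \<delta>" "10 * c * \<epsilon> \<le> \<delta>" "4 * \<epsilon> \<le> \<eta>" "10 * c * \<epsilon> \<le> \<eta>"
    by (auto simp: m_def)
  define r where "r = 2 * c"
  define P where "P = prox \<delta> r"
  define k0 where "k0 = r * \<kappa> / (1 + r * \<kappa>)"
  have r: "r > 0"
    using c by (simp add: r_def)
  have rk: "r * \<kappa> > 0"
    using r \<kappa> by simp
  have k0: "0 < k0" "k0 < 1"
    using rk by (auto simp: k0_def)
  have P_lip: "norm (P z - P w) \<le> k0 * norm (z - w)" if "norm (z - xbar) < \<epsilon>" "norm (w - xbar) < \<epsilon>" for z w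
    unfolding P_def k0_def r_def
    by (rule prox_contraction[OF H stat \<kappa> so \<epsilon> that(2,1)])
  have P_xbar: "P xbar = xbar"
    using prox_near[OF H stat, of xbar] by (simp add: P_def r_def)
  have P_feas: "P z \<in> \<Gamma>" "P z \<in> cball xbar \<delta>" for z
    unfolding P_def by (rule prox_min[OF H])+
  \<comment> \<open>The Moreau envelope: unlike \<open>f\<close> on the feasible set, it can be
    compared along segments that leave that set.\<close>
  define E where "E z = f (P z) + r / 2 * (norm (P z - z))\<^sup>2" for z
  have E_le: "E z \<le> f x + r / 2 * (norm (x - z))\<^sup>2" if "x \<in> \<Gamma>" "x \<in> cball xbar \<delta>" for x z
    unfolding E_def P_def by (rule prox_min(3)[OF H that])
  define \<gamma> where "\<gamma> = \<epsilon> / 2"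
  have \<gamma>: "\<gamma> > 0" "\<gamma> < \<epsilon>" "\<gamma> < \<delta>"
    using \<epsilon>0 \<epsilon>(1) by (auto simp: \<gamma>_def)
  have in_\<epsilon>: "norm (z - xbar) < \<epsilon>" if "z \<in> cball xbar \<gamma>" for z
    using that \<gamma> by (simp add: dist_norm norm_minus_commute)
  have E_cont: "continuous_on (cball xbar \<gamma>) E"
  proof -
    have "k0-lipschitz_on (cball xbar \<gamma>) P"
      using k0 P_lip in_\<epsilon> by (intro lipschitz_onI) (auto simp: dist_norm)
    then have cP: "continuous_on (cball xbar \<gamma>) P"
      by (rule lipschitz_on_continuous_on)
    moreover have "continuous_on (P ` cball xbar \<gamma>) f"
      using P_feas sub by (intro continuous_on_subset[OF continuous_on_f]) auto
    ultimately have "continuous_on (cball xbar \<gamma>) (\<lambda>z. f (P z))"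
      using continuous_on_compose2 by blast
    then show ?thesis
      unfolding E_def by (intro continuous_intros cP)
  qed
  have E_descent: "z = xbar" if z: "z \<in> cball xbar \<gamma>" and min: "\<And>w. w \<in> cball xbar \<gamma> \<Longrightarrow> E z \<le> E w" for z
  proof (rule ccontr)
    assume nz: "z \<noteq> xbar"
    \<comment> \<open>The point \<open>z\<close> is moved toward \<open>xbar\<close> by the fraction
      \<open>t\<close>, with the old \<open>P z\<close> as competitor. Since \<open>P z\<close> lies
      within \<open>k0\<close> times the distance from \<open>z\<close> to \<open>xbar\<close>, the
      squared distance to it changes by at most \<open>t * (t - 2 * (1 - k0))\<close> times
      \<open>(norm (xbar - z))\<^sup>2\<close>, which is negative for this \<open>t\<close>.\<close>
    define t where "t = 1 - k0"
    have t: "0 < t" "t < 1"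
      using k0 by (auto simp: t_def)
    define w where "w = z + t *\<^sub>R (xbar - z)"
    have "(1 - t) *\<^sub>R z + t *\<^sub>R xbar \<in> cball xbar \<gamma>"
      using z t \<gamma> by (intro convexD_alt[OF convex_cball]) auto
    then have "w \<in> cball xbar \<gamma>"
      by (simp add: w_def algebra_simps)
    then have "E z \<le> E w"
      by (rule min)
    also have "E w \<le> f (P z) + r / 2 * (norm (P z - w))\<^sup>2"
      by (rule E_le[OF P_feas])
    finally have "r / 2 * (norm (P z - z))\<^sup>2 \<le> r / 2 * (norm (P z - w))\<^sup>2"
      by (simp add: E_def)
    then have le: "(norm (P z - z))\<^sup>2 \<le> (norm (P z - w))\<^sup>2"
      using r by (simp add: mult_le_cancel_left_pos)
    have "(xbar - P z) \<bullet> (xbar - z) \<le> norm (xbar - P z) * norm (xbar - z)"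
      by (rule norm_cauchy_schwarz)
    also have "norm (xbar - P z) \<le> k0 * norm (xbar - z)"
      using P_lip[of xbar z] in_\<epsilon>[OF z] \<epsilon>0 by (simp add: P_xbar)
    then have "norm (xbar - P z) * norm (xbar - z) \<le> k0 * norm (xbar - z) * norm (xbar - z)"
      by (intro mult_right_mono) auto
    finally have cs: "(xbar - P z) \<bullet> (xbar - z) \<le> k0 * (norm (xbar - z))\<^sup>2"
      by (simp add: power2_eq_square mult.assoc)
    have zw: "z - w = - (t *\<^sub>R (xbar - z))"
      by (simp add: w_def)
    have "(norm (P z - w))\<^sup>2 = (norm (P z - z))\<^sup>2 + 2 * ((P z - z) \<bullet> (z - w)) + (norm (z - w))\<^sup>2"
      by (rule norm_sq_diff_expand)
    also have "(norm (z - w))\<^sup>2 = t\<^sup>2 * (norm (xbar - z))\<^sup>2"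
      unfolding zw by (simp add: power_mult_distrib)
    also have "(P z - z) \<bullet> (z - w) = t * ((xbar - P z) \<bullet> (xbar - z) - (norm (xbar - z))\<^sup>2)"
      unfolding zw power2_norm_eq_inner by (simp add: inner_diff_left inner_diff_right algebra_simps)
    finally have "0 \<le> t * (2 * ((xbar - P z) \<bullet> (xbar - z) - (norm (xbar - z))\<^sup>2) + t * (norm (xbar - z))\<^sup>2)"
      using le by (simp add: power2_eq_square algebra_simps)
    then have "0 \<le> 2 * ((xbar - P z) \<bullet> (xbar - z) - (norm (xbar - z))\<^sup>2) + t * (norm (xbar - z))\<^sup>2"
      using t by (simp add: zero_le_mult_iff)
    then have "0 \<le> - (1 - k0) * (norm (xbar - z))\<^sup>2"
      using cs by (simp add: t_def algebra_simps)
    moreover have "0 < (1 - k0) * (norm (xbar - z))\<^sup>2"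
      using k0 nz by simp
    ultimately show False
      unfolding mult_minus_left by linarith
  qed
  obtain z0 where z0: "z0 \<in> cball xbar \<gamma>" "\<And>w. w \<in> cball xbar \<gamma> \<Longrightarrow> E z0 \<le> E w"
    using continuous_attains_inf[OF compact_cball _ E_cont] \<gamma> by auto
  have "z0 = xbar"
    using E_descent z0 by blast
  \<comment> \<open>The envelope lies below \<open>f\<close> at feasible points of the ball and
    agrees with it at \<open>xbar\<close>, so strict minimality passes from \<open>E\<close> to
    \<open>f\<close>.\<close>
  have strict: "f xbar < f x" if x: "x \<in> \<Gamma>" "x \<in> cball xbar \<gamma>" "x \<noteq> xbar" for x
  proof -
    have "E xbar < E x"
      using E_descent[OF x(2)] x(3) z0(2) \<open>z0 = xbar\<close> by force
    also have "E x \<le> f x"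
      using E_le[of x x] x \<gamma> by simp
    finally show ?thesis
      by (simp add: E_def P_xbar)
  qed
  have xbar_c: "xbar \<in> cball xbar \<gamma>"
    using \<gamma> by simp
  have sub_\<gamma>: "cball xbar \<gamma> \<subseteq> U"
    using sub \<gamma> by auto
  have "\<exists>gap>0. \<forall>x\<in>\<Gamma>. norm (x - xbar) = \<gamma> \<longrightarrow> f xbar + gap \<le> f x"
  proof (cases "\<Gamma> \<inter> cball xbar \<gamma> \<inter> sphere xbar \<gamma> = {}")
    case True
    then show ?thesis
      by (intro exI[of _ 1]) (auto simp: dist_norm norm_minus_commute)
  next
    case False
    have "compact (\<Gamma> \<inter> cball xbar \<gamma> \<inter> sphere xbar \<gamma>)"
      by (intro compact_Int_closed compact_feas_cball[OF sub_\<gamma>]) auto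
    moreover have "continuous_on (\<Gamma> \<inter> cball xbar \<gamma> \<inter> sphere xbar \<gamma>) f"
      using sub_\<gamma> by (intro continuous_on_subset[OF continuous_on_f]) auto
    ultimately obtain s where s: "s \<in> \<Gamma> \<inter> cball xbar \<gamma> \<inter> sphere xbar \<gamma>"
      "\<And>x. x \<in> \<Gamma> \<inter> cball xbar \<gamma> \<inter> sphere xbar \<gamma> \<Longrightarrow> f s \<le> f x"
      using continuous_attains_inf False by metis
    have "f xbar < f s"
      using s(1) \<gamma> by (intro strict) auto
    then show ?thesis
      using s(2) by (intro exI[of _ "f s - f xbar"]) (auto simp: dist_norm norm_minus_commute)
  qed
  then obtain gap where gap: "gap > 0" "\<And>x. x \<in> \<Gamma> \<Longrightarrow> norm (x - xbar) = \<gamma> \<Longrightarrow> f xbar + gap \<le> f x"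
    by blast
  \<comment> \<open>\<open>gap / \<gamma>\<close> keeps tilted minimizers off the sphere, \<delta>
    keeps the tilt within the range of \<open>hypo\<close>, and \<open>r * \<gamma>\<close> makes
    the shift by \<open>v / r\<close> shorter than \<gamma>, so that it ends within \<epsilon>,
    which is twice \<gamma>.\<close>
  define \<rho> where "\<rho> = Min {gap / \<gamma>, \<delta>, r * \<gamma>}"
  have \<rho>: "\<rho> > 0" "\<rho> \<le> gap / \<gamma>" "\<rho> \<le> \<delta>" "\<rho> \<le> r * \<gamma>"
    using gap \<gamma> \<delta> r by (auto simp: \<rho>_def)
  have M_ne: "\<exists>x. x \<in> Mtilt f g xbar \<gamma> v" for v
  proof -
    have "continuous_on (\<Gamma> \<inter> cball xbar \<gamma>) (\<lambda>x. f x - v \<bullet> x)"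
      using sub_\<gamma> by (intro continuous_intros continuous_on_subset[OF continuous_on_f]) auto
    moreover have "xbar \<in> \<Gamma> \<inter> cball xbar \<gamma>"
      using xbar_feas xbar_c by blast
    then have "\<Gamma> \<inter> cball xbar \<gamma> \<noteq> {}"
      by blast
    ultimately obtain x where "x \<in> \<Gamma> \<inter> cball xbar \<gamma>" "\<forall>x'\<in>\<Gamma> \<inter> cball xbar \<gamma>. f x - v \<bullet> x \<le> f x' - v \<bullet> x'"
      using continuous_attains_inf[OF compact_feas_cball[OF sub_\<gamma>], of "\<lambda>x. f x - v \<bullet> x"] by blast
    then have "x \<in> Mtilt f g xbar \<gamma> v"
      by (auto simp: Mtilt_def dist_norm norm_minus_commute)
    then show ?thesis
      by blast
  qed
  have M_prox: "x = P (x + (1 / r) *\<^sub>R v) \<and> norm (x + (1 / r) *\<^sub>R v - xbar) < \<epsilon>"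
    if v: "norm v < \<rho>" and x: "x \<in> Mtilt f g xbar \<gamma> v" for x v
  proof -
    have xf: "x \<in> \<Gamma>" "norm (x - xbar) \<le> \<gamma>"
      and min: "\<And>x'. x' \<in> \<Gamma> \<Longrightarrow> norm (x' - xbar) \<le> \<gamma> \<Longrightarrow> f x - v \<bullet> x \<le> f x' - v \<bullet> x'"
      using x by (auto simp: Mtilt_def)
    have "norm (x - xbar) \<noteq> \<gamma>"
    proof
      assume eq: "norm (x - xbar) = \<gamma>"
      have "f xbar + gap \<le> f x"
        by (rule gap(2)[OF xf(1) eq])
      moreover have "f x - v \<bullet> x \<le> f xbar - v \<bullet> xbar"
        using min[OF xbar_feas] \<gamma> by simp
      ultimately have "gap \<le> v \<bullet> (x - xbar)"
        by (simp add: inner_diff_right)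
      also have "\<dots> \<le> norm v * norm (x - xbar)"
        by (rule norm_cauchy_schwarz)
      also have "\<dots> < gap / \<gamma> * \<gamma>"
        unfolding eq using v \<rho> \<gamma> by (intro mult_strict_right_mono) auto
      finally show False
        using \<gamma> by simp
    qed
    then have inside: "norm (x - xbar) < \<gamma>"
      using xf by simp
    have xU: "x \<in> U" "x \<in> cball xbar \<delta>"
      using xf(2) sub_\<gamma> \<gamma> by (auto simp: dist_norm norm_minus_commute)
    have normal: "v - f' x \<in> N x"
    proof (rule first_order_condition[OF xU(1), of "\<gamma> - norm (x - xbar)" 0])
      fix x'
      assume "x' \<in> \<Gamma>" "norm (x' - x) < \<gamma> - norm (x - xbar)"
      then have "f x - v \<bullet> x \<le> f x' - v \<bullet> x'"
        using norm_triangle_ineq[of "x' - x" "x - xbar"] by (intro min) auto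
      then show "f x + v \<bullet> (x' - x) - 0 * (norm (x' - x))\<^sup>2 \<le> f x'"
        by (simp add: inner_diff_right)
    qed (use inside in auto)
    define z where "z = x + (1 / r) *\<^sub>R v"
    have "norm v / r < \<gamma>"
      using v \<rho>(4) r by (simp add: pos_divide_less_eq mult.commute)
    moreover have "norm (z - xbar) \<le> norm (x - xbar) + norm v / r"
      using norm_triangle_ineq[of "x - xbar" "(1 / r) *\<^sub>R v"] r by (simp add: z_def algebra_simps)
    moreover have "\<epsilon> = \<gamma> + \<gamma>"
      by (simp add: \<gamma>_def)
    ultimately have z: "norm (z - xbar) < \<epsilon>"
      using inside by linarith
    have "norm v \<le> \<delta>"
      using v \<rho>(3) by simp
    then have "norm (x - prox \<delta> (2 * c) z) \<le> 2 * norm (x + (1 / (2 * c)) *\<^sub>R v - z)"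
      by (rule prox_lipschitz[OF H stat \<epsilon>(1,2) z xf(1) xU(2) _ normal])
    then have "x = P z"
      by (simp add: z_def P_def r_def)
    then show ?thesis
      using z unfolding z_def by (rule conjI)
  qed
  have M_lip: "norm (x - y) \<le> \<kappa> * norm (v - w)"
    if v: "norm v < \<rho>" and w: "norm w < \<rho>" and x: "x \<in> Mtilt f g xbar \<gamma> v" and y: "y \<in> Mtilt f g xbar \<gamma> w" for x y v w
  proof -
    define a where "a = x + (1 / r) *\<^sub>R v"
    define b where "b = y + (1 / r) *\<^sub>R w"
    note a = M_prox[OF v x, folded a_def] and b = M_prox[OF w y, folded b_def]
    have "norm (P a - P b) \<le> k0 * norm (a - b)"
      using a b by (intro P_lip) blast+
    then have "norm (x - y) \<le> k0 * norm (a - b)"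
      by (simp only: conjunct1[OF a, symmetric] conjunct1[OF b, symmetric])
    also have "a - b = (x - y) + (1 / r) *\<^sub>R (v - w)"
      by (simp add: a_def b_def algebra_simps)
    also have "norm \<dots> \<le> norm (x - y) + norm (v - w) / r"
      using norm_triangle_ineq[of "x - y" "(1 / r) *\<^sub>R (v - w)"] r by simp
    finally have "norm (x - y) \<le> k0 * (norm (x - y) + norm (v - w) / r)"
      using k0 by simp
    \<comment> \<open>The unknown distance stands on both sides. Multiplication by
      \<open>1 + r * \<kappa>\<close> absorbs it, because \<open>k0 / (r * (1 - k0))\<close> equals
      \<kappa>.\<close>
    then have "(1 + r * \<kappa>) * norm (x - y) \<le> (1 + r * \<kappa>) * (k0 * (norm (x - y) + norm (v - w) / r))"
      using rk by simp
    also have "\<dots> = r * \<kappa> * (norm (x - y) + norm (v - w) / r)"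
      using rk by (simp add: k0_def)
    finally show ?thesis
      using r by (simp add: algebra_simps)
  qed
  have single: "Mtilt f g xbar \<gamma> v = {SOME x. x \<in> Mtilt f g xbar \<gamma> v}" if v: "norm v < \<rho>" for v
  proof -
    have in_M: "(SOME x. x \<in> Mtilt f g xbar \<gamma> v) \<in> Mtilt f g xbar \<gamma> v"
      using someI_ex[OF M_ne] .
    have "x = (SOME x. x \<in> Mtilt f g xbar \<gamma> v)" if "x \<in> Mtilt f g xbar \<gamma> v" for x
      using M_lip[OF v v that in_M] by simp
    then show ?thesis
      using in_M by blast
  qed
  have "xbar \<in> Mtilt f g xbar \<gamma> 0"
    using xbar_feas \<gamma> strict by (force simp: Mtilt_def dist_norm norm_minus_commute)
  then have at0: "Mtilt f g xbar \<gamma> 0 = {xbar}"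
    using single[of 0] \<rho> by (metis norm_zero singletonD)
  show ?thesis
    unfolding tilt_stable_def
  proof (intro exI[of _ \<gamma>] exI[of _ "ball 0 \<rho>"] exI[of _ "\<lambda>v. SOME x. x \<in> Mtilt f g xbar \<gamma> v"] conjI ballI)
    show "Mtilt f g xbar \<gamma> v = {SOME x. x \<in> Mtilt f g xbar \<gamma> v}" if "v \<in> ball 0 \<rho>" for v
      using single that by simp
    show "dist (SOME x. x \<in> Mtilt f g xbar \<gamma> v) (SOME x. x \<in> Mtilt f g xbar \<gamma> w) \<le> \<kappa> * dist v w"
      if "v \<in> ball 0 \<rho>" "w \<in> ball 0 \<rho>" for v w
      using M_lip[of v w] that someI_ex[OF M_ne] by (simp add: dist_norm)
  qed (use \<gamma> \<rho> at0 in auto)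
qed

section \<open>Necessity\<close>

text \<open>The uniform bound on multipliers lets them converge along a subsequence. Polarity and
  complementarity are closed conditions, and \<open>multiplier_regular_normal\<close> turns the
  limit multiplier back into a regular normal.\<close>

lemma stationary_regular_normal:
  assumes "stationary f' g xbar"
  shows "- f' xbar \<in> N xbar"
proof -
  obtain X V where X: "\<And>k. X k \<in> \<Gamma>" "X \<longlonglongrightarrow> xbar" and V: "\<And>k. V k \<in> N (X k)" "V \<longlonglongrightarrow> - f' xbar"
    using assms unfolding stationary_def limiting_normal_def by blast
  have "\<forall>\<^sub>F k in sequentially. X k \<in> U"
    using X(2) open_U xbar_U by (rule topological_tendstoD)
  then obtain n0 where n0: "\<And>k. k \<ge> n0 \<Longrightarrow> X k \<in> U"
    by (auto simp: eventually_sequentially)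
  have "\<exists>lam. lam \<in> mlt (X (k + n0)) (V (k + n0)) \<and> norm lam \<le> \<sigma> * norm (V (k + n0))" for k
  proof -
    have "X (k + n0) \<in> U"
      by (simp add: n0)
    then obtain lam where "lam \<in> mlt (X (k + n0)) (V (k + n0))" "norm lam \<le> \<sigma> * norm (V (k + n0))"
      by (rule regular_normal_multiplier[OF X(1) _ V(1)])
    then show ?thesis
      by blast
  qed
  then obtain L where L: "\<And>k. L k \<in> mlt (X (k + n0)) (V (k + n0))" "\<And>k. norm (L k) \<le> \<sigma> * norm (V (k + n0))"
    by metis
  have "Bseq V"
    using V(2) convergent_imp_Bseq convergent_def by blast
  then obtain B where B: "B > 0" "\<And>k. norm (V k) \<le> B"
    by (auto simp: Bseq_def)
  have "norm (L k) \<le> \<sigma> * B" for k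
    using order_trans[OF L(2) mult_left_mono[OF B(2)]] sigma_pos by simp
  then have "bounded (range L)"
    by (auto simp: bounded_iff)
  then obtain l \<rho> where \<rho>: "strict_mono \<rho>" "(L \<circ> \<rho>) \<longlonglongrightarrow> l"
    using bounded_imp_convergent_subsequence by blast
  define s where "s k = \<rho> k + n0" for k
  have "strict_mono s"
    using \<rho>(1) by (auto simp: s_def strict_mono_def)
  then have Xs: "(\<lambda>k. X (s k)) \<longlonglongrightarrow> xbar" and Vs: "(\<lambda>k. V (s k)) \<longlonglongrightarrow> - f' xbar"
    using LIMSEQ_subseq_LIMSEQ[OF X(2)] LIMSEQ_subseq_LIMSEQ[OF V(2)] by (auto simp: o_def)
  have Ls: "(\<lambda>k. L (\<rho> k)) \<longlonglongrightarrow> l"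
    using \<rho>(2) by (simp add: o_def)
  have mem: "L (\<rho> k) \<in> soc_dual" "L (\<rho> k) \<bullet> g (X (s k)) = 0" "\<And>h. L (\<rho> k) \<bullet> Dg (X (s k)) h = V (s k) \<bullet> h" for k
    using L(1)[of "\<rho> k"] feasD[OF X(1)] by (auto simp: mults_def normal_soc_eq s_def)
  have gX: "(\<lambda>k. g (X (s k))) \<longlonglongrightarrow> g xbar" and DgX: "(\<lambda>k. Dg (X (s k))) \<longlonglongrightarrow> Dg xbar"
    using isCont_tendsto_compose[where g = g, OF has_derivative_continuous[OF g_deriv[OF xbar_U]] Xs]
      isCont_tendsto_compose[where g = Dg, OF has_derivative_continuous[OF Dg_deriv[OF xbar_U]] Xs]
    by simp_all
  have "l \<in> soc_dual"
    by (rule closed_sequentially[OF closed_soc_dual _ Ls]) (rule mem(1))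
  moreover have "l \<bullet> g xbar = 0"
    using tendsto_inner[OF Ls gX] unfolding mem(2) by (simp add: LIMSEQ_const_iff)
  moreover have "l \<bullet> Dg xbar h = - f' xbar \<bullet> h" for h
  proof (rule LIMSEQ_unique)
    show "(\<lambda>k. V (s k) \<bullet> h) \<longlonglongrightarrow> - f' xbar \<bullet> h"
      by (intro tendsto_intros Vs)
    have "(\<lambda>k. L (\<rho> k) \<bullet> Dg (X (s k)) h) \<longlonglongrightarrow> l \<bullet> Dg xbar h"
      by (intro tendsto_intros Ls DgX)
    then show "(\<lambda>k. V (s k) \<bullet> h) \<longlonglongrightarrow> l \<bullet> Dg xbar h"
      by (simp add: mem(3))
  qed
  ultimately have l: "l \<in> mlt xbar (- f' xbar)"
    using feasD[OF xbar_feas] by (simp add: mults_def normal_soc_eq)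
  obtain \<delta> where \<delta>: "\<delta> > 0" "\<And>x lam y. x \<in> \<Gamma> \<Longrightarrow> x \<in> ball xbar \<delta> \<Longrightarrow> lam \<in> mlt x y \<Longrightarrow> y \<in> N x"
    by (rule multiplier_regular_normal) blast
  show ?thesis
    using \<delta>(1) by (intro \<delta>(2)[OF xbar_feas _ l]) simp
qed

text \<open>A Lipschitz solution map \<open>m\<close> is the gradient of the convex function \<open>-\<psi>\<close>, where \<open>\<psi>\<close> is the
  optimal value; the growth estimate is the conjugate of the resulting quadratic upper bound.\<close>

lemma tilt_stable_growth:
  assumes tilt: "tilt_stable f g xbar \<kappa>" and \<kappa>: "\<kappa> > 0"
  obtains \<eta> where "\<eta> > 0" "\<And>x x' xs. x \<in> \<Gamma> \<Longrightarrow> x' \<in> \<Gamma> \<Longrightarrow> norm (x - xbar) \<le> \<eta> \<Longrightarrow> norm (x' - x) \<le> \<eta> \<Longrightarrow>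
    norm xs \<le> \<eta> \<Longrightarrow> xs - f' x \<in> N x \<Longrightarrow> f x' \<ge> f x + xs \<bullet> (x' - x) + (norm (x' - x))\<^sup>2 / (2 * \<kappa>)"
proof -
  obtain \<gamma> V m where \<gamma>: "\<gamma> > 0" and V: "open V" "0 \<in> V" and M0: "Mtilt f g xbar \<gamma> 0 = {xbar}"
    and M: "\<And>v. v \<in> V \<Longrightarrow> Mtilt f g xbar \<gamma> v = {m v}"
    and lip: "\<And>v w. v \<in> V \<Longrightarrow> w \<in> V \<Longrightarrow> dist (m v) (m w) \<le> \<kappa> * dist v w"
    using tilt unfolding tilt_stable_def by blast
  obtain \<rho>0 where \<rho>0: "\<rho>0 > 0" "ball 0 \<rho>0 \<subseteq> V"
    using V openE by blast
  obtain \<delta> c where H: "hypo \<delta> c"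
    using hypo_exists by blast
  have c: "c > 0" and \<delta>: "\<delta> > 0" and sub: "cball xbar \<delta> \<subseteq> U"
    using hypoD[OF H] by auto
  define \<psi> where "\<psi> v = f (m v) - v \<bullet> m v" for v
  have m_M: "m v \<in> \<Gamma>" "norm (m v - xbar) \<le> \<gamma>" "\<And>x. x \<in> \<Gamma> \<Longrightarrow> norm (x - xbar) \<le> \<gamma> \<Longrightarrow> \<psi> v \<le> f x - v \<bullet> x"
    if "v \<in> V" for v
    using M[OF that] unfolding Mtilt_def \<psi>_def by blast+
  have m0: "m 0 = xbar"
    using M[OF V(2)] M0 by simp
  have m_near: "norm (m v - xbar) \<le> \<kappa> * norm v" if "v \<in> V" for v
    using lip[OF that V(2)] by (simp add: m0 dist_norm)
  \<comment> \<open>The minimizer for \<open>v\<close> is a competitor for \<open>w\<close>: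
    \<open>- m v\<close> is a supergradient of the optimal value \<psi>.\<close>
  have sub_ineq: "\<psi> w \<le> \<psi> v - m v \<bullet> (w - v)" if "v \<in> V" "w \<in> V" for v w
    using m_M(3)[OF that(2) m_M(1,2)[OF that(1)]]
    by (simp add: \<psi>_def inner_diff_right inner_commute)
  define \<rho> where "\<rho> = Min {\<rho>0 / 2, \<gamma> / (2 * \<kappa>), \<delta> / \<kappa>, \<delta>}"
  have \<rho>_le: "\<rho> \<le> \<rho>0 / 2" "\<rho> \<le> \<gamma> / (2 * \<kappa>)" "\<rho> \<le> \<delta> / \<kappa>" "\<rho> \<le> \<delta>"
    unfolding \<rho>_def by (rule Min_le; simp)+
  have \<rho>: "\<rho> > 0" "\<rho> < \<rho>0" "\<kappa> * \<rho> < \<gamma>" "\<kappa> * \<rho> \<le> \<delta>" "\<rho> \<le> \<delta>"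
  proof -
    show "\<rho> > 0"
      using \<rho>0 \<gamma> \<delta> \<kappa> by (simp add: \<rho>_def)
    show "\<rho> < \<rho>0" "\<rho> \<le> \<delta>"
      using \<rho>_le \<rho>0(1) by auto
    show "\<kappa> * \<rho> < \<gamma>"
      using mult_left_mono[OF \<rho>_le(2), of \<kappa>] \<kappa> \<gamma> by simp
    show "\<kappa> * \<rho> \<le> \<delta>"
      using mult_left_mono[OF \<rho>_le(3), of \<kappa>] \<kappa> by simp
  qed
  have inV: "v \<in> V" if "norm v \<le> \<rho>" for v
    using that \<rho> \<rho>0 by (intro subsetD[OF \<rho>0(2)]) simp
  have m_\<delta>: "m v \<in> cball xbar \<delta>" "norm (m v - xbar) < \<gamma>" if v: "norm v \<le> \<rho>" for v
  proof -
    have "norm (m v - xbar) \<le> \<kappa> * \<rho>"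
      using m_near[OF inV[OF v]] mult_left_mono[OF v, of \<kappa>] \<kappa> by linarith
    then show "m v \<in> cball xbar \<delta>" "norm (m v - xbar) < \<gamma>"
      using \<rho>(3,4) by (simp_all add: dist_norm norm_minus_commute)
  qed
  have m_normal: "v - f' (m v) \<in> N (m v)" if v: "norm v \<le> \<rho>" for v
  proof (rule first_order_condition[of _ "\<gamma> - norm (m v - xbar)" 0])
    show "m v \<in> U"
      using m_\<delta>[OF v] sub by blast
    show "0 < \<gamma> - norm (m v - xbar)"
      using m_\<delta>[OF v] by simp
    fix x'
    assume x': "x' \<in> \<Gamma>" "norm (x' - m v) < \<gamma> - norm (m v - xbar)"
    then have "\<psi> v \<le> f x' - v \<bullet> x'"
      using norm_triangle_ineq[of "x' - m v" "m v - xbar"] by (intro m_M(3)[OF inV[OF v]]) auto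
    then show "f (m v) + v \<bullet> (x' - m v) - 0 * (norm (x' - m v))\<^sup>2 \<le> f x'"
      by (simp add: \<psi>_def inner_diff_right)
  qed simp
  have m_cont: "continuous_on (cball 0 \<rho>) m"
  proof (rule lipschitz_on_continuous_on[of \<kappa>], rule lipschitz_onI)
    show "dist (m v) (m w) \<le> \<kappa> * dist v w" if "v \<in> cball 0 \<rho>" "w \<in> cball 0 \<rho>" for v w
      using that by (intro lip inV) auto
  qed (use \<kappa> in simp)
  have \<psi>_cont: "continuous_on (cball 0 \<rho>) \<psi>"
  proof -
    have "continuous_on (m ` cball 0 \<rho>) f"
      using m_\<delta> sub by (intro continuous_on_subset[OF continuous_on_f]) auto
    then have "continuous_on (cball 0 \<rho>) (\<lambda>v. f (m v))"
      using m_cont continuous_on_compose2 by blast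
    then show ?thesis
      unfolding \<psi>_def by (intro continuous_intros m_cont)
  qed
  define r where "r = 2 * c"
  have r: "r > 0"
    using c by (simp add: r_def)
  \<comment> \<open>Every nearby point with a normal solves its tilted problem. The equation
    \<open>m w + (w - xs) / r = x\<close> is solved by minimizing the strongly convex
    \<open>Hf\<close>; then \<open>(m w, w)\<close> and \<open>(x, xs)\<close> are both pairs of a
    point and a tilt to which hypomonotonicity applies, and \<open>c < r\<close> forces them to
    coincide.\<close>
  have is_m: "x = m xs"
    if x: "x \<in> \<Gamma>" "x \<in> cball xbar \<delta>" "norm xs \<le> \<delta>" "xs - f' x \<in> N x"
      and small: "2 * r * norm (x - xbar) + 2 * norm xs < \<rho>" for x xs
  proof -
    define Hf where "Hf w = - \<psi> w + (norm (w - xs))\<^sup>2 / (2 * r) - x \<bullet> w" for w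
    have "continuous_on (cball 0 \<rho>) Hf"
      unfolding Hf_def using r by (intro continuous_intros \<psi>_cont) auto
    then obtain w where w: "w \<in> cball 0 \<rho>" "\<And>w'. w' \<in> cball 0 \<rho> \<Longrightarrow> Hf w \<le> Hf w'"
      using continuous_attains_inf[OF compact_cball, of 0 \<rho> Hf] \<rho>(1) by auto
    have wV: "w \<in> V"
      using w(1) by (intro inV) simp
    \<comment> \<open>The minimizer has to be interior for the gradient step below. Comparison with
      0 bounds it, and \<open>small\<close> is calibrated to this bound.\<close>
    have "norm w \<le> 2 * r * norm (x - xbar) + 2 * norm xs"
    proof -
      have "Hf w \<le> Hf 0"
        using w(2)[of 0] \<rho>(1) by simp
      moreover have "\<psi> w \<le> \<psi> 0 - xbar \<bullet> w"
        using sub_ineq[OF V(2) wV] by (simp add: m0)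
      ultimately have "(norm (w - xs))\<^sup>2 / (2 * r) - (norm xs)\<^sup>2 / (2 * r) \<le> (x - xbar) \<bullet> w"
        by (simp add: Hf_def inner_diff_left)
      also have "(norm (w - xs))\<^sup>2 / (2 * r) - (norm xs)\<^sup>2 / (2 * r) = ((norm w)\<^sup>2 - 2 * (w \<bullet> xs)) / (2 * r)"
        using norm_sq_diff_expand[of w xs 0] by (simp add: diff_divide_distrib add_divide_distrib)
      finally have "(norm w)\<^sup>2 - 2 * (w \<bullet> xs) \<le> 2 * r * ((x - xbar) \<bullet> w)"
        using r by (simp add: pos_divide_le_eq mult.commute)
      also have "(x - xbar) \<bullet> w \<le> norm (x - xbar) * norm w"
        by (rule norm_cauchy_schwarz)
      then have "2 * r * ((x - xbar) \<bullet> w) \<le> 2 * r * (norm (x - xbar) * norm w)"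
        using r by simp
      finally have "(norm w)\<^sup>2 \<le> 2 * r * (norm (x - xbar) * norm w) + 2 * (w \<bullet> xs)"
        by simp
      also have "w \<bullet> xs \<le> norm w * norm xs"
        by (rule norm_cauchy_schwarz)
      finally have "norm w * norm w \<le> norm w * (2 * r * norm (x - xbar) + 2 * norm xs)"
        by (simp add: power2_eq_square algebra_simps)
      then show ?thesis
        using r by (cases "w = 0") (auto simp: mult_le_cancel_left)
    qed
    then have w_int: "norm w < \<rho>"
      using small by linarith
    \<comment> \<open>\<open>G\<close> is the gradient of \<open>Hf\<close> at \<open>w\<close>. If
      it were nonzero, a short step along \<open>- G\<close> would lower \<open>Hf\<close>;
      \<open>K\<close> below collects the losses from the Lipschitz constant of \<open>m\<close> and
      from the quadratic term.\<close>
    define G where "G = m w + (1 / r) *\<^sub>R (w - xs) - x"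
    have "G = 0"
    proof (rule ccontr)
      assume nz: "G \<noteq> 0"
      define K where "K = \<kappa> + 1 / (2 * r)"
      have K: "K > 0"
        using \<kappa> r by (simp add: K_def add_pos_pos)
      define t where "t = min (1 / (2 * K)) ((\<rho> - norm w) / norm G)"
      have t: "t > 0" "t * K < 1" "t * norm G \<le> \<rho> - norm w"
      proof -
        show "t > 0"
          using K w_int nz by (simp add: t_def)
        have "t \<le> 1 / (2 * K)" "t \<le> (\<rho> - norm w) / norm G"
          by (auto simp: t_def)
        then show "t * K < 1" "t * norm G \<le> \<rho> - norm w"
          using K nz by (auto simp: field_simps)
      qed
      define w' where "w' = w - t *\<^sub>R G"
      have w': "w' \<in> cball 0 \<rho>"
        using norm_triangle_ineq4[of w "t *\<^sub>R G"] t by (simp add: w'_def)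
      have w'V: "w' \<in> V"
        using w' by (intro inV) simp
      have "Hf w \<le> Hf w'"
        by (rule w(2)[OF w'])
      moreover have "\<psi> w \<le> \<psi> w' - m w' \<bullet> (w - w')"
        by (rule sub_ineq[OF w'V wV])
      ultimately have "m w' \<bullet> (w - w') + (norm (w - xs))\<^sup>2 / (2 * r) + x \<bullet> (w' - w) \<le> (norm (w' - xs))\<^sup>2 / (2 * r)"
        by (simp add: Hf_def inner_diff_right)
      also have "(norm (w' - xs))\<^sup>2 / (2 * r) = (norm (w - xs))\<^sup>2 / (2 * r) - t * (G \<bullet> ((1 / r) *\<^sub>R (w - xs))) + t\<^sup>2 * (norm G)\<^sup>2 / (2 * r)"
        using r norm_sq_diff_expand[of w' xs w]
        by (simp add: w'_def power_mult_distrib add_divide_distrib diff_divide_distrib)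
      finally have le: "m w' \<bullet> (w - w') + x \<bullet> (w' - w) + t * (G \<bullet> ((1 / r) *\<^sub>R (w - xs))) \<le> t\<^sup>2 * (norm G)\<^sup>2 / (2 * r)"
        by simp
      have ww: "w - w' = t *\<^sub>R G" "w' - w = - (t *\<^sub>R G)"
        by (simp_all add: w'_def)
      have "t * (G \<bullet> (m w' + (1 / r) *\<^sub>R (w - xs) - x)) \<le> t\<^sup>2 * (norm G)\<^sup>2 / (2 * r)"
        using le unfolding ww
        by (simp only: inner_add_right inner_diff_right inner_minus_right inner_scaleR_right inner_commute[of _ G]
            distrib_left right_diff_distrib)
      then have "t * (G \<bullet> (m w' + (1 / r) *\<^sub>R (w - xs) - x)) \<le> t * (t * (norm G)\<^sup>2 / (2 * r))"
        by (simp add: power2_eq_square)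
      then have "G \<bullet> (m w' + (1 / r) *\<^sub>R (w - xs) - x) \<le> t * (norm G)\<^sup>2 / (2 * r)"
        using t(1) by (simp only: mult_le_cancel_left_pos)
      moreover have "m w' + (1 / r) *\<^sub>R (w - xs) - x = G - (m w - m w')"
        by (simp add: G_def)
      moreover have "G \<bullet> (m w - m w') \<le> norm G * (\<kappa> * (t * norm G))"
      proof -
        have "norm (m w - m w') \<le> \<kappa> * norm (w - w')"
          using lip[OF wV w'V] by (simp add: dist_norm)
        also have "norm (w - w') = t * norm G"
          using t by (simp add: w'_def)
        finally have "norm G * norm (m w - m w') \<le> norm G * (\<kappa> * (t * norm G))"
          by (intro mult_left_mono) auto
        then show ?thesis
          using norm_cauchy_schwarz[of G "m w - m w'"] by linarith
      qed
      ultimately have "G \<bullet> G \<le> norm G * (\<kappa> * (t * norm G)) + t * (norm G)\<^sup>2 / (2 * r)"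
        by (simp add: inner_diff_right)
      also have "\<dots> = (t * K) * (norm G)\<^sup>2"
        by (simp add: K_def power2_eq_square distrib_left distrib_right)
      also have "\<dots> < 1 * (norm G)\<^sup>2"
        using t nz by (intro mult_strict_right_mono) auto
      finally show False
        by (simp add: power2_norm_eq_inner)
    qed
    define z where "z = m w"
    have zx: "xs - w = - (r *\<^sub>R (x - z))"
    proof -
      have "r *\<^sub>R (z + (1 / r) *\<^sub>R (w - xs) - x) = 0"
        using \<open>G = 0\<close> by (simp add: G_def z_def)
      then have "r *\<^sub>R z + (w - xs) - r *\<^sub>R x = 0"
        using r by (simp add: scaleR_add_right scaleR_diff_right)
      then show ?thesis
        by (simp add: algebra_simps)
    qed
    have wn: "norm w \<le> \<rho>"
      using w_int by simp
    have "(xs - w) \<bullet> (x - z) \<ge> - c * (norm (x - z))\<^sup>2"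
      unfolding z_def using wn \<rho>
      by (intro hypo_mono[OF H x m_M(1)[OF wV] m_\<delta>(1)[OF wn] _ m_normal[OF wn]]) auto
    then have "c * (norm (x - z))\<^sup>2 \<le> 0"
      unfolding zx by (simp add: r_def power2_norm_eq_inner[symmetric])
    then have "x = z"
      using c by (simp add: mult_le_0_iff)
    then show ?thesis
      using zx by (simp add: z_def)
  qed
  \<comment> \<open>The descent lemma for \<open>-\<psi>\<close>, whose gradient \<open>m\<close>
    has Lipschitz constant \<kappa>.\<close>
  have upper: "\<psi> v - m v \<bullet> d - \<kappa> / 2 * (norm d)\<^sup>2 \<le> \<psi> (v + d)" if v: "v \<in> ball 0 \<rho>0" "v + d \<in> ball 0 \<rho>0" for v d
  proof -
    define \<phi> where "\<phi> s = \<psi> (v + s *\<^sub>R d) + s * (m v \<bullet> d) + \<kappa> / 2 * s\<^sup>2 * (norm d)\<^sup>2" for s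
    define \<phi>' where "\<phi>' s = - (m (v + s *\<^sub>R d) \<bullet> d) + m v \<bullet> d + \<kappa> * s * (norm d)\<^sup>2" for s
    have seg: "v + s *\<^sub>R d \<in> ball 0 \<rho>0" if "0 \<le> s" "s \<le> 1" for s
    proof -
      have "(1 - s) *\<^sub>R v + s *\<^sub>R (v + d) \<in> ball 0 \<rho>0"
        by (rule convexD_alt[OF convex_ball v that])
      then show ?thesis
        by (simp add: algebra_simps)
    qed
    have "\<phi> 0 \<le> \<phi> 1"
    proof (rule DERIV_nonneg_imp_nondecreasing[of 0 1 \<phi>])
      fix s :: real
      assume s: "0 \<le> s" "s \<le> 1"
      define a where "a = v + s *\<^sub>R d"
      have aV: "a \<in> V"
        unfolding a_def using seg[OF s] \<rho>0(2) by blast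
      \<comment> \<open>Differentiability by sandwiching: \<open>sub_ineq\<close> in both orders
        leaves an error of at most \<kappa> times the squared increment.\<close>
      have "((\<lambda>s. \<psi> (v + s *\<^sub>R d)) has_real_derivative - (m a \<bullet> d)) (at s)"
        unfolding has_field_derivative_def has_derivative_at_alt
      proof (intro conjI allI impI)
        show "bounded_linear ((*) (- (m a \<bullet> d)))"
          by (rule bounded_linear_mult_right)
        fix e :: real
        assume e: "e > 0"
        have "open ((\<lambda>s. v + s *\<^sub>R d) -` V)"
          by (intro open_vimage V(1) continuous_intros)
        moreover have "s \<in> (\<lambda>s. v + s *\<^sub>R d) -` V"
          using aV by (simp add: a_def)
        ultimately obtain e1 where e1: "e1 > 0" "ball s e1 \<subseteq> (\<lambda>s. v + s *\<^sub>R d) -` V"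
          using openE by blast
        define e2 where "e2 = e / (\<kappa> * (norm d)\<^sup>2 + 1)"
        have den: "\<kappa> * (norm d)\<^sup>2 + 1 > 0"
          using \<kappa> by (simp add: add_nonneg_pos)
        have e2: "e2 > 0" "(\<kappa> * (norm d)\<^sup>2) * e2 \<le> e"
        proof -
          show "e2 > 0"
            using e den by (simp add: e2_def)
          have "(\<kappa> * (norm d)\<^sup>2) * e2 \<le> (\<kappa> * (norm d)\<^sup>2 + 1) * e2"
            using \<open>e2 > 0\<close> by (simp add: distrib_right)
          also have "\<dots> = e"
            using den by (simp add: e2_def)
          finally show "(\<kappa> * (norm d)\<^sup>2) * e2 \<le> e" .
        qed
        show "\<exists>\<delta>'>0. \<forall>s'. norm (s' - s) < \<delta>' \<longrightarrow>
            norm (\<psi> (v + s' *\<^sub>R d) - \<psi> (v + s *\<^sub>R d) - - (m a \<bullet> d) * (s' - s)) \<le> e * norm (s' - s)"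
        proof (intro exI[of _ "min e1 e2"] conjI allI impI)
          show "0 < min e1 e2"
            using e1 e2 by simp
          fix s'
          assume s': "norm (s' - s) < min e1 e2"
          define b where "b = v + s' *\<^sub>R d"
          have "s' \<in> ball s e1"
            using s' by (simp add: dist_real_def abs_minus_commute)
          then have bV: "b \<in> V"
            using e1(2) by (auto simp: b_def)
          have ba: "b - a = (s' - s) *\<^sub>R d"
            by (simp add: a_def b_def scaleR_diff_left)
          have "\<psi> b \<le> \<psi> a - m a \<bullet> (b - a)" "\<psi> a \<le> \<psi> b - m b \<bullet> (a - b)"
            by (rule sub_ineq[OF aV bV], rule sub_ineq[OF bV aV])
          then have "\<bar>\<psi> b - \<psi> a + m a \<bullet> (b - a)\<bar> \<le> (m b - m a) \<bullet> (b - a)"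
            by (simp add: inner_diff_left inner_diff_right abs_le_iff)
          also have "\<dots> \<le> norm (m b - m a) * norm (b - a)"
            by (rule norm_cauchy_schwarz)
          also have "\<dots> \<le> \<kappa> * norm (b - a) * norm (b - a)"
            using lip[OF bV aV] by (intro mult_right_mono) (auto simp: dist_norm)
          also have "\<dots> = (\<kappa> * (norm d)\<^sup>2) * \<bar>s' - s\<bar> * \<bar>s' - s\<bar>"
            by (simp add: ba power2_eq_square)
          also have "\<dots> \<le> (\<kappa> * (norm d)\<^sup>2) * e2 * \<bar>s' - s\<bar>"
            using s' \<kappa> by (intro mult_right_mono mult_left_mono) auto
          also have "\<dots> \<le> e * \<bar>s' - s\<bar>"
            using e2 by (intro mult_right_mono) auto
          finally show "norm (\<psi> (v + s' *\<^sub>R d) - \<psi> (v + s *\<^sub>R d) - - (m a \<bullet> d) * (s' - s)) \<le> e * norm (s' - s)"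
            by (simp add: ba flip: a_def b_def) (simp add: mult.commute)
        qed
      qed
      then have D: "(\<phi> has_real_derivative \<phi>' s) (at s)"
        unfolding \<phi>_def \<phi>'_def a_def by (auto intro!: derivative_eq_intros)
      have "(m a - m v) \<bullet> d \<le> norm (m a - m v) * norm d"
        by (rule norm_cauchy_schwarz)
      also have "norm (m a - m v) \<le> \<kappa> * (s * norm d)"
        using lip[OF aV subsetD[OF \<rho>0(2) v(1)]] s by (simp add: dist_norm a_def)
      then have "norm (m a - m v) * norm d \<le> \<kappa> * (s * norm d) * norm d"
        by (intro mult_right_mono) auto
      finally have "\<phi>' s \<ge> 0"
        by (simp add: \<phi>'_def inner_diff_left power2_eq_square flip: a_def)
      with D show "\<exists>y. (\<phi> has_real_derivative y) (at s) \<and> 0 \<le> y"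
        by blast
    qed simp
    then show ?thesis
      by (simp add: \<phi>_def)
  qed
  \<comment> \<open>The two bounds with \<rho>0 keep \<open>xs + d\<close> where \<open>m\<close> is
    controlled, with \<kappa> accounting for \<open>d = (x' - x) / \<kappa>\<close>;
    \<open>\<rho> / (4 * r + 4)\<close> and \<delta> are for \<open>is_m\<close>, and
    \<open>\<gamma> / 2\<close> makes \<open>x'\<close> admissible in the tilted problem.\<close>
  define \<eta> where "\<eta> = Min {\<delta>, \<rho> / (4 * r + 4), \<gamma> / 2, \<rho>0 / 4, \<rho>0 * \<kappa> / 4}"
  have "\<eta> > 0"
    using \<delta> \<rho> r \<gamma> \<rho>0 \<kappa> by (simp add: \<eta>_def add_pos_pos)
  moreover have "\<eta> \<le> \<delta>" "\<eta> \<le> \<rho> / (4 * r + 4)" "\<eta> \<le> \<gamma> / 2" "\<eta> \<le> \<rho>0 / 4" "\<eta> \<le> \<rho>0 * \<kappa> / 4"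
    unfolding \<eta>_def by (rule Min_le; simp)+
  ultimately have \<eta>0: "\<eta> > 0" "\<eta> \<le> \<delta>" "\<eta> \<le> \<rho> / (4 * r + 4)" "\<eta> \<le> \<gamma> / 2" "\<eta> \<le> \<rho>0 / 4" "\<eta> \<le> \<rho>0 * \<kappa> / 4"
    by blast+
  have \<eta>_\<rho>: "\<eta> * (4 * r + 4) \<le> \<rho>"
    using \<eta>0(3) r by (simp add: pos_le_divide_eq add_pos_pos)
  have \<eta>1: "2 * r * \<eta> + 2 * \<eta> < \<rho>"
  proof -
    have "0 < \<eta> * (4 * r + 4)" and "2 * r * \<eta> + 2 * \<eta> = \<eta> * (4 * r + 4) / 2"
      using \<eta>0(1) r by (simp_all add: field_simps add_pos_pos)
    then show ?thesis
      using \<eta>_\<rho> by linarith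
  qed
  show ?thesis
  proof (rule that[OF \<eta>0(1)])
    fix x x' xs
    assume x: "x \<in> \<Gamma>" "x' \<in> \<Gamma>" "norm (x - xbar) \<le> \<eta>" "norm (x' - x) \<le> \<eta>" and xs: "norm xs \<le> \<eta>" "xs - f' x \<in> N x"
    have "2 * r * norm (x - xbar) \<le> 2 * r * \<eta>"
      using x(3) r by simp
    then have small: "2 * r * norm (x - xbar) + 2 * norm xs < \<rho>"
      using \<eta>1 xs(1) by linarith
    have "x \<in> cball xbar \<delta>" "norm xs \<le> \<delta>"
      using x(3) xs(1) \<eta>0(2) by (simp_all add: dist_norm norm_minus_commute)
    then have xm: "x = m xs"
      by (rule is_m[OF x(1) _ _ xs(2) small])
    \<comment> \<open>This \<open>d\<close> maximizes
      \<open>d \<bullet> (x' - x) - \<kappa> / 2 * (norm d)\<^sup>2\<close>; it evaluates the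
      conjugate of the quadratic bound.\<close>
    define d where "d = (1 / \<kappa>) *\<^sub>R (x' - x)"
    have "norm d \<le> \<rho>0 / 4"
    proof -
      have "norm (x' - x) \<le> \<rho>0 * \<kappa> / 4"
        using x(4) \<eta>0(6) by linarith
      moreover have "norm d = norm (x' - x) / \<kappa>"
        using \<kappa> by (simp add: d_def)
      ultimately show ?thesis
        using \<kappa> by (simp add: pos_divide_le_eq mult.commute)
    qed
    moreover have "norm xs \<le> \<rho>0 / 4"
      using xs(1) \<eta>0(5) by linarith
    ultimately have "norm xs < \<rho>0" "norm (xs + d) < \<rho>0"
      using norm_triangle_ineq[of xs d] \<rho>0(1) by linarith+
    then have b: "xs \<in> ball 0 \<rho>0" "xs + d \<in> ball 0 \<rho>0"
      by simp_all
    have near: "norm (x' - xbar) \<le> \<gamma>"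
      using x(3,4) \<eta>0(4) norm_triangle_ineq[of "x' - x" "x - xbar"] by simp
    have "\<psi> xs - m xs \<bullet> d - \<kappa> / 2 * (norm d)\<^sup>2 \<le> \<psi> (xs + d)"
      by (rule upper[OF b])
    also have "\<psi> (xs + d) \<le> f x' - (xs + d) \<bullet> x'"
      by (rule m_M(3)[OF subsetD[OF \<rho>0(2) b(2)] x(2) near])
    finally have "f x + xs \<bullet> (x' - x) + (d \<bullet> (x' - x) - \<kappa> / 2 * (norm d)\<^sup>2) \<le> f x'"
      by (simp add: \<psi>_def xm[symmetric] inner_add_left inner_add_right inner_diff_right inner_commute)
    moreover have "d \<bullet> (x' - x) - \<kappa> / 2 * (norm d)\<^sup>2 = (norm (x' - x))\<^sup>2 / (2 * \<kappa>)"
    proof -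
      have "d \<bullet> (x' - x) = (norm (x' - x))\<^sup>2 / \<kappa>"
        by (simp add: d_def power2_norm_eq_inner)
      moreover have "\<kappa> / 2 * (norm d)\<^sup>2 = (norm (x' - x))\<^sup>2 / (2 * \<kappa>)"
      proof -
        have "norm d = norm (x' - x) / \<kappa>"
          using \<kappa> by (simp add: d_def)
        then show ?thesis
          using \<kappa> by (simp add: power2_eq_square)
      qed
      moreover have "(norm (x' - x))\<^sup>2 / \<kappa> = 2 * ((norm (x' - x))\<^sup>2 / (2 * \<kappa>))"
        by simp
      ultimately show ?thesis
        by linarith
    qed
    ultimately show "f x' \<ge> f x + xs \<bullet> (x' - x) + (norm (x' - x))\<^sup>2 / (2 * \<kappa>)"
      by simp
  qed
qed

text \<open>Growth is evaluated along arcs whose cost \<open>- (y \<bullet> W)\<close> exceeds the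
  maximal Lagrangian form by at most \<open>e\<close>; the Taylor expansion of \<open>f\<close>
  supplies the Hessian term. The estimate covers all directional multipliers, so both restricted
  conditions follow from it.\<close>

lemma necessity:
  assumes tilt: "tilt_stable f g xbar \<kappa>" and \<kappa>: "\<kappa> > 0"
  obtains \<eta> where "\<eta> > 0" "\<And>x xs u lam. x \<in> \<Gamma> \<Longrightarrow> norm (x - xbar) \<le> \<eta> \<Longrightarrow> norm xs \<le> \<eta> \<Longrightarrow>
    u \<in> crit_cone \<Gamma> x (xs - f' x) \<Longrightarrow> norm u = 1 \<Longrightarrow> lam \<in> dir_mults g Dg D2g x (xs - f' x) u \<Longrightarrow>
    hess x u + lq x lam u \<ge> 1 / \<kappa>"
proof -
  obtain \<eta>1 where \<eta>1: "\<eta>1 > 0"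
    and growth: "\<And>x x' xs. x \<in> \<Gamma> \<Longrightarrow> x' \<in> \<Gamma> \<Longrightarrow> norm (x - xbar) \<le> \<eta>1 \<Longrightarrow> norm (x' - x) \<le> \<eta>1 \<Longrightarrow>
    norm xs \<le> \<eta>1 \<Longrightarrow> xs - f' x \<in> N x \<Longrightarrow> f x' \<ge> f x + xs \<bullet> (x' - x) + (norm (x' - x))\<^sup>2 / (2 * \<kappa>)"
    by (rule tilt_stable_growth[OF tilt \<kappa>]) blast
  obtain \<delta>1 where \<delta>1: "\<delta>1 > 0" "\<And>x lam y. x \<in> \<Gamma> \<Longrightarrow> x \<in> ball xbar \<delta>1 \<Longrightarrow> lam \<in> mlt x y \<Longrightarrow> y \<in> N x"
    by (rule multiplier_regular_normal) blast
  obtain \<delta>2 where \<delta>2: "\<delta>2 > 0" "ball xbar \<delta>2 \<subseteq> U"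
    using open_U xbar_U openE by blast
  define \<eta> where "\<eta> = Min {\<eta>1, \<delta>1 / 2, \<delta>2 / 2}"
  have \<eta>: "\<eta> > 0" "\<eta> \<le> \<eta>1" "\<eta> < \<delta>1" "\<eta> < \<delta>2"
    using \<eta>1 \<delta>1(1) \<delta>2(1) by (auto simp: \<eta>_def)
  show ?thesis
  proof (rule that[OF \<eta>(1)])
    fix x xs u lam
    assume x: "x \<in> \<Gamma>" "norm (x - xbar) \<le> \<eta>" and xs: "norm xs \<le> \<eta>"
      and u: "u \<in> crit_cone \<Gamma> x (xs - f' x)" "norm u = 1" and lam: "lam \<in> dir_mults g Dg D2g x (xs - f' x) u"
    define y where "y = xs - f' x"
    have xU: "x \<in> U"
      using x(2) \<eta> by (intro subsetD[OF \<delta>2(2)]) (simp add: dist_norm norm_minus_commute)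
    have lam_m: "lam \<in> mlt x y" and lam_max: "\<And>mu. mu \<in> mlt x y \<Longrightarrow> lq x mu u \<le> lq x lam u"
      using lam by (auto simp: dir_mults_def y_def)
    have yN: "y \<in> N x"
      using x \<eta> by (intro \<delta>1(2)[OF x(1) _ lam_m]) (simp add: dist_norm norm_minus_commute)
    have uT: "u \<in> tangent_cone \<Gamma> x" and yu: "y \<bullet> u = 0"
      using u by (auto simp: crit_cone_def y_def)
    show "hess x u + lq x lam u \<ge> 1 / \<kappa>"
    proof (rule field_le_epsilon)
      fix e :: real
      assume e: "e > 0"
      define \<beta> where "\<beta> = lq x lam u + e"
      have none: "lq x mu u < \<beta>" if "mu \<in> mlt x y" "norm mu \<le> \<sigma> * norm y" for mu
        using lam_max[OF that(1)] e by (simp add: \<beta>_def)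
      define t where "t k = inverse (real (Suc k))" for k
      have t: "\<And>k. 0 < t k" "t \<longlonglongrightarrow> 0"
        unfolding t_def using LIMSEQ_inverse_real_of_nat by auto
      obtain W K where K: "\<And>k. norm (W k) \<le> K"
        and ev: "\<forall>\<^sub>F k in sequentially. x + t k *\<^sub>R u + ((t k)\<^sup>2 / 2) *\<^sub>R W k \<in> \<Gamma>"
        and W: "\<And>k. - (y \<bullet> W k) \<le> \<beta>"
        by (rule feasible_arc[OF x(1) xU uT yu none t]) (assumption | rule that)+
      define d where "d k = u + (t k / 2) *\<^sub>R W k" for k
      have d_lim: "d \<longlonglongrightarrow> u"
        unfolding d_def by (rule arc_direction_tendsto[OF t(2) K])
      have d_eq: "x + t k *\<^sub>R u + ((t k)\<^sup>2 / 2) *\<^sub>R W k = x + t k *\<^sub>R d k" for k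
        by (simp add: d_def scaleR_add_right power2_eq_square)
      have "(\<lambda>k. t k *\<^sub>R d k) \<longlonglongrightarrow> 0 *\<^sub>R u"
        by (intro tendsto_intros t d_lim)
      then have "\<forall>\<^sub>F k in sequentially. norm (t k *\<^sub>R d k) < \<eta>1"
        using \<eta>1 by (intro order_tendstoD(2)[of _ "norm (0 *\<^sub>R u)"] tendsto_norm) auto
      with ev have "\<forall>\<^sub>F k in sequentially. - \<beta> + (norm (d k))\<^sup>2 / \<kappa> \<le>
          (2 / (t k)\<^sup>2) * (f (x + t k *\<^sub>R d k) - f x - t k * (f' x \<bullet> d k))"
      proof eventually_elim
        case (elim k)
        have tk: "t k > 0"
          by (rule t(1))
        have "f (x + t k *\<^sub>R d k) \<ge> f x + xs \<bullet> ((x + t k *\<^sub>R d k) - x) + (norm ((x + t k *\<^sub>R d k) - x))\<^sup>2 / (2 * \<kappa>)"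
          using elim x \<eta> xs yN unfolding d_eq by (intro growth) (auto simp: y_def)
        then have "t k * (y \<bullet> d k) + (t k)\<^sup>2 * (norm (d k))\<^sup>2 / (2 * \<kappa>) \<le> f (x + t k *\<^sub>R d k) - f x - t k * (f' x \<bullet> d k)"
          by (simp add: y_def inner_diff_left power_mult_distrib right_diff_distrib)
        moreover have "t k * (y \<bullet> d k) = (t k)\<^sup>2 / 2 * (y \<bullet> W k)"
          using yu by (simp add: d_def inner_add_right power2_eq_square)
        moreover have "(t k)\<^sup>2 / 2 * (- \<beta>) \<le> (t k)\<^sup>2 / 2 * (y \<bullet> W k)"
          using W[of k] by (intro mult_left_mono) auto
        moreover have "(t k)\<^sup>2 / 2 * (- \<beta> + (norm (d k))\<^sup>2 / \<kappa>) = (t k)\<^sup>2 / 2 * (- \<beta>) + (t k)\<^sup>2 * (norm (d k))\<^sup>2 / (2 * \<kappa>)"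
          by (simp add: right_diff_distrib diff_divide_distrib)
        ultimately have "(t k)\<^sup>2 / 2 * (- \<beta> + (norm (d k))\<^sup>2 / \<kappa>) \<le> f (x + t k *\<^sub>R d k) - f x - t k * (f' x \<bullet> d k)"
          by linarith
        then have "(2 / (t k)\<^sup>2) * ((t k)\<^sup>2 / 2 * (- \<beta> + (norm (d k))\<^sup>2 / \<kappa>)) \<le> (2 / (t k)\<^sup>2) * (f (x + t k *\<^sub>R d k) - f x - t k * (f' x \<bullet> d k))"
          by (intro mult_left_mono) auto
        moreover have "(2 / (t k)\<^sup>2) * ((t k)\<^sup>2 / 2 * X) = X" for X
          using tk by simp
        ultimately show ?case
          by (simp only:)
      qed
      moreover have "(\<lambda>k. (2 / (t k)\<^sup>2) * (f (x + t k *\<^sub>R d k) - f x - t k * (f' x \<bullet> d k))) \<longlonglongrightarrow> hess x u"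
        by (rule f_taylor_seq[OF xU t d_lim])
      moreover have "(\<lambda>k. - \<beta> + (norm (d k))\<^sup>2 / \<kappa>) \<longlonglongrightarrow> - \<beta> + (norm u)\<^sup>2 / \<kappa>"
        using \<kappa> by (intro tendsto_intros d_lim) auto
      ultimately have "- \<beta> + (norm u)\<^sup>2 / \<kappa> \<le> hess x u"
        using tendsto_le[OF trivial_limit_sequentially] by blast
      then show "1 / \<kappa> \<le> hess x u + lq x lam u + e"
        using u(2) by (simp add: \<beta>_def)
    qed
  qed
qed

section \<open>The characterization\<close>

text \<open>A condition on bounded multipliers has content only where such multipliers exist.
  \<open>dir_mults_exist\<close> provides them for normals at points of \<open>U\<close>, hence the
  smaller radius.\<close>

lemma second_order_shrink:
  assumes "\<eta> > 0"
    and ex: "\<And>x xs u lam. x \<in> \<Gamma> \<Longrightarrow> norm (x - xbar) \<le> \<eta> \<Longrightarrow> norm xs \<le> \<eta> \<Longrightarrow>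
      u \<in> crit_cone \<Gamma> x (xs - f' x) \<Longrightarrow> norm u = 1 \<Longrightarrow> lam \<in> dir_mults g Dg D2g x (xs - f' x) u \<Longrightarrow>
      norm lam \<le> \<sigma> * norm (xs - f' x) \<Longrightarrow> hess x u + lq x lam u \<ge> 1 / \<kappa>"
  shows "\<exists>\<eta>>0. second_order \<kappa> \<eta>"
proof -
  obtain \<delta> where \<delta>: "\<delta> > 0" "cball xbar \<delta> \<subseteq> U"
    using open_U xbar_U open_contains_cball by blast
  have "second_order \<kappa> (min \<eta> \<delta>)"
    unfolding second_order_def
  proof (intro allI impI)
    fix x xs u
    assume x: "x \<in> \<Gamma>" "norm (x - xbar) \<le> min \<eta> \<delta>" and xs: "norm xs \<le> min \<eta> \<delta>" "xs - f' x \<in> N x"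
      and u: "u \<in> crit_cone \<Gamma> x (xs - f' x)" "norm u = 1"
    have "x \<in> U"
      using x(2) by (intro subsetD[OF \<delta>(2)]) (simp add: dist_norm norm_minus_commute)
    then obtain lam where lam: "lam \<in> dir_mults g Dg D2g x (xs - f' x) u" "norm lam \<le> \<sigma> * norm (xs - f' x)"
      by (rule dir_mults_exist[OF x(1) _ xs(2) u(1)])
    then have "hess x u + lq x lam u \<ge> 1 / \<kappa>"
      using x xs by (intro ex[OF x(1) _ _ u lam]) auto
    with lam show "\<exists>lam\<in>dir_mults g Dg D2g x (xs - f' x) u. hess x u + lq x lam u \<ge> 1 / \<kappa>"
      by blast
  qed
  then show ?thesis
    using assms(1) \<delta>(1) by (intro exI[of _ "min \<eta> \<delta>"]) simp
qed

lemma tilt_stable_iff_bounded: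
  assumes stat: "- f' xbar \<in> N xbar" and \<kappa>: "\<kappa> > 0"
  shows "tilt_stable f g xbar \<kappa> \<longleftrightarrow>
      (\<exists>\<eta>>0. \<forall>x xs u lam. x \<in> feas g \<and> norm (x - xbar) \<le> \<eta> \<and> norm xs \<le> \<eta> \<and>
          u \<in> crit_cone (feas g) x (xs - f' x) \<and> norm u = 1 \<and>
          lam \<in> dir_mults g Dg D2g x (xs - f' x) u \<and> norm lam \<le> \<sigma> * norm (xs - f' x) \<longrightarrow>
          blinfun_apply (f'' x) u \<bullet> u + lagr_quad g Dg D2g x lam u \<ge> 1 / \<kappa>)"
    (is "?T \<longleftrightarrow> ?B")
proof
  assume ?T
  then show ?B
    by (rule necessity[OF _ \<kappa>]) blast
next
  assume ?B
  then have "\<exists>\<eta>>0. second_order \<kappa> \<eta>"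
    by (elim exE conjE) (rule second_order_shrink, assumption, blast)
  then show ?T
    using sufficiency[OF stat \<kappa>] by blast
qed

lemma tilt_stable_iff_mults0:
  assumes stat: "- f' xbar \<in> N xbar" and \<kappa>: "\<kappa> > 0"
  shows "tilt_stable f g xbar \<kappa> \<longleftrightarrow>
      (\<exists>\<eta>>0. \<forall>x xs u lam. x \<in> feas g \<and> norm (x - xbar) \<le> \<eta> \<and> norm xs \<le> \<eta> \<and>
          u \<in> crit_cone (feas g) x (xs - f' x) \<and> norm u = 1 \<and>
          lam \<in> dir_mults g Dg D2g x (xs - f' x) u \<and> lam \<in> mults0 g Dg x (xs - f' x) \<longrightarrow>
          blinfun_apply (f'' x) u \<bullet> u + lagr_quad g Dg D2g x lam u \<ge> 1 / \<kappa>)"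
    (is "?T \<longleftrightarrow> ?B")
proof
  assume ?T
  then show ?B
    by (rule necessity[OF _ \<kappa>]) blast
next
  assume ?B
  \<comment> \<open>For \<open>y = 0\<close> the norm bound forces \<open>lam = 0\<close>, so
    bounded directional multipliers always belong to \<open>mults0\<close>.\<close>
  moreover have "lam \<in> mults0 g Dg x y" if "lam \<in> dir_mults g Dg D2g x y u" "norm lam \<le> \<sigma> * norm y" for lam x y u
    using that by (auto simp: mults0_def dir_mults_def)
  ultimately have "\<exists>\<eta>>0. second_order \<kappa> \<eta>"
    by (elim exE conjE) (rule second_order_shrink, assumption, blast)
  then show ?T
    using sufficiency[OF stat \<kappa>] by blast
qed

section \<open>The exact bound of tilt stability\<close>

lemma tilt_bound_le:
  assumes tilt: "tilt_stable f g xbar \<kappa>" and \<kappa>: "\<kappa> > 0"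
  shows "tilt_bound f g xbar \<le> ereal \<kappa>"
proof -
  from tilt obtain \<gamma> V m where \<gamma>: "\<gamma> > 0" and V: "open V" "0 \<in> V" "Mtilt f g xbar \<gamma> 0 = {xbar}"
    "\<forall>v\<in>V. Mtilt f g xbar \<gamma> v = {m v}" "\<forall>v\<in>V. \<forall>w\<in>V. dist (m v) (m w) \<le> \<kappa> * dist v w"
    unfolding tilt_stable_def by blast
  have "lipM f g xbar \<gamma> \<le> ereal \<kappa>"
    unfolding lipM_def using V \<kappa> by (intro Inf_lower CollectI exI[of _ \<kappa>]) auto
  then show ?thesis
    unfolding tilt_bound_def using \<gamma> by (intro INF_lower2[of \<gamma>]) auto
qed

lemma tilt_stable_if_bound_less:
  assumes "tilt_bound f g xbar < ereal \<kappa>"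
  shows "\<kappa> > 0" "tilt_stable f g xbar \<kappa>"
proof -
  obtain \<gamma> where \<gamma>: "\<gamma> > 0" "lipM f g xbar \<gamma> < ereal \<kappa>"
    using assms unfolding tilt_bound_def INF_less_iff by auto
  obtain l V m where l: "l \<ge> 0" "l < \<kappa>" and V: "open V" "0 \<in> V" "Mtilt f g xbar \<gamma> 0 = {xbar}"
    "\<forall>v\<in>V. Mtilt f g xbar \<gamma> v = {m v}" "\<forall>v\<in>V. \<forall>w\<in>V. dist (m v) (m w) \<le> l * dist v w"
    using \<gamma>(2) unfolding lipM_def Inf_less_iff by auto
  show "\<kappa> > 0"
    using l by simp
  have "dist (m v) (m w) \<le> \<kappa> * dist v w" if "v \<in> V" "w \<in> V" for v w
    using V(5) that mult_right_mono[of l \<kappa> "dist v w"] l by force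
  then show "tilt_stable f g xbar \<kappa>"
    unfolding tilt_stable_def using \<gamma>(1) V by blast
qed

text \<open>Both sides are compared with an arbitrary larger threshold, by means of the
  characterization with that threshold as modulus. The inserted 0 matters when no tuple is
  admissible: the supremum is then 0 instead of minus infinity, in accordance with Lipschitz
  constants being nonnegative.\<close>

lemma exact_bound:
  assumes stat: "- f' xbar \<in> N xbar" and \<kappa>: "\<kappa> > 0" and tilt: "tilt_stable f g xbar \<kappa>"
  shows "tilt_bound f g xbar =
        (INF \<eta>\<in>{0<..}. Sup (insert 0
           {ereal (1 / (blinfun_apply (f'' x) u \<bullet> u + lagr_quad g Dg D2g x lam u)) | x xs u lam.
              x \<in> feas g \<and> norm (x - xbar) \<le> \<eta> \<and> norm xs \<le> \<eta> \<and>
              u \<in> crit_cone (feas g) x (xs - f' x) \<and> norm u = 1 \<and>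
              lam \<in> dir_mults g Dg D2g x (xs - f' x) u \<and> norm lam \<le> \<sigma> * norm (xs - f' x)}))"
    (is "_ = (INF \<eta>\<in>{0<..}. Sup (insert 0 (?Q \<eta>)))")
proof (rule antisym)
  define admissible where "admissible \<eta> x xs u lam \<longleftrightarrow> x \<in> feas g \<and> norm (x - xbar) \<le> \<eta> \<and> norm xs \<le> \<eta> \<and>
              u \<in> crit_cone (feas g) x (xs - f' x) \<and> norm u = 1 \<and>
              lam \<in> dir_mults g Dg D2g x (xs - f' x) u \<and> norm lam \<le> \<sigma> * norm (xs - f' x)" for \<eta> x xs u lam
  have iff: "tilt_stable f g xbar k \<longleftrightarrow> (\<exists>\<eta>>0. \<forall>x xs u lam. admissible \<eta> x xs u lam \<longrightarrow> hess x u + lq x lam u \<ge> 1 / k)"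
    if "k > 0" for k
    unfolding admissible_def by (rule tilt_stable_iff_bounded[OF stat that])
  have Q: "?Q \<eta> = {ereal (1 / (hess x u + lq x lam u)) | x xs u lam. admissible \<eta> x xs u lam}" for \<eta>
    unfolding admissible_def ..
  show "(INF \<eta>\<in>{0<..}. Sup (insert 0 (?Q \<eta>))) \<le> tilt_bound f g xbar"
  proof (rule dense_ge)
    fix b
    assume b: "tilt_bound f g xbar < b"
    show "(INF \<eta>\<in>{0<..}. Sup (insert 0 (?Q \<eta>))) \<le> b"
    proof (cases b)
      case (real k)
      then have k: "k > 0" and "tilt_stable f g xbar k"
        using tilt_stable_if_bound_less b by auto
      then obtain \<eta> where \<eta>: "\<eta> > 0" "\<And>x xs u lam. admissible \<eta> x xs u lam \<Longrightarrow> hess x u + lq x lam u \<ge> 1 / k"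
        using iff[OF k] by blast
      have "s \<le> b" if s: "s \<in> insert 0 (?Q \<eta>)" for s
      proof (cases "s = 0")
        case True
        then show ?thesis
          using k real by simp
      next
        case False
        then obtain x xs u lam where adm: "admissible \<eta> x xs u lam" and s_eq: "s = ereal (1 / (hess x u + lq x lam u))"
          using s unfolding Q by blast
        have "1 / (hess x u + lq x lam u) \<le> 1 / (1 / k)"
          using \<eta>(2)[OF adm] k by (intro divide_left_mono mult_pos_pos) (auto intro: less_le_trans[of 0 "1 / k"])
        then show ?thesis
          using s_eq real by simp
      qed
      then have "Sup (insert 0 (?Q \<eta>)) \<le> b"
        by (rule Sup_least)
      then show ?thesis
        using \<eta>(1) by (intro INF_lower2[of \<eta>]) auto
    next
      case MInf
      then show ?thesis
        using b by simp
    qed simp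
  qed
  show "tilt_bound f g xbar \<le> (INF \<eta>\<in>{0<..}. Sup (insert 0 (?Q \<eta>)))"
  proof (rule INF_greatest)
    fix \<eta> :: real
    assume \<eta>: "\<eta> \<in> {0<..}"
    show "tilt_bound f g xbar \<le> Sup (insert 0 (?Q \<eta>))"
    proof (rule dense_ge)
      fix b
      assume b: "Sup (insert 0 (?Q \<eta>)) < b"
      then have "0 < b"
        using Sup_upper[of 0 "insert 0 (?Q \<eta>)"] by (meson insertI1 le_less_trans)
      show "tilt_bound f g xbar \<le> b"
      proof (cases b)
        case (real k)
        then have k: "k > 0"
          using \<open>0 < b\<close> by simp
        \<comment> \<open>An upper bound on reciprocals does not exclude negative values of the
          form. Stability with modulus \<kappa> makes the form positive near \<open>xbar\<close>,
          after which the reciprocals can be inverted.\<close>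
        obtain \<eta>1 where \<eta>1: "\<eta>1 > 0" "\<And>x xs u lam. admissible \<eta>1 x xs u lam \<Longrightarrow> hess x u + lq x lam u \<ge> 1 / \<kappa>"
          using iff[OF \<kappa>] tilt by blast
        have "hess x u + lq x lam u \<ge> 1 / k" if adm: "admissible (min \<eta> \<eta>1) x xs u lam" for x xs u lam
        proof -
          define q where "q = hess x u + lq x lam u"
          have "admissible \<eta>1 x xs u lam" and adm': "admissible \<eta> x xs u lam"
            using adm by (auto simp: admissible_def)
          then have "1 / \<kappa> \<le> q"
            using \<eta>1(2) by (simp add: q_def)
          then have q: "q > 0"
            using \<kappa> by (meson less_le_trans zero_less_divide_1_iff)
          have "ereal (1 / q) \<in> ?Q \<eta>"
            unfolding Q q_def using adm' by blast
          then have "ereal (1 / q) \<le> Sup (insert 0 (?Q \<eta>))"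
            by (intro Sup_upper) blast
          from le_less_trans[OF this b] have "1 / q \<le> k"
            unfolding real by simp
          then show ?thesis
            using q k by (simp add: q_def field_simps)
        qed
        then have "tilt_stable f g xbar k"
          unfolding iff[OF k] using \<eta> \<eta>1(1) by (intro exI[of _ "min \<eta> \<eta>1"]) auto
        then show ?thesis
          using tilt_bound_le k real by simp
      qed (use \<open>0 < b\<close> in auto)
    qed
  qed
qed

end

theorem theorem3p2:
  fixes f :: "'a::euclidean_space \<Rightarrow> real"
    and f' :: "'a \<Rightarrow> 'a"
    and f'' :: "'a \<Rightarrow> 'a \<Rightarrow>\<^sub>L 'a"
    and g :: "'a \<Rightarrow> real \<times> 'b::euclidean_space"
    and Dg :: "'a \<Rightarrow> 'a \<Rightarrow>\<^sub>L (real \<times> 'b)"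
    and D2g :: "'a \<Rightarrow> 'a \<Rightarrow>\<^sub>L 'a \<Rightarrow>\<^sub>L (real \<times> 'b)"
    and xbar :: 'a and \<sigma> \<kappa> :: real
  assumes C2f: "C2_around_f f f' f'' xbar"
    and C2g: "C2_around_g g Dg D2g xbar"
    and feasible: "xbar \<in> feas g"
    and g0: "g xbar = 0"
    and stat: "stationary f' g xbar"
    and sigma_pos: "\<sigma> > 0"
    and MSCQ: "mscq g xbar \<sigma>"
    and kappa_pos: "\<kappa> > 0"
  shows
   "(tilt_stable f g xbar \<kappa> \<longleftrightarrow>
      (\<exists>\<eta>>0. \<forall>x xs u lam. x \<in> feas g \<and> norm (x - xbar) \<le> \<eta> \<and> norm xs \<le> \<eta> \<and>
          u \<in> crit_cone (feas g) x (xs - f' x) \<and> norm u = 1 \<and>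
          lam \<in> dir_mults g Dg D2g x (xs - f' x) u \<and> norm lam \<le> \<sigma> * norm (xs - f' x) \<longrightarrow>
          blinfun_apply (f'' x) u \<bullet> u + lagr_quad g Dg D2g x lam u \<ge> 1 / \<kappa>))
  \<and> (tilt_stable f g xbar \<kappa> \<longleftrightarrow>
      (\<exists>\<eta>>0. \<forall>x xs u lam. x \<in> feas g \<and> norm (x - xbar) \<le> \<eta> \<and> norm xs \<le> \<eta> \<and>
          u \<in> crit_cone (feas g) x (xs - f' x) \<and> norm u = 1 \<and>
          lam \<in> dir_mults g Dg D2g x (xs - f' x) u \<and> lam \<in> mults0 g Dg x (xs - f' x) \<longrightarrow>
          blinfun_apply (f'' x) u \<bullet> u + lagr_quad g Dg D2g x lam u \<ge> 1 / \<kappa>))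
  \<and> (tilt_stable f g xbar \<kappa> \<longrightarrow>
      tilt_bound f g xbar =
        (INF \<eta>\<in>{0<..}. Sup (insert 0
           {ereal (1 / (blinfun_apply (f'' x) u \<bullet> u + lagr_quad g Dg D2g x lam u)) | x xs u lam.
              x \<in> feas g \<and> norm (x - xbar) \<le> \<eta> \<and> norm xs \<le> \<eta> \<and>
              u \<in> crit_cone (feas g) x (xs - f' x) \<and> norm u = 1 \<and>
              lam \<in> dir_mults g Dg D2g x (xs - f' x) u \<and> norm lam \<le> \<sigma> * norm (xs - f' x)})))"
proof -
  obtain U1 where U1: "open U1" "xbar \<in> U1" "\<And>x. x \<in> U1 \<Longrightarrow> (f has_derivative (\<lambda>h. f' x \<bullet> h)) (at x)"
    "\<And>x. x \<in> U1 \<Longrightarrow> (f' has_derivative blinfun_apply (f'' x)) (at x)" "continuous_on U1 f''"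
    using C2f unfolding C2_around_f_def by blast
  obtain U2 where U2: "open U2" "xbar \<in> U2" "\<And>x. x \<in> U2 \<Longrightarrow> (g has_derivative blinfun_apply (Dg x)) (at x)"
    "\<And>x. x \<in> U2 \<Longrightarrow> (Dg has_derivative blinfun_apply (D2g x)) (at x)" "continuous_on U2 D2g"
    using C2g unfolding C2_around_g_def by blast
  obtain U3 where U3: "open U3" "xbar \<in> U3" "\<And>x. x \<in> U3 \<Longrightarrow> infdist x (feas g) \<le> \<sigma> * infdist (g x) soc"
    using MSCQ unfolding mscq_def by blast
  interpret socp f f' f'' g Dg D2g xbar \<sigma> "U1 \<inter> U2 \<inter> U3"
  proof
    show "continuous_on (U1 \<inter> U2 \<inter> U3) f''" "continuous_on (U1 \<inter> U2 \<inter> U3) D2g"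
      by (rule continuous_on_subset[OF U1(5)], blast, rule continuous_on_subset[OF U2(5)], blast)
  qed (use U1 U2 U3 feasible sigma_pos in auto)
  note stat' = stationary_regular_normal[OF stat]
  show ?thesis
    by (intro conjI impI tilt_stable_iff_bounded[OF stat' kappa_pos] tilt_stable_iff_mults0[OF stat' kappa_pos]
        exact_bound[OF stat' kappa_pos])
qed

end
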